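(* Let $\Delta^{G}$ be a $\pi$-connection of degree $s$ on $\mathrm{GL}_n$. For every non-degenerate curve $c\in R^n$ and every vector $w^{(0)}\in R^n$ there exists a unique vector $w\in R^n$ such that $w$ is parallel along $c$ with respect to $\Delta^{G}$ and $w\equiv w^{(0)}$ mod $p$.
   Context: $p$ odd prime; $R$ the $p$-adic completion of the ring of integers of the maximal unramified extension of $\mathbb Q_p$, $K=R[1/p]$; $\phi$ the unique Frobenius lift on $R$; for $a\in R$, $a^{\phi^s}=\phi^s(a)=a^{p^s}+p\,\delta^{(s)}a$ defines $\delta^{(s)}a$ (componentwise on vectors). $\pi$ is a prime element of a finite Galois extension of $\mathbb Q_p$, $R_\pi=R[\pi]$, and $[K(\pi):K]=n$; fix an $R$-basis $\theta_1,\ldots,\theta_n$ of $R_\pi$ and write $p/\pi=\sum_l r_l\theta_l$, $r_l\in R$. Fix $s\ge1$ and an $n$-tuple $\delta_1^{(s)},\ldots,\delta_n^{(s)}$ of higher $\pi$-derivations of degree $s$ on $R_\pi$ (maps $\delta$ with $\delta(1)=0$, $\delta(x+y)=\delta x+\delta y+\frac p\pi C^{(s)}_p(x,y)$, $\delta(xy)=x^{p^s}\delta y+y^{p^s}\delta x+\pi\delta x\delta y$, $C^{(s)}_p(X,Y)=(X^{p^s}+Y^{p^s}-(X+Y)^{p^s})/p$). Let $x$ be an $n\times n$ matrix of indeterminates, $\mathcal A=R_\pi[x,\det(x)^{-1}]^{\widehat{\ }}$ ($p$-adic completion), and for $F\in\mathcal A$ let $F(1)\in R_\pi$ be its image under $x\mapsto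 1$. A $\pi$-connection of degree $s$ on $\mathrm{GL}_n$ is an $n$-tuple of higher $\pi$-derivations $(\delta_i^{(s)})^G$ of degree $s$ on $\mathcal A$ extending $\delta_i^{(s)}$. A curve is $c\in R^n$; $c^*:R_\pi\to R$ is the $R$-linear map $\sum a_i\theta_i\mapsto\sum a_ic_i$, and $F_c:=c^*(F(1))$. The velocity of $c$ is $v=\delta^{(s)}c$, and $\delta_v^{G}=\sum_i v_i^{\phi^s}(\delta_i^{(s)})^G$. A vector $w\in R^n$ is parallel along $c$ if $(\delta_v^G(xw))_c=0$ (entrywise). $c$ is non-degenerate if $\sum_lr_lc_l\not\equiv0$ and $\sum_lv_l\not\equiv0$ mod $p$. *)

theory Defs
  imports
    "HOL-Analysis.Determinants"
    "HOL-Library.Poly_Mapping"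
    "HOL-Algebra.Algebra"
    "HOL-Algebra.Algebraic_Closure_Type"
begin

section \<open>Subrings of an ambient ring type\<close>

abbreviation ambient :: "'a::comm_ring_1 ring" where
  "ambient \<equiv> ring_of_type_algebra"

definition subring_of :: "'a::comm_ring_1 set \<Rightarrow> 'a ring" where
  "subring_of S = ambient\<lparr>carrier := S\<rparr>"


section \<open>The \<open>p\<close>-adic fields and rings\<close>

text \<open>
  All fields live in one algebraically closed field of characteristic 0 that is complete for a
  non-archimedean absolute value extending the \<open>p\<close>-adic one, e.g. the completion of an algebraic
  closure of the \<open>p\<close>-adic numbers. The \<open>p\<close>-adic numbers, their maximal unramified extension and
  its completion are subsets of it that do not depend on it up to isomorphism.
\<close>

locale padic_universe =
  fixes p :: nat and nv :: "'a::{alg_closed_field, field_char_0} \<Rightarrow> real"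
  assumes prime_p: "Factorial_Ring.prime p"
    and nv_nonneg: "nv x \<ge> 0"
    and nv_eq_0_iff: "nv x = 0 \<longleftrightarrow> x = 0"
    and nv_mult: "nv (x * y) = nv x * nv y"
    and nv_add: "nv (x + y) \<le> max (nv x) (nv y)"
    and nv_p: "nv (of_nat p) = 1 / real p"
    and nv_complete: "(\<forall>e>0. \<exists>N. \<forall>i\<ge>N. \<forall>j\<ge>N. nv (u i - u j) < e) \<Longrightarrow>
                      \<exists>l. (\<lambda>i. nv (u i - l)) \<longlonglongrightarrow> 0"

definition nv_closure :: "('a::field_char_0 \<Rightarrow> real) \<Rightarrow> 'a set \<Rightarrow> 'a set" where
  "nv_closure nv S = {x. \<forall>e>0. \<exists>y\<in>S. nv (x - y) < e}"

definition Qp :: "('a::field_char_0 \<Rightarrow> real) \<Rightarrow> 'a set" where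
  "Qp nv = nv_closure nv \<rat>"

definition integers_of :: "('a::field_char_0 \<Rightarrow> real) \<Rightarrow> 'a set \<Rightarrow> 'a set" where
  "integers_of nv E = {x \<in> E. nv x \<le> 1}"

definition finite_field_ext :: "'a::field_char_0 set \<Rightarrow> 'a set \<Rightarrow> bool" where
  "finite_field_ext F E \<longleftrightarrow> subfield F ambient \<and> subfield E ambient \<and> F \<subseteq> E \<and>
     ring.finite_dimension ambient F E"

definition field_auts :: "'a::field_char_0 set \<Rightarrow> 'a set \<Rightarrow> ('a \<Rightarrow> 'a) set" where
  "field_auts F E = {\<sigma> \<in> ring_iso (subring_of E) (subring_of E). \<forall>a\<in>F. \<sigma> a = a}"

definition finite_galois_ext :: "'a::field_char_0 set \<Rightarrow> 'a set \<Rightarrow> bool" where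
  "finite_galois_ext F E \<longleftrightarrow> finite_field_ext F E \<and> {x \<in> E. \<forall>\<sigma>\<in>field_auts F E. \<sigma> x = x} = F"

text \<open>
  Ramification index 1, i.e. equality of the value groups. The residue field of the \<open>p\<close>-adic
  numbers is perfect, so separability of the residue field extension is automatic.
\<close>

definition finite_unramified_ext :: "('a::field_char_0 \<Rightarrow> real) \<Rightarrow> 'a set \<Rightarrow> bool" where
  "finite_unramified_ext nv E \<longleftrightarrow> finite_field_ext (Qp nv) E \<and> nv ` E = nv ` Qp nv"

definition Qp_ur :: "('a::field_char_0 \<Rightarrow> real) \<Rightarrow> 'a set" where
  "Qp_ur nv = \<Union>{E. finite_unramified_ext nv E}"

text \<open>
  The powers of \<open>p\<close> generate the ideals of elements of absolute value at most \<open>p\<^sup>-\<^sup>k\<close> in the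
  integers of \<open>Qp_ur\<close>, so the \<open>p\<close>-adic completion of these integers is their closure in the
  complete ambient field.
\<close>

definition Rur :: "('a::field_char_0 \<Rightarrow> real) \<Rightarrow> 'a set" where
  "Rur nv = nv_closure nv (integers_of nv (Qp_ur nv))"

definition prime_element_of :: "('a::field_char_0 \<Rightarrow> real) \<Rightarrow> 'a set \<Rightarrow> 'a \<Rightarrow> bool" where
  "prime_element_of nv E \<pi> \<longleftrightarrow> \<pi> \<in> integers_of nv E \<and>
     {x \<in> E. nv x < 1} = PIdl\<^bsub>subring_of (integers_of nv E)\<^esub> \<pi>"

definition adjoin :: "'a::field_char_0 set \<Rightarrow> 'a \<Rightarrow> 'a set" where
  "adjoin S a = ring.simple_extension ambient S a"

definition frobenius_lift :: "nat \<Rightarrow> 'a::field_char_0 set \<Rightarrow> ('a \<Rightarrow> 'a) \<Rightarrow> bool" where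
  "frobenius_lift p R \<phi> \<longleftrightarrow> \<phi> \<in> ring_hom (subring_of R) (subring_of R) \<and>
     (\<forall>a\<in>R. \<phi> a - a ^ p \<in> PIdl\<^bsub>subring_of R\<^esub> (of_nat p))"

definition delta :: "nat \<Rightarrow> ('a \<Rightarrow> 'a) \<Rightarrow> nat \<Rightarrow> 'a \<Rightarrow> 'a::field_char_0" where
  "delta p \<phi> s a = ((\<phi> ^^ s) a - a ^ (p ^ s)) / of_nat p"

definition vecs :: "'a set \<Rightarrow> ('a ^ 'n) set" where
  "vecs R = {c. \<forall>i. c $ i \<in> R}"

definition is_basis :: "'a::field_char_0 set \<Rightarrow> 'a set \<Rightarrow> 'a ^ 'n \<Rightarrow> bool" where
  "is_basis R M \<theta> \<longleftrightarrow> \<theta> \<in> vecs M \<and> (\<forall>a\<in>M. \<exists>!u. u \<in> vecs R \<and> a = (\<Sum>i\<in>UNIV. u $ i * \<theta> $ i))"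

definition coords :: "'a::field_char_0 set \<Rightarrow> 'a ^ 'n \<Rightarrow> 'a \<Rightarrow> 'a ^ 'n" where
  "coords R \<theta> a = (THE u. u \<in> vecs R \<and> a = (\<Sum>i\<in>UNIV. u $ i * \<theta> $ i))"


section \<open>Higher \<open>\<pi>\<close>-derivations\<close>

text \<open>
  The integer polynomial \<open>(X^q + Y^q - (X + Y)^q) / p\<close> with \<open>q = p ^ s\<close>, expanded by the binomial
  theorem so that it can be evaluated in any commutative ring; the divisions are exact.
\<close>

definition Cp :: "('a, 'm) ring_scheme \<Rightarrow> nat \<Rightarrow> nat \<Rightarrow> 'a \<Rightarrow> 'a \<Rightarrow> 'a" where
  "Cp A p s x y = \<ominus>\<^bsub>A\<^esub> (\<Oplus>\<^bsub>A\<^esub>k\<in>{0<..<p ^ s}.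
     [((p ^ s choose k) div p)] \<cdot>\<^bsub>A\<^esub> (x [^]\<^bsub>A\<^esub> k \<otimes>\<^bsub>A\<^esub> y [^]\<^bsub>A\<^esub> (p ^ s - k)))"

text \<open>\<open>q\<close> and \<open>t\<close> are the images of \<open>p / \<pi>\<close> and \<open>\<pi>\<close> in the algebra \<open>A\<close>.\<close>

definition higher_pi_derivation ::
  "('a, 'm) ring_scheme \<Rightarrow> nat \<Rightarrow> nat \<Rightarrow> 'a \<Rightarrow> 'a \<Rightarrow> ('a \<Rightarrow> 'a) \<Rightarrow> bool" where
  "higher_pi_derivation A p s q t d \<longleftrightarrow>
     d \<in> carrier A \<rightarrow> carrier A \<and>
     d \<one>\<^bsub>A\<^esub> = \<zero>\<^bsub>A\<^esub> \<and>
     (\<forall>x\<in>carrier A. \<forall>y\<in>carrier A.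
        d (x \<oplus>\<^bsub>A\<^esub> y) = d x \<oplus>\<^bsub>A\<^esub> d y \<oplus>\<^bsub>A\<^esub> q \<otimes>\<^bsub>A\<^esub> Cp A p s x y) \<and>
     (\<forall>x\<in>carrier A. \<forall>y\<in>carrier A.
        d (x \<otimes>\<^bsub>A\<^esub> y) =
          x [^]\<^bsub>A\<^esub> (p ^ s) \<otimes>\<^bsub>A\<^esub> d y \<oplus>\<^bsub>A\<^esub> y [^]\<^bsub>A\<^esub> (p ^ s) \<otimes>\<^bsub>A\<^esub> d x
            \<oplus>\<^bsub>A\<^esub> t \<otimes>\<^bsub>A\<^esub> d x \<otimes>\<^bsub>A\<^esub> d y)"


section \<open>Adic completion\<close>

text \<open>
  The inverse limit of the quotients of \<open>S\<close> by the powers of \<open>a\<close>. A residue class modulo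
  \<open>a^(k+1)\<close> is mapped to a class modulo \<open>a^k\<close> iff it is contained in it.
\<close>

definition adic_quot :: "('a, 'm) ring_scheme \<Rightarrow> 'a \<Rightarrow> nat \<Rightarrow> 'a set ring" where
  "adic_quot S a k = S Quot (PIdl\<^bsub>S\<^esub> (a [^]\<^bsub>S\<^esub> k))"

definition adic_completion :: "('a, 'm) ring_scheme \<Rightarrow> 'a \<Rightarrow> (nat \<Rightarrow> 'a set) ring" where
  "adic_completion S a =
     \<lparr>carrier = {F. (\<forall>k. F k \<in> carrier (adic_quot S a k)) \<and> (\<forall>k. F (Suc k) \<subseteq> F k)},
      monoid.mult = (\<lambda>F G k. F k \<otimes>\<^bsub>adic_quot S a k\<^esub> G k),
      one = (\<lambda>k. \<one>\<^bsub>adic_quot S a k\<^esub>),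
      ring.zero = (\<lambda>k. \<zero>\<^bsub>adic_quot S a k\<^esub>),
      add = (\<lambda>F G k. F k \<oplus>\<^bsub>adic_quot S a k\<^esub> G k)\<rparr>"

definition adic_of :: "('a, 'm) ring_scheme \<Rightarrow> 'a \<Rightarrow> 'a \<Rightarrow> nat \<Rightarrow> 'a set" where
  "adic_of S a y = (\<lambda>k. (PIdl\<^bsub>S\<^esub> (a [^]\<^bsub>S\<^esub> k)) +>\<^bsub>S\<^esub> y)"


section \<open>The completed coordinate ring of the general linear group\<close>

text \<open>
  The variable \<open>Some (i, j)\<close> is the matrix entry \<open>x i j\<close>; \<open>None\<close> becomes the inverse of the
  determinant in the quotient \<open>gl_ring\<close>.
\<close>

type_synonym ('a, 'n) gl_poly = "(('n \<times> 'n) option \<Rightarrow>\<^sub>0 nat) \<Rightarrow>\<^sub>0 'a"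
type_synonym ('a, 'n) gl_hat = "nat \<Rightarrow> ('a, 'n) gl_poly set set"

definition gl_const :: "'a::field_char_0 \<Rightarrow> ('a, 'n) gl_poly" where
  "gl_const a = Poly_Mapping.single 0 a"

definition gl_var :: "('n \<times> 'n) option \<Rightarrow> ('a::field_char_0, 'n) gl_poly" where
  "gl_var v = Poly_Mapping.single (Poly_Mapping.single v 1) 1"

definition gl_poly_ring :: "'a::field_char_0 set \<Rightarrow> ('a, 'n) gl_poly ring" where
  "gl_poly_ring S = subring_of {f. \<forall>m. Poly_Mapping.lookup f m \<in> S}"

definition gl_det :: "('a::field_char_0, 'n::finite) gl_poly" where
  "gl_det = det (\<chi> i j. gl_var (Some (i, j)))"

definition gl_ideal :: "'a::field_char_0 set \<Rightarrow> ('a, 'n::finite) gl_poly set" where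
  "gl_ideal S = PIdl\<^bsub>gl_poly_ring S\<^esub> (gl_var None * gl_det - 1)"

definition gl_ring :: "'a::field_char_0 set \<Rightarrow> ('a, 'n::finite) gl_poly set ring" where
  "gl_ring S = gl_poly_ring S Quot gl_ideal S"

definition gl_class :: "'a::field_char_0 set \<Rightarrow> ('a, 'n::finite) gl_poly \<Rightarrow> ('a, 'n) gl_poly set" where
  "gl_class S f = gl_ideal S +>\<^bsub>gl_poly_ring S\<^esub> f"

definition gl_hat_ring :: "nat \<Rightarrow> 'a::field_char_0 set \<Rightarrow> ('a, 'n::finite) gl_hat ring" where
  "gl_hat_ring p S = adic_completion (gl_ring S) (gl_class S (gl_const (of_nat p)))"

definition gl_hat_of ::
  "nat \<Rightarrow> 'a::field_char_0 set \<Rightarrow> ('a, 'n::finite) gl_poly \<Rightarrow> ('a, 'n) gl_hat" where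
  "gl_hat_of p S f = adic_of (gl_ring S) (gl_class S (gl_const (of_nat p))) (gl_class S f)"

abbreviation gl_hat_const :: "nat \<Rightarrow> 'a::field_char_0 set \<Rightarrow> 'a \<Rightarrow> ('a, 'n::finite) gl_hat" where
  "gl_hat_const p S a \<equiv> gl_hat_of p S (gl_const a)"

definition gl_poly_eval_one :: "('a::field_char_0, 'n) gl_poly \<Rightarrow> 'a" where
  "gl_poly_eval_one f = (\<Sum>m\<in>Poly_Mapping.keys f. Poly_Mapping.lookup f m *
     (\<Prod>v\<in>Poly_Mapping.keys m.
        (case v of Some (i, j) \<Rightarrow> if i = j then 1 else 0 | None \<Rightarrow> 1) ^ Poly_Mapping.lookup m v))"

text \<open>
  \<open>F\<close> at the identity matrix is the limit in \<open>S\<close> of the values of polynomials representing \<open>F\<close>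
  modulo the powers of \<open>p\<close>.
\<close>

definition gl_eval_one :: "nat \<Rightarrow> 'a::field_char_0 set \<Rightarrow> ('a, 'n::finite) gl_hat \<Rightarrow> 'a" where
  "gl_eval_one p S F = (THE r. r \<in> S \<and>
     (\<forall>k. \<forall>f\<in>carrier (gl_poly_ring S). gl_class S f \<in> F k \<longrightarrow>
        r - gl_poly_eval_one f \<in> PIdl\<^bsub>subring_of S\<^esub> (of_nat p ^ k)))"


section \<open>Connections, curves and parallel vectors\<close>

definition pi_connection ::
  "nat \<Rightarrow> nat \<Rightarrow> 'a::field_char_0 set \<Rightarrow> 'a \<Rightarrow> ('n::finite \<Rightarrow> 'a \<Rightarrow> 'a)
     \<Rightarrow> ('n \<Rightarrow> ('a, 'n) gl_hat \<Rightarrow> ('a, 'n) gl_hat) \<Rightarrow> bool" where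
  "pi_connection p s S \<pi> d D \<longleftrightarrow>
     (\<forall>i. higher_pi_derivation (gl_hat_ring p S) p s
            (gl_hat_const p S (of_nat p / \<pi>)) (gl_hat_const p S \<pi>) (D i) \<and>
          (\<forall>a\<in>S. D i (gl_hat_const p S a) = gl_hat_const p S (d i a)))"

definition curve_star :: "'a::field_char_0 set \<Rightarrow> 'a ^ 'n \<Rightarrow> 'a ^ 'n \<Rightarrow> 'a \<Rightarrow> 'a" where
  "curve_star R \<theta> c a = (\<Sum>i\<in>UNIV. coords R \<theta> a $ i * c $ i)"

definition velocity :: "nat \<Rightarrow> ('a \<Rightarrow> 'a) \<Rightarrow> nat \<Rightarrow> 'a::field_char_0 ^ 'n \<Rightarrow> 'a ^ 'n" where
  "velocity p \<phi> s c = (\<chi> i. delta p \<phi> s (c $ i))"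

definition directional ::
  "nat \<Rightarrow> nat \<Rightarrow> 'a::field_char_0 set \<Rightarrow> ('a \<Rightarrow> 'a) \<Rightarrow> ('n::finite \<Rightarrow> ('a, 'n) gl_hat \<Rightarrow> ('a, 'n) gl_hat)
     \<Rightarrow> 'a ^ 'n \<Rightarrow> ('a, 'n) gl_hat \<Rightarrow> ('a, 'n) gl_hat" where
  "directional p s S \<phi> D v F = (\<Oplus>\<^bsub>gl_hat_ring p S\<^esub>i\<in>UNIV.
     gl_hat_const p S ((\<phi> ^^ s) (v $ i)) \<otimes>\<^bsub>gl_hat_ring p S\<^esub> D i F)"

definition gl_mat_vec ::
  "nat \<Rightarrow> 'a::field_char_0 set \<Rightarrow> 'a ^ 'n \<Rightarrow> 'n::finite \<Rightarrow> ('a, 'n) gl_hat" where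
  "gl_mat_vec p S w k = (\<Oplus>\<^bsub>gl_hat_ring p S\<^esub>j\<in>UNIV.
     gl_hat_of p S (gl_var (Some (k, j))) \<otimes>\<^bsub>gl_hat_ring p S\<^esub> gl_hat_const p S (w $ j))"

definition parallel_along ::
  "nat \<Rightarrow> nat \<Rightarrow> 'a::field_char_0 set \<Rightarrow> 'a set \<Rightarrow> ('a \<Rightarrow> 'a) \<Rightarrow> 'a ^ 'n
     \<Rightarrow> ('n::finite \<Rightarrow> ('a, 'n) gl_hat \<Rightarrow> ('a, 'n) gl_hat) \<Rightarrow> 'a ^ 'n \<Rightarrow> 'a ^ 'n \<Rightarrow> bool" where
  "parallel_along p s R S \<phi> \<theta> D c w \<longleftrightarrow>
     (\<forall>k. curve_star R \<theta> c
            (gl_eval_one p S (directional p s S \<phi> D (velocity p \<phi> s c) (gl_mat_vec p S w k))) = 0)"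

definition nondegenerate ::
  "nat \<Rightarrow> nat \<Rightarrow> 'a::field_char_0 set \<Rightarrow> ('a \<Rightarrow> 'a) \<Rightarrow> 'a ^ 'n \<Rightarrow> 'a ^ 'n \<Rightarrow> bool" where
  "nondegenerate p s R \<phi> r c \<longleftrightarrow>
     (\<Sum>l\<in>UNIV. r $ l * c $ l) \<notin> PIdl\<^bsub>subring_of R\<^esub> (of_nat p) \<and>
     (\<Sum>l\<in>UNIV. velocity p \<phi> s c $ l) \<notin> PIdl\<^bsub>subring_of R\<^esub> (of_nat p)"

end

theory Submission
  imports Defs
begin

text \<open>
  The ring \<open>R\<close> is the closure of the ring generated by the roots of unity of order prime to \<open>p\<close> (an
  element of a finite unramified extension is approximated by Teichmueller representatives, and a
  finite extension of the \<open>p\<close>-adic numbers is complete with finite residue field). Hence \<open>R\<close> is a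
  complete discrete valuation ring with uniformizer \<open>p\<close> and perfect residue field, so \<open>\<phi>\<close> is bijective
  on \<open>R\<close> and a homomorphism on \<open>R\<close> that lifts the \<open>p^s\<close>-th power map is unique. Each map
  \<open>a \<mapsto> a^(p^s) + \<pi> \<delta>_i a\<close> is such a homomorphism, so it equals \<open>\<phi>^s\<close> on \<open>R\<close>. The corresponding
  homomorphism on the coordinate ring, applied to the entries of \<open>x w\<close> and evaluated at \<open>x = 1\<close>, turns
  parallelism into \<open>u \<delta>(w) + B \<phi>^s(w) = 0\<close> with \<open>u\<close> in \<open>R\<close> and a matrix \<open>B\<close> over \<open>R\<close>; non-degeneracy
  says that \<open>u\<close> is a unit. The equation reads \<open>\<phi>^s(w) = w^(p^s) - p u^(-1) B \<phi>^s(w)\<close>, which after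
  applying \<open>\<phi>^(-s)\<close> is a fixed point equation for a \<open>p\<close>-adic contraction preserving residues mod \<open>p\<close>.
\<close>

section \<open>Subrings of a commutative ring type\<close>

text \<open>No residue field is ever formed. Its algebraicity over the prime field is used in one
  form: every \<open>x\<close> in \<open>R\<close> satisfies \<open>x ^ (p ^ m) = x + p * y\<close>
  with \<open>m >= 1\<close> and \<open>y\<close> in \<open>R\<close>. Replacing \<open>x\<close> by
  such powers makes small elements divisible by \<open>p\<close>, inverts units by a geometric
  series, extracts \<open>p ^ s\<close>-th roots modulo \<open>p\<close> and improves any agreement
  between two homomorphisms. The obstacle is that \<open>Rur\<close> is the closure of the integers
  in a union of fields, for which neither the ring operations nor this congruence is evident; the
  description by roots of unity supplies both. The functional \<open>curve_star\<close> is only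
  \<open>R\<close>-linear, whereas the connection involves division by \<pi>. Because all twisted
  maps agree with \<open>\<phi> ^^ s\<close> on \<open>R\<close>, the division occurs only as
  \<open>(\<Phi> a - a ^ (p ^ s)) / \<pi> = delta a * (p / \<pi>)\<close> with
  \<open>delta a\<close> in \<open>R\<close>. The functional sends \<open>p / \<pi>\<close> to the
  sum of the \<open>r $ l * c $ l\<close>, and the weights of the direction add up to \<Phi> of the
  sum of the velocity. The product of these two numbers is \<open>u\<close>, which is where the two
  conditions of non-degeneracy come from.\<close>

lemma carrier_ambient [simp]: "carrier ambient = UNIV"
  and mult_ambient [simp]: "monoid.mult ambient = (*)"
  and one_ambient [simp]: "one ambient = 1"
  and zero_ambient [simp]: "ring.zero ambient = 0"
  and add_ambient [simp]: "ring.add ambient = (+)"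
  by (simp_all add: ring_of_type_algebra_def)

lemma a_inv_ambient [simp]: "a_inv ambient x = - x"
proof -
  interpret cring "ambient :: 'a ring" by (rule cring_from_type_algebra)
  show ?thesis
    using minus_equality[of "- x" x] by simp
qed

lemma carrier_subring_of [simp]: "carrier (subring_of S) = S"
  and mult_subring_of [simp]: "monoid.mult (subring_of S) = (*)"
  and one_subring_of [simp]: "one (subring_of S) = 1"
  and zero_subring_of [simp]: "ring.zero (subring_of S) = 0"
  and add_subring_of [simp]: "ring.add (subring_of S) = (+)"
  by (simp_all add: subring_of_def)

lemma pow_subring_of [simp]: "x [^]\<^bsub>subring_of S\<^esub> (n::nat) = x ^ n"
  by (induction n) (simp_all add: mult.commute)

lemma subring_ambientI:
  assumes "1 \<in> S" "\<And>x y. x \<in> S \<Longrightarrow> y \<in> S \<Longrightarrow> x - y \<in> S" "\<And>x y. x \<in> S \<Longrightarrow> y \<in> S \<Longrightarrow> x * y \<in> S"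
  shows "subring S (ambient :: 'a::comm_ring_1 ring)"
proof -
  interpret cring "ambient :: 'a ring" by (rule cring_from_type_algebra)
  have 0: "0 \<in> S" using assms(2)[OF assms(1) assms(1)] by simp
  have neg: "- x \<in> S" if "x \<in> S" for x using assms(2)[OF 0 that] by simp
  have "x + y \<in> S" if "x \<in> S" "y \<in> S" for x y using assms(2)[OF that(1) neg[OF that(2)]] by simp
  then show ?thesis
    using assms neg by (intro subringI) auto
qed

context
  fixes S :: "'a::comm_ring_1 set"
  assumes S: "subring S ambient"
begin

lemma subring_ambient_one: "1 \<in> S"
  and subring_ambient_zero: "0 \<in> S"
  and subring_ambient_add: "x \<in> S \<Longrightarrow> y \<in> S \<Longrightarrow> x + y \<in> S"
  and subring_ambient_mult: "x \<in> S \<Longrightarrow> y \<in> S \<Longrightarrow> x * y \<in> S"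
  and subring_ambient_uminus: "x \<in> S \<Longrightarrow> - x \<in> S"
  using subringE[OF S] by auto

lemma subring_ambient_diff: "x \<in> S \<Longrightarrow> y \<in> S \<Longrightarrow> x - y \<in> S"
  using subring_ambient_add[of x "- y"] subring_ambient_uminus[of y] by simp

lemma subring_ambient_power: "x \<in> S \<Longrightarrow> x ^ n \<in> S"
  by (induction n) (auto intro: subring_ambient_one subring_ambient_mult)

lemma subring_ambient_of_nat: "of_nat n \<in> S"
  by (induction n) (auto intro: subring_ambient_one subring_ambient_zero subring_ambient_add)

lemma subring_ambient_sum: "(\<And>i. i \<in> I \<Longrightarrow> f i \<in> S) \<Longrightarrow> sum f I \<in> S"
  by (induction I rule: infinite_finite_induct) (auto intro: subring_ambient_zero subring_ambient_add)

lemma subring_ambient_prod: "(\<And>i. i \<in> I \<Longrightarrow> f i \<in> S) \<Longrightarrow> prod f I \<in> S"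
  by (induction I rule: infinite_finite_induct) (auto intro: subring_ambient_one subring_ambient_mult)

lemmas subring_ambient_closed = subring_ambient_one subring_ambient_zero subring_ambient_add
  subring_ambient_mult subring_ambient_uminus subring_ambient_diff subring_ambient_power
  subring_ambient_of_nat subring_ambient_sum subring_ambient_prod

lemma subring_of_cring: "cring (subring_of S)"
proof -
  interpret cring "ambient :: 'a ring" by (rule cring_from_type_algebra)
  show ?thesis
    unfolding subring_of_def
    using subcring_iff[of S] S by (simp add: subcringI' )
qed

lemma a_inv_subring_of: "x \<in> S \<Longrightarrow> a_inv (subring_of S) x = - x"
proof -
  assume x: "x \<in> S"
  interpret cring "subring_of S" by (rule subring_of_cring)
  show ?thesis
    using minus_equality[of "- x" x] x subring_ambient_uminus[of x] by simp
qed

lemma finsum_subring_of: "(\<And>i. i \<in> I \<Longrightarrow> f i \<in> S) \<Longrightarrow> finsum (subring_of S) f I = sum f I"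
proof -
  interpret cring "subring_of S" by (rule subring_of_cring)
  show "(\<And>i. i \<in> I \<Longrightarrow> f i \<in> S) \<Longrightarrow> ?thesis"
  proof (induction I rule: infinite_finite_induct)
    case (infinite A)
    then show ?case by (simp add: finsum_infinite)
  next
    case empty
    then show ?case by simp
  next
    case (insert x F)
    then show ?case by (subst finsum_insert) auto
  qed
qed

end

lemma PIdl_subring_of: "x \<in> PIdl\<^bsub>subring_of S\<^esub> a \<longleftrightarrow> (\<exists>y\<in>S. x = a * y)"
  unfolding cgenideal_def by (auto simp: mult.commute[of a])

lemma subring_power_diff_dvd:
  assumes "subring S ambient" "x \<in> S" "y \<in> S"
  shows "\<exists>z\<in>S. x ^ n - y ^ n = (x - y) * z"
proof (induction n)
  case (Suc n)
  then obtain z where z: "z \<in> S" "x ^ n - y ^ n = (x - y) * z" by blast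
  have "x ^ Suc n - y ^ Suc n = x * (x ^ n - y ^ n) + (x - y) * y ^ n"
    by (simp add: algebra_simps)
  also have "\<dots> = (x - y) * (x * z + y ^ n)"
    by (simp add: z algebra_simps)
  finally show ?case
    using z assms by (intro bexI[of _ "x * z + y ^ n"]) (auto intro: subring_ambient_closed)
qed (use subring_ambient_zero[OF assms(1)] in force)

text \<open>With \<open>q = p ^ s\<close>, use
  \<open>k * (q choose k) = q * (q - 1 choose (k - 1))\<close>: were the binomial coefficient prime
  to \<open>p\<close>, all of \<open>q\<close> would divide \<open>k\<close>, which is
  smaller.\<close>

lemma prime_dvd_choose_power:
  assumes "Factorial_Ring.prime (p::nat)" "0 < k" "k < p ^ s"
  shows "p dvd (p ^ s choose k)"
proof (rule ccontr)
  assume "\<not> p dvd (p ^ s choose k)"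
  then have cop: "coprime (p ^ s) (p ^ s choose k)"
    using assms(1) by (simp add: prime_imp_coprime)
  have "k * (p ^ s choose k) = p ^ s * (p ^ s - 1 choose (k - 1))"
    using assms by (intro times_binomial_minus1_eq) auto
  then have "p ^ s dvd k * (p ^ s choose k)" by simp
  then have "p ^ s dvd k"
    using cop coprime_dvd_mult_left_iff by blast
  with assms(2) have "p ^ s \<le> k" by (simp add: dvd_imp_le)
  with assms(3) show False by simp
qed

text \<open>The correction sum is the negative of \<open>Cp\<close>, so this is also the proof that
  the divisions in \<open>Cp\<close> are exact. Read modulo \<open>p\<close> it says that Frobenius
  is additive.\<close>

lemma add_power_prime_power:
  fixes x y :: "'a::comm_ring_1"
  assumes "Factorial_Ring.prime (p::nat)"
  shows "(x + y) ^ (p ^ s) = x ^ (p ^ s) + y ^ (p ^ s) +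
           of_nat p * (\<Sum>k\<in>{0<..<p ^ s}. of_nat ((p ^ s choose k) div p) * (x ^ k * y ^ (p ^ s - k)))"
proof -
  have p: "p > 0" using assms by (simp add: prime_gt_0_nat)
  define q where "q = p ^ s"
  have q: "q > 0" using p by (simp add: q_def)
  have "{..q} = insert 0 (insert q {0<..<q})" using q by auto
  then have "(x + y) ^ q = y ^ q + (x ^ q + (\<Sum>k\<in>{0<..<q}. of_nat (q choose k) * x ^ k * y ^ (q - k)))"
    using q by (simp add: binomial_ring)
  also have "(\<Sum>k\<in>{0<..<q}. of_nat (q choose k) * x ^ k * y ^ (q - k)) =
      of_nat p * (\<Sum>k\<in>{0<..<q}. of_nat ((q choose k) div p) * (x ^ k * y ^ (q - k)))"
    unfolding sum_distrib_left
  proof (rule sum.cong)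
    fix k assume "k \<in> {0<..<q}"
    then have "p dvd (q choose k)"
      using prime_dvd_choose_power[OF assms] by (auto simp: q_def)
    then have "(of_nat (q choose k) :: 'a) = of_nat p * of_nat ((q choose k) div p)"
      by (metis dvd_mult_div_cancel of_nat_mult)
    then show "of_nat (q choose k) * x ^ k * y ^ (q - k) =
        of_nat p * (of_nat ((q choose k) div p) * (x ^ k * y ^ (q - k)))"
      by (simp add: mult_ac)
  qed simp
  finally show ?thesis by (simp add: q_def)
qed

lemma subring_add_power_prime_power:
  assumes "subring S (ambient :: 'a::comm_ring_1 ring)" "Factorial_Ring.prime (p::nat)" "x \<in> S" "y \<in> S"
  shows "\<exists>z\<in>S. (x + y) ^ (p ^ s) = x ^ (p ^ s) + y ^ (p ^ s) + of_nat p * z"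
  by (rule bexI, rule add_power_prime_power[OF assms(2)])
     (use assms in \<open>auto intro!: subring_ambient_closed[OF assms(1)]\<close>)

section \<open>The absolute value\<close>

context padic_universe
begin

lemma p_gt_1: "real p > 1"
  using prime_gt_1_nat[OF prime_p] by simp

lemma p_pos [simp]: "p > 0" "p \<noteq> 0"
  using prime_gt_0_nat[OF prime_p] by auto

lemma of_nat_p_nz [simp]: "(of_nat p :: 'a) \<noteq> 0"
  using prime_gt_0_nat[OF prime_p] by simp

lemma nv_0 [simp]: "nv 0 = 0"
  by (simp add: nv_eq_0_iff)

lemma nv_pos: "x \<noteq> 0 \<Longrightarrow> nv x > 0"
  using nv_nonneg[of x] nv_eq_0_iff[of x] by linarith

lemma nv_1 [simp]: "nv 1 = 1"
  using nv_mult[of 1 1] nv_eq_0_iff[of 1] by simp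

lemma nv_uminus [simp]: "nv (- x) = nv x"
proof -
  have "nv (- 1) ^ 2 = 1" using nv_mult[of "-1" "-1"] by (simp add: power2_eq_square)
  then have "nv (- 1) = 1" using nv_nonneg[of "-1"] by (simp add: power2_eq_1_iff)
  then show ?thesis using nv_mult[of "-1" x] by simp
qed

lemma nv_minus_commute: "nv (x - y) = nv (y - x)"
  using nv_uminus[of "x - y"] by simp

lemma nv_diff: "nv (x - y) \<le> max (nv x) (nv y)"
  using nv_add[of x "- y"] by simp

lemma nv_add_le: "nv x \<le> r \<Longrightarrow> nv y \<le> r \<Longrightarrow> nv (x + y) \<le> r"
  using nv_add[of x y] by simp

lemma nv_add_less: "nv x < r \<Longrightarrow> nv y < r \<Longrightarrow> nv (x + y) < r"
  using nv_add[of x y] by (simp add: less_le_trans max_def split: if_splits)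

lemma nv_diff_le: "nv x \<le> r \<Longrightarrow> nv y \<le> r \<Longrightarrow> nv (x - y) \<le> r"
  using nv_diff[of x y] by simp

lemma nv_diff_less: "nv x < r \<Longrightarrow> nv y < r \<Longrightarrow> nv (x - y) < r"
  using nv_add_less[of x r "- y"] by simp

lemma nv_diff_trans_le: "nv (x - y) \<le> r \<Longrightarrow> nv (y - z) \<le> r \<Longrightarrow> nv (x - z) \<le> r"
  using nv_add_le[of "x - y" r "y - z"] by simp

lemma nv_diff_trans_less: "nv (x - y) < r \<Longrightarrow> nv (y - z) < r \<Longrightarrow> nv (x - z) < r"
  using nv_add_less[of "x - y" r "y - z"] by simp

lemma nv_power: "nv (x ^ n) = nv x ^ n"
  by (induction n) (simp_all add: nv_mult)

lemma nv_inverse: "nv (inverse x) = inverse (nv x)"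
proof (cases "x = 0")
  case False
  then have "nv x * nv (inverse x) = 1" using nv_mult[of x "inverse x"] by simp
  then show ?thesis by (metis inverse_unique)
qed simp

lemma nv_divide: "nv (x / y) = nv x / nv y"
  by (simp add: field_class.field_divide_inverse nv_mult nv_inverse)

lemma nv_mult_le: "nv x \<le> r \<Longrightarrow> nv y \<le> 1 \<Longrightarrow> nv (x * y) \<le> r"
  using mult_mono[of "nv x" r "nv y" 1] nv_nonneg[of x] nv_nonneg[of y] by (simp add: nv_mult)

lemma nv_power_le_1: "nv x \<le> 1 \<Longrightarrow> nv (x ^ n) \<le> 1"
  by (simp add: nv_power power_le_one nv_nonneg)

lemma nv_of_nat_le: "nv (of_nat n) \<le> 1"
  by (induction n) (simp_all add: nv_add_le)

lemma nv_sum_le: "r \<ge> 0 \<Longrightarrow> (\<And>i. i \<in> I \<Longrightarrow> nv (f i) \<le> r) \<Longrightarrow> nv (sum f I) \<le> r"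
  by (induction I rule: infinite_finite_induct) (auto intro: nv_add_le)

text \<open>The isosceles triangle principle for non-archimedean absolute values.\<close>

lemma nv_eq_of_close: "nv (x - y) < nv y \<Longrightarrow> nv x = nv y"
proof (rule antisym)
  assume *: "nv (x - y) < nv y"
  show "nv x \<le> nv y" using nv_add[of "x - y" y] * by simp
  show "nv y \<le> nv x" using nv_diff[of x "x - y"] * by (simp add: max_def split: if_splits)
qed

lemma nv_power_diff_le:
  assumes "nv x \<le> 1" "nv y \<le> 1"
  shows "nv (x ^ n - y ^ n) \<le> nv (x - y)"
proof (induction n)
  case (Suc n)
  have "x ^ Suc n - y ^ Suc n = (x ^ n - y ^ n) * x + (x - y) * y ^ n"
    by (simp add: algebra_simps)
  then show ?case
    using Suc assms by (auto intro!: nv_add_le nv_mult_le nv_power_le_1)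
qed (simp add: nv_nonneg)

lemma nv_mod_p_power:
  assumes "nv x \<le> 1" "nv y \<le> 1"
  shows "nv ((x + y) ^ (p ^ s) - x ^ (p ^ s) - y ^ (p ^ s)) \<le> 1 / real p"
proof -
  have "(x + y) ^ (p ^ s) - x ^ (p ^ s) - y ^ (p ^ s) =
     of_nat p * (\<Sum>k\<in>{0<..<p ^ s}. of_nat ((p ^ s choose k) div p) * (x ^ k * y ^ (p ^ s - k)))"
    using add_power_prime_power[OF prime_p, of x y s] by simp
  then show ?thesis
    using assms
    by (auto intro!: nv_mult_le nv_sum_le nv_of_nat_le nv_power_le_1 simp: nv_p)
qed

text \<open>The source of every convergence rate below. With \<open>h = x - y\<close>, expanding
  \<open>(h + y) ^ p\<close> leaves \<open>h ^ p\<close>, of size at most \<open>r ^ 2\<close>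
  because \<open>p >= 2\<close>, and \<open>p\<close> times a combination of positive powers of
  \<open>h\<close>, of size at most \<open>r / p\<close>. Further powers lose nothing. The maximum
  also covers \<open>r > 1 / real p\<close>, which occurs for congruences modulo a ramified
  \<pi>.\<close>

lemma nv_prime_power_diff_le:
  assumes xy: "nv x \<le> 1" "nv y \<le> 1" and r: "nv (x - y) \<le> r" "r \<le> 1" and s: "s \<ge> 1"
  shows "nv (x ^ (p ^ s) - y ^ (p ^ s)) \<le> r * max r (1 / real p)"
proof -
  define h where "h = x - y"
  have r0: "r \<ge> 0" using r nv_nonneg[of "x - y"] by linarith
  have p2: "p \<ge> 2" using prime_ge_2_nat[OF prime_p] .
  have "x ^ p = (h + y) ^ (p ^ 1)" by (simp add: h_def)
  also have "\<dots> = h ^ p + y ^ p + of_nat p * (\<Sum>k\<in>{0<..<p}. of_nat ((p choose k) div p) * (h ^ k * y ^ (p - k)))"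
    using add_power_prime_power[OF prime_p, of h y 1] by simp
  finally have eq: "x ^ p - y ^ p = h ^ p + of_nat p * (\<Sum>k\<in>{0<..<p}. of_nat ((p choose k) div p) * (h ^ k * y ^ (p - k)))"
    by simp
  have h: "nv h \<le> r" using r by (simp add: h_def)
  have hk: "nv (h ^ k) \<le> r" if "k > 0" for k
  proof -
    have "nv h ^ k \<le> r ^ k" by (intro power_mono h nv_nonneg)
    also have "\<dots> \<le> r ^ 1" by (rule power_decreasing) (use r0 r that in auto)
    finally show ?thesis by (simp add: nv_power)
  qed
  have "nv h ^ p \<le> r ^ p" by (intro power_mono h nv_nonneg)
  also have "\<dots> \<le> r ^ 2" by (rule power_decreasing) (use r0 r p2 in auto)
  finally have 1: "nv (h ^ p) \<le> r * max r (1 / real p)"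
    using mult_left_mono[OF max.cobounded1[of r "1 / real p"] r0]
    by (simp add: nv_power power2_eq_square)
  have "nv (\<Sum>k\<in>{0<..<p}. of_nat ((p choose k) div p) * (h ^ k * y ^ (p - k))) \<le> r"
  proof (rule nv_sum_le[OF r0])
    fix k assume "k \<in> {0<..<p}"
    then have "nv (h ^ k * y ^ (p - k)) \<le> r"
      by (intro nv_mult_le hk nv_power_le_1 xy) auto
    then show "nv (of_nat ((p choose k) div p) * (h ^ k * y ^ (p - k))) \<le> r"
      using nv_mult_le[OF _ nv_of_nat_le] by (metis mult.commute)
  qed
  then have "nv (of_nat p * (\<Sum>k\<in>{0<..<p}. of_nat ((p choose k) div p) * (h ^ k * y ^ (p - k)))) \<le> r / real p"
    using p_gt_1 by (simp add: nv_mult nv_p field_simps)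
  also have "\<dots> \<le> r * max r (1 / real p)"
    using mult_left_mono[OF max.cobounded2[of "1 / real p" r] r0] by simp
  finally have "nv (x ^ p - y ^ p) \<le> r * max r (1 / real p)"
    unfolding eq by (intro nv_add_le 1)
  moreover have "nv ((x ^ p) ^ (p ^ (s - 1)) - (y ^ p) ^ (p ^ (s - 1))) \<le> nv (x ^ p - y ^ p)"
    by (intro nv_power_diff_le nv_power_le_1 xy)
  moreover have "p * p ^ (s - 1) = p ^ s" using s by (cases s) auto
  ultimately show ?thesis by (simp flip: power_mult)
qed

lemma eq_if_nv_le: "(\<And>e. e > 0 \<Longrightarrow> nv (x - y) \<le> e) \<Longrightarrow> x = y"
  by (metis dense eq_iff_diff_eq_0 leD nv_eq_0_iff nv_pos)

lemma inv_p_power_small: "e > 0 \<Longrightarrow> \<exists>k. C * (1 / real p) ^ k < e"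
proof -
  assume e: "e > 0"
  have "(\<lambda>k. C * (1 / real p) ^ k) \<longlonglongrightarrow> C * 0"
    by (intro tendsto_mult tendsto_const LIMSEQ_power_zero) (use p_gt_1 in auto)
  then have "eventually (\<lambda>k. C * (1 / real p) ^ k < e) sequentially"
    using e by (simp add: order_tendstoD(2))
  then show ?thesis using eventually_happens'[OF sequentially_bot] by blast
qed

lemma eq_if_nv_le_powers: "(\<And>k. nv (x - y) \<le> C * (1 / real p) ^ k) \<Longrightarrow> x = y"
  using inv_p_power_small[of _ C] by (meson eq_if_nv_le less_imp_le order_trans)

text \<open>By the ultrametric inequality the limit is no farther from \<open>u k\<close> than the
  largest later step, so the constant \<open>C\<close> survives without the factor of a geometric
  series.\<close>

lemma nv_limit:
  assumes "\<And>k. nv (u (Suc k) - u k) \<le> C * (1 / real p) ^ k"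
  shows "\<exists>l. \<forall>k. nv (l - u k) \<le> C * (1 / real p) ^ k"
proof -
  have C: "C \<ge> 0" using order_trans[OF nv_nonneg assms[of 0]] by simp
  have mono: "C * (1 / real p) ^ j \<le> C * (1 / real p) ^ k" if "k \<le> j" for j k
    by (intro mult_left_mono power_decreasing) (use C that p_gt_1 in auto)
  have step: "nv (u (k + j) - u k) \<le> C * (1 / real p) ^ k" for j k
  proof (induction j)
    case 0
    then show ?case using C by simp
  next
    case (Suc j)
    have "nv (u (k + Suc j) - u (k + j)) \<le> C * (1 / real p) ^ k"
      using order_trans[OF assms mono, of k "k + j"] by simp
    then show ?case using Suc nv_diff_trans_le by blast
  qed
  have "\<exists>l. (\<lambda>i. nv (u i - l)) \<longlonglongrightarrow> 0"
  proof (rule nv_complete, intro allI impI)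
    fix e :: real assume "e > 0"
    then obtain N where N: "C * (1 / real p) ^ N < e" using inv_p_power_small by blast
    have "nv (u i - u N) < e" if "i \<ge> N" for i
      using step[of N "i - N"] that N by simp
    then show "\<exists>N. \<forall>i\<ge>N. \<forall>j\<ge>N. nv (u i - u j) < e"
      using nv_diff_trans_less nv_minus_commute by (intro exI[of _ N]) metis
  qed
  then obtain l where l: "(\<lambda>i. nv (u i - l)) \<longlonglongrightarrow> 0" by blast
  have "nv (l - u k) \<le> C * (1 / real p) ^ k" for k
  proof (rule field_le_epsilon)
    fix e :: real assume e: "e > 0"
    then have "eventually (\<lambda>i. nv (u i - l) < e) sequentially"
      using l by (simp add: order_tendstoD(2))
    moreover have "eventually (\<lambda>i. i \<ge> k) sequentially" by (rule eventually_ge_at_top)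
    ultimately have "eventually (\<lambda>i. i \<ge> k \<and> nv (u i - l) < e) sequentially"
      by eventually_elim auto
    then obtain i where i: "i \<ge> k" "nv (u i - l) < e"
      using eventually_happens'[OF sequentially_bot] by blast
    have 0: "C * (1 / real p) ^ k \<ge> 0" using C by simp
    have "nv (l - u i) \<le> C * (1 / real p) ^ k + e"
      using i(2) nv_minus_commute[of l "u i"] 0 by linarith
    moreover have "nv (u i - u k) \<le> C * (1 / real p) ^ k + e"
      using step[of k "i - k"] i e by simp
    ultimately show "nv (l - u k) \<le> C * (1 / real p) ^ k + e" by (rule nv_diff_trans_le)
  qed
  then show ?thesis by blast
qed

section \<open>Closures in the ambient field\<close>

lemma nv_closureI: "(\<And>e. e > 0 \<Longrightarrow> \<exists>y\<in>S. nv (x - y) < e) \<Longrightarrow> x \<in> nv_closure nv S"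
  by (simp add: nv_closure_def)

lemma nv_closureD: "x \<in> nv_closure nv S \<Longrightarrow> e > 0 \<Longrightarrow> \<exists>y\<in>S. nv (x - y) < e"
  by (simp add: nv_closure_def)

lemma nv_closure_superset: "S \<subseteq> nv_closure nv S"
  by (auto simp: nv_closure_def intro!: bexI)

lemma nv_closure_closure [simp]: "nv_closure nv (nv_closure nv S) = nv_closure nv S"
proof
  show "nv_closure nv (nv_closure nv S) \<subseteq> nv_closure nv S"
  proof
    fix x assume x: "x \<in> nv_closure nv (nv_closure nv S)"
    show "x \<in> nv_closure nv S"
    proof (rule nv_closureI)
      fix e :: real assume e: "e > 0"
      obtain y where y: "y \<in> nv_closure nv S" "nv (x - y) < e" using nv_closureD[OF x e] by blast
      obtain z where "z \<in> S" "nv (y - z) < e" using nv_closureD[OF y(1) e] by blast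
      then show "\<exists>z\<in>S. nv (x - z) < e" using y nv_diff_trans_less by blast
    qed
  qed
qed (rule nv_closure_superset)

lemma nv_closure_mono: "S \<subseteq> S' \<Longrightarrow> nv_closure nv S \<subseteq> nv_closure nv S'"
  unfolding nv_closure_def by blast

lemma nv_closureI_powers:
  assumes "\<And>k. \<exists>y\<in>S. nv (x - y) \<le> C * (1 / real p) ^ k"
  shows "x \<in> nv_closure nv S"
  by (rule nv_closureI) (meson assms inv_p_power_small le_less_trans)

lemma nv_closure_le: "(\<And>x. x \<in> S \<Longrightarrow> nv x \<le> r) \<Longrightarrow> r > 0 \<Longrightarrow> x \<in> nv_closure nv S \<Longrightarrow> nv x \<le> r"
proof -
  assume *: "\<And>x. x \<in> S \<Longrightarrow> nv x \<le> r" "r > 0" "x \<in> nv_closure nv S"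
  obtain y where "y \<in> S" "nv (x - y) < r" using nv_closureD[OF *(3,2)] by blast
  then show "nv x \<le> r" using nv_add_le[of "x - y" r y] * by simp
qed

lemma nv_closure_scale:
  assumes "x \<in> nv_closure nv S" "\<And>y. y \<in> S \<Longrightarrow> a * y \<in> S'"
  shows "a * x \<in> nv_closure nv S'"
proof (rule nv_closureI)
  fix e :: real assume e: "e > 0"
  \<comment> \<open>Adding 1 keeps the divisor positive also for \<open>a = 0\<close>.\<close>
  define c where "c = nv a + 1"
  have c: "c > 0" using nv_nonneg[of a] by (simp add: c_def)
  obtain y where y: "y \<in> S" "nv (x - y) < e / c" using nv_closureD[OF assms(1), of "e / c"] e c by auto
  have "nv (a * x - a * y) = nv a * nv (x - y)" by (simp add: nv_mult flip: right_diff_distrib)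
  also have "\<dots> \<le> c * nv (x - y)" by (intro mult_right_mono nv_nonneg) (simp add: c_def)
  also have "\<dots> < e" using y c by (simp add: field_simps)
  finally show "\<exists>y\<in>S'. nv (a * x - y) < e" using assms(2) y by blast
qed

lemma nv_closure_diff:
  assumes "x \<in> nv_closure nv S" "y \<in> nv_closure nv S" "\<And>x y. x \<in> S \<Longrightarrow> y \<in> S \<Longrightarrow> x - y \<in> S"
  shows "x - y \<in> nv_closure nv S"
proof (rule nv_closureI)
  fix e :: real assume e: "e > 0"
  obtain x' y' where "x' \<in> S" "nv (x - x') < e" "y' \<in> S" "nv (y - y') < e"
    using nv_closureD[OF assms(1) e] nv_closureD[OF assms(2) e] by blast
  moreover have "x - y - (x' - y') = (x - x') - (y - y')" by simp
  ultimately show "\<exists>z\<in>S. nv (x - y - z) < e" by (metis assms(3) nv_diff_less)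
qed

text \<open>One factor at a time: scaling by a limit point maps \<open>S\<close> into the closure,
  hence the closure into the closure of the closure.\<close>

lemma nv_closure_mult:
  assumes "x \<in> nv_closure nv S" "y \<in> nv_closure nv S" "\<And>x y. x \<in> S \<Longrightarrow> y \<in> S \<Longrightarrow> x * y \<in> S"
  shows "x * y \<in> nv_closure nv S"
proof -
  have "x * z \<in> nv_closure nv S" if "z \<in> S" for z
    using nv_closure_scale[OF assms(1), of z S] that assms(3) by (simp add: mult.commute)
  then have "x * y \<in> nv_closure nv (nv_closure nv S)" by (rule nv_closure_scale[OF assms(2)])
  then show ?thesis by simp
qed

lemma subring_nv_closure:
  assumes "subring S ambient"
  shows "subring (nv_closure nv S) ambient"
  using nv_closure_superset[of S]
  by (intro subring_ambientI nv_closure_diff nv_closure_mult) 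
     (auto simp: subring_ambient_one[OF assms] subring_ambient_diff[OF assms] subring_ambient_mult[OF assms])

end

section \<open>Closures of subrings with periodic Frobenius\<close>

text \<open>
  A subring \<open>B\<close> of the integers whose reduction modulo \<open>p\<close> is algebraic over the prime field in the
  sense that every element is fixed by a power of Frobenius. Its closure is then an unramified
  discrete valuation ring; this covers the integers, rings generated by roots of unity of order
  prime to \<open>p\<close>, and the integers of a finite unramified extension.
\<close>

locale frobenius_periodic = padic_universe p nv
  for p :: nat and nv :: "'a::{alg_closed_field, field_char_0} \<Rightarrow> real" +
  fixes B :: "'a set"
  assumes subring_B: "subring B ambient"
    and nv_B: "x \<in> B \<Longrightarrow> nv x \<le> 1"
    and frob_B: "x \<in> B \<Longrightarrow> \<exists>m\<ge>1. \<exists>y\<in>B. x ^ (p ^ m) - x = of_nat p * y"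
begin

abbreviation A where "A \<equiv> nv_closure nv B"

lemma subring_A: "subring A ambient"
  by (rule subring_nv_closure[OF subring_B])

lemmas A_closed = subring_ambient_closed[OF subring_A]
lemmas B_closed = subring_ambient_closed[OF subring_B]

lemma B_subset_A: "B \<subseteq> A"
  by (rule nv_closure_superset)

lemma nv_A: "x \<in> A \<Longrightarrow> nv x \<le> 1"
  by (rule nv_closure_le[of B]) (auto intro: nv_B)

text \<open>Arbitrarily high exponents are needed for limits. The factor
  \<open>b ^ (p ^ m) - b\<close> splits off every difference of equal powers of its two terms, so a
  single period \<open>m\<close> serves all its multiples.\<close>

lemma frob_B_iterate:
  assumes "b \<in> B"
  shows "\<exists>m\<ge>1. \<forall>k. \<exists>y\<in>B. b ^ (p ^ (m * k)) - b = of_nat p * y"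
proof -
  obtain m y where m: "m \<ge> 1" "y \<in> B" "b ^ (p ^ m) - b = of_nat p * y"
    using frob_B[OF assms] by blast
  have "\<exists>y\<in>B. b ^ (p ^ (m * k)) - b = of_nat p * y" for k
  proof (induction k)
    case 0
    show ?case using B_closed(2) by (intro bexI[of _ 0]) auto
  next
    case (Suc k)
    then obtain z where z: "z \<in> B" "b ^ (p ^ (m * k)) - b = of_nat p * z" by blast
    obtain t where t: "t \<in> B" "(b ^ (p ^ m)) ^ (p ^ (m * k)) - b ^ (p ^ (m * k)) = (b ^ (p ^ m) - b) * t"
      using subring_power_diff_dvd[OF subring_B, of "b ^ (p ^ m)" b "p ^ (m * k)"] assms B_closed(7) by blast
    have "b ^ (p ^ (m * Suc k)) = (b ^ (p ^ m)) ^ (p ^ (m * k))"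
      by (simp add: power_add flip: power_mult)
    then have "b ^ (p ^ (m * Suc k)) - b = (b ^ (p ^ m) - b) * t + (b ^ (p ^ (m * k)) - b)"
      using t by (simp add: algebra_simps)
    also have "\<dots> = of_nat p * (y * t + z)"
      unfolding m z by (simp add: algebra_simps)
    finally show ?case using m z t B_closed(3,4) by blast
  qed
  with m show ?thesis by blast
qed

text \<open>This is why \<open>p\<close> is a uniformizer. The congruence
  \<open>b ^ N - b = p * y\<close> shows that \<open>b / p\<close> differs from the element
  \<open>- y\<close> of \<open>B\<close> by \<open>b ^ N / p\<close>, and this error tends to 0
  along \<open>N = p ^ (m * k)\<close>.\<close>

lemma B_nv_less_1:
  assumes b: "b \<in> B" "nv b < 1"
  shows "b / of_nat p \<in> A"
proof -
  obtain m where m: "m \<ge> 1" "\<And>k. \<exists>y\<in>B. b ^ (p ^ (m * k)) - b = of_nat p * y"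
    using frob_B_iterate[OF b(1)] by blast
  show ?thesis
  proof (rule nv_closureI)
    fix e :: real assume e: "e > 0"
    have "(\<lambda>k. nv b ^ k) \<longlonglongrightarrow> 0"
      by (rule LIMSEQ_power_zero) (use b nv_nonneg[of b] in auto)
    then have "eventually (\<lambda>k. nv b ^ k < e / real p) sequentially"
      using e p_gt_1 by (simp add: order_tendstoD(2))
    then obtain k where k: "nv b ^ k < e / real p"
      using eventually_happens'[OF sequentially_bot] by blast
    have "k < p ^ k" by (rule power_gt_expt) (use p_gt_1 in simp)
    also have "p ^ k \<le> p ^ (m * k)" by (rule power_increasing) (use m p_gt_1 in auto)
    finally have "nv b ^ (p ^ (m * k)) \<le> nv b ^ k"
      by (intro power_decreasing) (use b nv_nonneg[of b] in auto)
    then have "real p * nv b ^ (p ^ (m * k)) \<le> real p * nv b ^ k"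
      by (intro mult_left_mono) auto
    also have "\<dots> < e" using k p_gt_1 by (simp add: field_simps)
    finally have *: "real p * nv b ^ (p ^ (m * k)) < e" .
    obtain y where y: "y \<in> B" "b ^ (p ^ (m * k)) - b = of_nat p * y" using m by blast
    have "b / of_nat p - (- y) = b ^ (p ^ (m * k)) / of_nat p"
      using y(2) by (simp add: field_simps)
    then have "nv (b / of_nat p - (- y)) = real p * nv b ^ (p ^ (m * k))"
      by (simp add: nv_divide nv_power nv_p)
    then show "\<exists>y\<in>B. nv (b / of_nat p - y) < e"
      using * y B_closed(5) by metis
  qed
qed

lemma A_nv_less_1:
  assumes x: "x \<in> A" "nv x < 1"
  shows "x / of_nat p \<in> A"
proof -
  have "x / of_nat p \<in> nv_closure nv A"
  proof (rule nv_closureI)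
    fix e :: real assume e: "e > 0"
    \<comment> \<open>The first bound compensates the division by \<open>p\<close>; the second
      forces the approximant \<open>b\<close> to have absolute value below 1 as well.\<close>
    define e' where "e' = min (e / real p) 1"
    have e': "e' > 0" using e p_gt_1 by (simp add: e'_def)
    obtain b where b: "b \<in> B" "nv (x - b) < e'" using nv_closureD[OF x(1) e'] by blast
    have "nv b < 1"
      using nv_diff_less[of x 1 "x - b"] x b by (simp add: e'_def)
    then have "b / of_nat p \<in> A" by (rule B_nv_less_1[OF b(1)])
    moreover have "nv (x / of_nat p - b / of_nat p) < e"
      using b p_gt_1 by (simp add: e'_def nv_divide nv_p field_simps flip: diff_divide_distrib)
    ultimately show "\<exists>y\<in>A. nv (x / of_nat p - y) < e" by blast
  qed
  then show ?thesis by simp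
qed

lemma A_pE: "x \<in> A \<Longrightarrow> nv x < 1 \<Longrightarrow> \<exists>y\<in>A. x = of_nat p * y"
  using A_nv_less_1 by (intro bexI[of _ "x / of_nat p"]) auto

lemma A_p_multiple_iff: "(\<exists>y\<in>A. x = of_nat p * y) \<longleftrightarrow> x \<in> A \<and> nv x < 1"
proof
  assume "\<exists>y\<in>A. x = of_nat p * y"
  then obtain y where y: "y \<in> A" "x = of_nat p * y" by blast
  have "nv x \<le> 1 / real p" using nv_mult_le[of "of_nat p" "1 / real p" y] y nv_A nv_p by simp
  also have "\<dots> < 1" using p_gt_1 by simp
  finally show "x \<in> A \<and> nv x < 1" using y A_closed(4,8) by blast
qed (use A_pE in blast)

lemma A_nv_less_1_le: "x \<in> A \<Longrightarrow> nv x < 1 \<Longrightarrow> nv x \<le> 1 / real p"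
  using A_pE[of x] nv_mult_le[of "of_nat p" "1 / real p"] nv_A nv_p by auto

lemma frob_A:
  assumes x: "x \<in> A"
  shows "\<exists>m\<ge>1. nv (x ^ (p ^ m) - x) < 1"
proof -
  obtain b where b: "b \<in> B" "nv (x - b) < 1" using nv_closureD[OF x, of 1] by auto
  obtain m y where m: "m \<ge> 1" "y \<in> B" "b ^ (p ^ m) - b = of_nat p * y"
    using frob_B[OF b(1)] by blast
  have "nv (x ^ (p ^ m) - b ^ (p ^ m)) < 1"
    using nv_power_diff_le[OF nv_A[OF x] nv_B[OF b(1)]] b(2) by (rule le_less_trans)
  moreover have "nv (b ^ (p ^ m) - b) < 1"
    using m B_subset_A A_p_multiple_iff by blast
  ultimately have "nv (x ^ (p ^ m) - b) < 1" by (rule nv_diff_trans_less)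
  moreover have "nv (b - x) < 1" using b by (simp add: nv_minus_commute)
  ultimately have "nv (x ^ (p ^ m) - x) < 1" by (rule nv_diff_trans_less)
  with m show ?thesis by blast
qed

text \<open>For a unit, \<open>x ^ (p ^ m)\<close> close to \<open>x\<close> means
  \<open>x ^ (p ^ m - 1) = 1 - h\<close> with \<open>nv h < 1\<close>. So
  \<open>x ^ (p ^ m - 2)\<close> times the geometric series in \<open>h\<close> converges to the
  inverse.\<close>

lemma A_unit:
  assumes x: "x \<in> A" "nv x = 1"
  shows "inverse x \<in> A"
proof -
  have x0: "x \<noteq> 0" using x by auto
  obtain m where m: "m \<ge> 1" "nv (x ^ (p ^ m) - x) < 1" using frob_A[OF x(1)] by blast
  have pm: "p ^ m \<ge> 2"
    using m p_gt_1 by (metis One_nat_def Suc_1 Suc_leI less_le_trans of_nat_1 of_nat_less_iff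
        one_less_power order_less_le_trans zero_less_one)
  define N where "N = p ^ m - 2"
  have N: "p ^ m = Suc (Suc N)" using pm by (simp add: N_def)
  define h where "h = 1 - x ^ Suc N"
  have "x ^ (p ^ m) - x = - (x * h)" by (simp add: N h_def algebra_simps)
  then have h: "nv h < 1" using m x by (simp add: nv_mult)
  have hA: "h \<in> A" unfolding h_def using x A_closed(1,6,7) by blast
  have "inverse x \<in> nv_closure nv A"
  proof (rule nv_closureI)
    fix e :: real assume e: "e > 0"
    have "(\<lambda>k. nv h ^ k) \<longlonglongrightarrow> 0"
      by (rule LIMSEQ_power_zero) (use h nv_nonneg[of h] in auto)
    then have "eventually (\<lambda>k. nv h ^ k < e) sequentially"
      using e by (simp add: order_tendstoD(2))
    then obtain k where k: "nv h ^ k < e"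
      using eventually_happens'[OF sequentially_bot] by blast
    define y where "y = x ^ N * (\<Sum>j<k. h ^ j)"
    have "x * y = (1 - h) * (\<Sum>j<k. h ^ j)" by (simp add: y_def h_def)
    also have "\<dots> = 1 - h ^ k" by (simp add: one_diff_power_eq)
    finally have "inverse x - y = inverse x * h ^ k" using x0 by (simp add: field_simps)
    then have "nv (inverse x - y) < e" using k x by (simp add: nv_mult nv_inverse nv_power)
    moreover have "y \<in> A" unfolding y_def by (intro A_closed x hA)
    ultimately show "\<exists>y\<in>A. nv (inverse x - y) < e" by blast
  qed
  then show ?thesis by simp
qed

text \<open>The representative is the limit of the powers \<open>x ^ (p ^ (m * k))\<close>. The
  first step has absolute value below 1, hence at most \<open>1 / real p\<close> since
  \<open>p\<close> is a uniformizer, and each later step gains another such factor.\<close>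

lemma teichmueller:
  assumes x: "x \<in> A"
  shows "\<exists>m\<ge>1. \<exists>z\<in>A. z ^ (p ^ m) = z \<and> nv (x - z) < 1"
proof -
  obtain m where m: "m \<ge> 1" "nv (x ^ (p ^ m) - x) < 1" using frob_A[OF x] by blast
  define u where "u k = x ^ (p ^ (m * k))" for k
  have uS: "u (Suc k) = u k ^ (p ^ m)" for k
    by (simp add: u_def power_add mult.commute flip: power_mult)
  have uA: "u k \<in> A" for k unfolding u_def by (intro A_closed x)
  have step: "nv (u (Suc k) - u k) \<le> 1 / real p * (1 / real p) ^ k" for k
  proof (induction k)
    case 0
    have "x ^ (p ^ m) - x \<in> A" by (intro A_closed x)
    then show ?case using A_nv_less_1_le m by (simp add: u_def)
  next
    case (Suc k)
    have "nv (u (Suc k) ^ (p ^ m) - u k ^ (p ^ m))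
        \<le> (1 / real p * (1 / real p) ^ k) * max (1 / real p * (1 / real p) ^ k) (1 / real p)"
      by (rule nv_prime_power_diff_le[OF nv_A[OF uA] nv_A[OF uA] Suc _ m(1)])
         (use p_gt_1 in \<open>auto intro: power_le_one simp flip: power_Suc\<close>)
    moreover have "1 / real p * (1 / real p) ^ k \<le> 1 / real p"
      by (rule mult_left_le) (use p_gt_1 in \<open>auto intro: power_le_one\<close>)
    ultimately show ?case unfolding uS[of "Suc k"] uS[of k] by (simp add: max_absorb2 mult.commute)
  qed
  obtain z where z: "\<And>k. nv (z - u k) \<le> 1 / real p * (1 / real p) ^ k"
    using nv_limit[of u, OF step] by blast
  have "z \<in> nv_closure nv A"
    by (rule nv_closureI_powers) (use z uA in blast)
  then have zA: "z \<in> A" by simp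
  have "z ^ (p ^ m) = z"
  proof (rule eq_if_nv_le_powers)
    fix k
    have mono: "1 / real p * (1 / real p) ^ Suc k \<le> 1 / real p * (1 / real p) ^ k"
      by (intro mult_left_mono power_decreasing) (use p_gt_1 in auto)
    have "nv (z ^ (p ^ m) - u (Suc k)) \<le> 1 / real p * (1 / real p) ^ k"
      unfolding uS using nv_power_diff_le[OF nv_A[OF zA] nv_A[OF uA]] z by (rule order_trans)
    moreover have "nv (u (Suc k) - z) \<le> 1 / real p * (1 / real p) ^ k"
      using order_trans[OF z mono] nv_minus_commute by metis
    ultimately show "nv (z ^ (p ^ m) - z) \<le> 1 / real p * (1 / real p) ^ k"
      by (rule nv_diff_trans_le)
  qed
  moreover have "nv (x - z) < 1"
  proof -
    have "nv (x - z) \<le> 1 / real p" using z[of 0] nv_minus_commute[of x z] by (simp add: u_def)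
    also have "\<dots> < 1" using p_gt_1 by simp
    finally show ?thesis .
  qed
  ultimately show ?thesis using m zA by blast
qed

section \<open>The fraction field of the closure\<close>

definition A_frac :: "'a set" where
  "A_frac = {x. \<exists>k. of_nat p ^ k * x \<in> A}"

lemma A_subset_A_frac: "A \<subseteq> A_frac"
  by (auto simp: A_frac_def intro: exI[of _ 0])

text \<open>Denominators are removed one \<open>p\<close> at a time: while a factor \<open>p\<close>
  remains, the element of \<open>A\<close> has absolute value below 1 and can be divided by
  \<open>p\<close> inside \<open>A\<close>.\<close>

lemma A_frac_integral:
  assumes "x \<in> A_frac" "nv x \<le> 1"
  shows "x \<in> A"
proof -
  obtain k where "of_nat p ^ k * x \<in> A" using assms by (auto simp: A_frac_def)
  then show ?thesis
  proof (induction k)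
    case (Suc k)
    have "nv (of_nat p * (of_nat p ^ k * x)) \<le> 1 / real p"
      using assms nv_of_nat_le[of p]
      by (intro nv_mult_le) (auto simp: nv_p nv_mult nv_power intro!: mult_le_one power_le_one nv_nonneg)
    also have "\<dots> < 1" using p_gt_1 by simp
    finally have "nv (of_nat p ^ Suc k * x) < 1" by (simp add: mult.assoc)
    from A_nv_less_1[OF Suc.prems this] have "of_nat p ^ k * x \<in> A" by (simp add: mult.assoc)
    then show ?case by (rule Suc.IH)
  qed simp
qed

text \<open>Divide by \<open>p\<close> until a unit appears. If this never stopped, \<open>x\<close>
  would be divisible by all powers of \<open>p\<close> and hence be 0.\<close>

lemma A_valuation:
  assumes "x \<in> A" "x \<noteq> 0"
  shows "\<exists>k. \<exists>y\<in>A. nv y = 1 \<and> x = of_nat p ^ k * y"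
proof -
  have *: "(\<exists>j. \<exists>y\<in>A. nv y = 1 \<and> x = of_nat p ^ j * y) \<or> (\<exists>y\<in>A. x = of_nat p ^ k * y)" for k
  proof (induction k)
    case 0
    then show ?case using assms by auto
  next
    case (Suc k)
    show ?case
    proof (cases "\<exists>y\<in>A. x = of_nat p ^ k * y")
      case True
      then obtain y where y: "y \<in> A" "x = of_nat p ^ k * y" by blast
      show ?thesis
      proof (cases "nv y = 1")
        case False
        then have "nv y < 1" using nv_A[OF y(1)] by simp
        then obtain z where "z \<in> A" "y = of_nat p * z" using A_pE y by blast
        then have "x = of_nat p ^ Suc k * z" using y by (simp add: mult_ac)
        with \<open>z \<in> A\<close> show ?thesis by blast
      qed (use y in blast)
    qed (use Suc in blast)
  qed
  show ?thesis
  proof (rule ccontr)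
    assume "\<not> ?thesis"
    then have "\<exists>y\<in>A. x = of_nat p ^ k * y" for k using *[of k] by blast
    then have "nv (x - 0) \<le> 1 * (1 / real p) ^ k" for k
      using nv_mult_le[of "of_nat p ^ k" "(1 / real p) ^ k"] nv_A by (force simp: nv_power nv_p)
    then have "x = 0" by (rule eq_if_nv_le_powers)
    with assms show False by simp
  qed
qed

text \<open>One denominator \<open>p ^ k\<close>, taken from an approximant \<open>y\<close> at
  distance below 1, works for all approximants \<open>z\<close> at distance below 1: then
  \<open>p ^ k * z\<close> has absolute value at most 1, and \<open>A_frac_integral\<close> puts it
  into \<open>A\<close>.\<close>

lemma A_frac_closed:
  "nv_closure nv A_frac = A_frac"
proof
  show "nv_closure nv A_frac \<subseteq> A_frac"
  proof
    fix x assume x: "x \<in> nv_closure nv A_frac"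
    obtain y where y: "y \<in> A_frac" "nv (x - y) < 1" using nv_closureD[OF x, of 1] by auto
    then obtain k where k: "of_nat p ^ k * y \<in> A" by (auto simp: A_frac_def)
    have "of_nat p ^ k * x \<in> nv_closure nv A"
    proof (rule nv_closureI)
      fix e :: real assume e: "e > 0"
      obtain z where z: "z \<in> A_frac" "nv (x - z) < min e 1"
        using nv_closureD[OF x, of "min e 1"] e by auto
      have pk: "nv (of_nat p ^ k) \<le> 1" by (intro nv_power_le_1 nv_of_nat_le)
      have "nv (z - y) < 1" using nv_diff_trans_less[of z x 1 y] z y nv_minus_commute[of z x] by simp
      then have "nv (of_nat p ^ k * (z - y)) \<le> 1"
        using nv_mult_le[OF pk, of "z - y"] by simp
      moreover have "nv (of_nat p ^ k * y) \<le> 1" using nv_A k by simp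
      ultimately have "nv (of_nat p ^ k * z) \<le> 1"
        using nv_add_le[of "of_nat p ^ k * (z - y)" 1 "of_nat p ^ k * y"] by (simp add: algebra_simps)
      moreover obtain j where "of_nat p ^ j * z \<in> A" using z by (auto simp: A_frac_def)
      then have "of_nat p ^ k * (of_nat p ^ j * z) \<in> A" using A_closed(4,7,8) by blast
      then have "of_nat p ^ k * z \<in> A_frac" unfolding A_frac_def
        by (auto intro!: exI[of _ j] simp: mult_ac)
      ultimately have "of_nat p ^ k * z \<in> A" by (intro A_frac_integral)
      moreover have "nv (of_nat p ^ k * x - of_nat p ^ k * z) < e"
      proof -
        have "nv (of_nat p ^ k * x - of_nat p ^ k * z) = nv ((x - z) * of_nat p ^ k)"
          by (simp add: algebra_simps)
        also have "\<dots> \<le> nv (x - z)" by (intro nv_mult_le pk) simp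
        finally show ?thesis using z by simp
      qed
      ultimately show "\<exists>y\<in>A. nv (of_nat p ^ k * x - y) < e" by blast
    qed
    then show "x \<in> A_frac" by (auto simp: A_frac_def)
  qed
qed (rule nv_closure_superset)

lemma A_frac_inverse:
  assumes "x \<in> A_frac" shows "inverse x \<in> A_frac"
proof (cases "x = 0")
  case False
  obtain k where k: "of_nat p ^ k * x \<in> A" using assms by (auto simp: A_frac_def)
  obtain j y where y: "y \<in> A" "nv y = 1" "of_nat p ^ k * x = of_nat p ^ j * y"
    using A_valuation[OF k] False by auto
  have y0: "y \<noteq> 0" using y by auto
  have "inverse (of_nat p ^ k * x) = inverse (of_nat p ^ j * y)" using y(3) by simp
  then have "of_nat p ^ j * inverse x = of_nat p ^ k * inverse y"
    using False y0 by (simp add: field_simps)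
  moreover have "of_nat p ^ k * inverse y \<in> A" using A_unit[OF y(1,2)] A_closed(4,7,8) by blast
  ultimately show ?thesis by (auto simp: A_frac_def intro!: exI[of _ j])
qed (use A_closed(2) in \<open>auto simp: A_frac_def\<close>)

lemma subring_A_frac: "subring A_frac ambient"
proof (rule subring_ambientI)
  show "1 \<in> A_frac" using A_closed(1) A_subset_A_frac by auto
  fix x y assume "x \<in> A_frac" "y \<in> A_frac"
  then obtain k j where k: "of_nat p ^ k * x \<in> A" "of_nat p ^ j * y \<in> A" by (auto simp: A_frac_def)
  have "of_nat p ^ (k + j) * (x - y) = of_nat p ^ j * (of_nat p ^ k * x) - of_nat p ^ k * (of_nat p ^ j * y)"
    by (simp add: algebra_simps power_add)
  also have "\<dots> \<in> A" by (intro A_closed k)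
  finally show "x - y \<in> A_frac" unfolding A_frac_def by blast
  have "of_nat p ^ (k + j) * (x * y) = (of_nat p ^ k * x) * (of_nat p ^ j * y)"
    by (simp add: algebra_simps power_add)
  also have "\<dots> \<in> A" by (intro A_closed k)
  finally show "x * y \<in> A_frac" unfolding A_frac_def by blast
qed

lemma subfield_A_frac: "subfield A_frac ambient"
proof -
  interpret field "ambient :: 'a ring" by (rule field_from_type_algebra)
  show ?thesis
  proof (rule subfieldI'[OF subring_A_frac])
    fix k assume k: "k \<in> A_frac - {\<zero>\<^bsub>ambient\<^esub>}"
    then have "inv\<^bsub>ambient\<^esub> k = inverse k"
      using comm_inv_char[of k "inverse k"] by simp
    then show "inv\<^bsub>ambient\<^esub> k \<in> A_frac" using A_frac_inverse k by auto
  qed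
qed

text \<open>The right-hand side depends on \<open>p\<close> alone, so any two instances of the
  locale have the same value group; this is how ramification index 1 is recognized later.\<close>

lemma nv_A_frac: "nv ` A_frac = insert 0 (range (\<lambda>(i, j). (1 / real p) ^ i / (1 / real p) ^ j))"
proof (intro equalityI subsetI)
  fix t assume "t \<in> nv ` A_frac"
  then obtain x k where x: "t = nv x" "of_nat p ^ k * x \<in> A" by (auto simp: A_frac_def)
  show "t \<in> insert 0 (range (\<lambda>(i, j). (1 / real p) ^ i / (1 / real p) ^ j))"
  proof (cases "x = 0")
    case False
    then obtain j y where y: "y \<in> A" "nv y = 1" "of_nat p ^ k * x = of_nat p ^ j * y"
      using A_valuation[OF x(2)] by auto
    have "(1 / real p) ^ k * nv x = (1 / real p) ^ j"
      using arg_cong[OF y(3), of nv] y(2) by (simp add: nv_mult nv_power nv_p)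
    then have "t = (1 / real p) ^ j / (1 / real p) ^ k"
      using p_gt_1 x by (simp add: field_simps)
    then show ?thesis by auto
  qed (use x in auto)
next
  fix t assume t: "t \<in> insert 0 (range (\<lambda>(i, j). (1 / real p) ^ i / (1 / real p) ^ j))"
  have "0 \<in> A_frac" using subring_ambient_closed(2)[OF subring_A_frac] .
  moreover have "nv (of_nat p ^ i / of_nat p ^ j) = (1 / real p) ^ i / (1 / real p) ^ j" for i j
    by (simp add: nv_divide nv_power nv_p)
  moreover have "of_nat p ^ i / of_nat p ^ j \<in> A_frac" for i j
    unfolding A_frac_def using A_closed(7,8) by (auto intro!: exI[of _ j])
  ultimately show "t \<in> nv ` A_frac" using t by (smt (verit) imageE image_eqI insertE nv_0 old.prod.exhaust case_prod_conv)
qed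

end

section \<open>Finite extensions of the \<open>p\<close>-adic numbers\<close>

text \<open>For \<open>T\<close> containing 1 and closed under negation and products this is the
  subring generated by \<open>T\<close>. The inductive form lets the Frobenius congruence be proved
  by adding one generator at a time.\<close>

inductive_set finite_sums :: "'a::comm_ring_1 set \<Rightarrow> 'a set" for T where
  zero: "0 \<in> finite_sums T"
| add: "x \<in> finite_sums T \<Longrightarrow> z \<in> T \<Longrightarrow> x + z \<in> finite_sums T"

lemma finite_sums_superset: "z \<in> T \<Longrightarrow> z \<in> finite_sums T"
  using finite_sums.add[OF finite_sums.zero] by fastforce

lemma finite_sums_mono: "T \<subseteq> T' \<Longrightarrow> finite_sums T \<subseteq> finite_sums T'"
proof
  fix x assume "T \<subseteq> T'" "x \<in> finite_sums T"
  from this(2,1) show "x \<in> finite_sums T'" by induction (auto intro: finite_sums.intros)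
qed

lemma finite_sums_add: "y \<in> finite_sums T \<Longrightarrow> x \<in> finite_sums T \<Longrightarrow> x + y \<in> finite_sums T"
proof (induction rule: finite_sums.induct)
  case (add y z)
  then show ?case using finite_sums.add[of "x + y" T z] by (simp add: add.assoc)
qed simp

lemma finite_sums_uminus:
  "x \<in> finite_sums T \<Longrightarrow> (\<And>z. z \<in> T \<Longrightarrow> - z \<in> T) \<Longrightarrow> - x \<in> finite_sums T"
proof (induction rule: finite_sums.induct)
  case (add y z)
  then show ?case using finite_sums.add[of "- y" T "- z"] by simp
qed (simp add: finite_sums.zero)

lemma finite_sums_mult_elem:
  "x \<in> finite_sums T \<Longrightarrow> (\<And>z w. z \<in> T \<Longrightarrow> w \<in> T \<Longrightarrow> z * w \<in> T) \<Longrightarrow> w \<in> T \<Longrightarrow> x * w \<in> finite_sums T"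
proof (induction rule: finite_sums.induct)
  case (add y z)
  then show ?case using finite_sums.add[of "y * w" T "z * w"] by (simp add: algebra_simps)
qed (simp add: finite_sums.zero)

lemma finite_sums_mult:
  "y \<in> finite_sums T \<Longrightarrow> (\<And>z w. z \<in> T \<Longrightarrow> w \<in> T \<Longrightarrow> z * w \<in> T) \<Longrightarrow> x \<in> finite_sums T \<Longrightarrow>
   x * y \<in> finite_sums T"
proof (induction rule: finite_sums.induct)
  case (add y z)
  then show ?case
    using finite_sums_add[of "x * z" T "x * y"] finite_sums_mult_elem[of x T z] by (simp add: algebra_simps)
qed (simp add: finite_sums.zero)

lemma subring_finite_sums:
  assumes "1 \<in> T" "\<And>z. z \<in> T \<Longrightarrow> - z \<in> T" "\<And>z w. z \<in> T \<Longrightarrow> w \<in> T \<Longrightarrow> z * w \<in> T"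
  shows "subring (finite_sums T) ambient"
proof (rule subring_ambientI)
  fix x y assume xy: "x \<in> finite_sums T" "y \<in> finite_sums T"
  show "x - y \<in> finite_sums T"
    using finite_sums_add[OF finite_sums_uminus[OF xy(2) assms(2)] xy(1)] by simp
  show "x * y \<in> finite_sums T" by (rule finite_sums_mult[OF xy(2) assms(3) xy(1)])
qed (simp add: assms finite_sums_superset)

text \<open>Frobenius is additive modulo \<open>p\<close> and fixes every generator exactly. The
  correction terms stay in \<open>finite_sums T\<close> because it is a ring.\<close>

lemma finite_sums_frobenius:
  assumes T: "1 \<in> T" "\<And>z. z \<in> T \<Longrightarrow> - z \<in> T" "\<And>z w. z \<in> T \<Longrightarrow> w \<in> T \<Longrightarrow> z * w \<in> T"
    and p: "Factorial_Ring.prime (p::nat)" and m: "\<And>z. z \<in> T \<Longrightarrow> z ^ (p ^ m) = z"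
  shows "x \<in> finite_sums T \<Longrightarrow> \<exists>y\<in>finite_sums T. x ^ (p ^ m) - x = of_nat p * y"
proof (induction rule: finite_sums.induct)
  case zero
  then show ?case using p finite_sums.zero[of T] by (intro bexI[of _ 0]) (auto simp: prime_gt_0_nat zero_power)
next
  case (add x z)
  note sub = subring_finite_sums[OF T]
  obtain y where y: "y \<in> finite_sums T" "x ^ (p ^ m) - x = of_nat p * y" using add by blast
  obtain y' where y': "y' \<in> finite_sums T"
      "(x + z) ^ (p ^ m) = x ^ (p ^ m) + z ^ (p ^ m) + of_nat p * y'"
    using subring_add_power_prime_power[OF sub p add(1) finite_sums_superset[OF add(2)]] by blast
  have "(x + z) ^ (p ^ m) - (x + z) = (x ^ (p ^ m) - x) + of_nat p * y'"
    using y' m[OF add(2)] by simp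
  also have "\<dots> = of_nat p * (y + y')" unfolding y by (simp add: algebra_simps)
  finally show ?case using finite_sums_add[OF y'(1) y(1)] by blast
qed

lemma finite_sums_Ints: "finite_sums {1, -1} = \<int>"
proof (intro equalityI subsetI)
  fix x :: 'a assume "x \<in> finite_sums {1, -1}"
  then show "x \<in> \<int>" by induction auto
next
  fix x :: 'a assume "x \<in> \<int>"
  then obtain n where n: "x = of_int n" by (auto elim: Ints_cases)
  have sub: "subring (finite_sums {1, -1 :: 'a}) ambient" by (rule subring_finite_sums) auto
  show "x \<in> finite_sums {1, -1}"
    using subring_ambient_of_nat[OF sub] subring_ambient_uminus[OF sub subring_ambient_of_nat[OF sub]] n
    by (cases n rule: int_cases2) auto
qed

lemma subfield_ambient_inverse:
  assumes "subfield E (ambient :: 'a::field ring)" "x \<in> E"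
  shows "inverse x \<in> E"
proof (cases "x = 0")
  case True
  then show ?thesis using assms by simp
next
  case False
  interpret field "ambient :: 'a ring" by (rule field_from_type_algebra)
  have "inv\<^bsub>ambient\<^esub> x = inverse x"
    using comm_inv_char[of x "inverse x"] False by simp
  then show ?thesis using subfield_m_inv(1)[OF assms(1), of x] assms False by auto
qed

text \<open>Oddness of \<open>p\<close> makes the solutions of \<open>z ^ (p ^ m) = z\<close> closed
  under negation, so that sums of them form a ring.\<close>

locale odd_padic_universe = padic_universe +
  assumes odd_p: "odd p"
begin

lemma minus_power_p: "(- z) ^ (p ^ m) = - (z ^ (p ^ m))" for z :: 'a
  using odd_p by (simp add: power_minus_odd)

lemma frobenius_periodic_finite_sums:
  assumes T: "1 \<in> T" "\<And>z. z \<in> T \<Longrightarrow> - z \<in> T" "\<And>z w. z \<in> T \<Longrightarrow> w \<in> T \<Longrightarrow> z * w \<in> T"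
    and m: "m \<ge> 1" "\<And>z. z \<in> T \<Longrightarrow> z ^ (p ^ m) = z"
  shows "frobenius_periodic p nv (finite_sums T)"
proof (intro frobenius_periodic.intro frobenius_periodic_axioms.intro padic_universe_axioms)
  show "subring (finite_sums T) ambient" by (rule subring_finite_sums[OF T])
  show "\<exists>m\<ge>1. \<exists>y\<in>finite_sums T. x ^ p ^ m - x = of_nat p * y" if "x \<in> finite_sums T" for x
    using finite_sums_frobenius[OF T prime_p m(2) that] m(1) by blast
  \<comment> \<open>An absolute value above 1 would grow strictly under the exponent
    \<open>p ^ m > 1\<close>, but \<open>z\<close> is fixed by this power.\<close>
  have nvT: "nv z \<le> 1" if "z \<in> T" for z
  proof (rule ccontr)
    assume *: "\<not> nv z \<le> 1"
    have "1 < p" using p_gt_1 by simp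
    then have "1 < p ^ m" using m(1) by (intro one_less_power) auto
    then have "nv z ^ 1 < nv z ^ (p ^ m)" using * by (intro power_strict_increasing) auto
    then show False using arg_cong[OF m(2)[OF that], of nv] by (simp add: nv_power)
  qed
  show "nv x \<le> 1" if "x \<in> finite_sums T" for x
    using that by (induction rule: finite_sums.induct) (auto intro: nv_add_le nvT)
qed

text \<open>Here \<open>Zp.A\<close> is the ring of \<open>p\<close>-adic integers. The periodicity
  is Fermat's little theorem, obtained from the generators 1 and -1 with period
  \<open>m = 1\<close>.\<close>

sublocale Zp: frobenius_periodic p nv "\<int>"
proof -
  have "frobenius_periodic p nv (finite_sums {1, -1})"
    by (rule frobenius_periodic_finite_sums[of _ 1]) (use minus_power_p[of 1 1] in auto)
  then show "frobenius_periodic p nv \<int>" by (simp add: finite_sums_Ints)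
qed

text \<open>Transfers the valuation theory to \<open>Qp nv\<close>: \<open>Zp.A_frac\<close> is a
  closed field containing the integers, hence contains the closure of the rationals, and scaling by
  \<open>inverse (p ^ k)\<close> gives the other inclusion.\<close>

lemma Qp_eq: "Qp nv = Zp.A_frac"
proof (intro equalityI subsetI)
  fix x assume x: "x \<in> Qp nv"
  have int: "of_int n \<in> Zp.A_frac" for n
    using Zp.A_subset_A_frac Zp.B_subset_A by (auto intro: Ints_of_int)
  have "\<rat> \<subseteq> Zp.A_frac"
  proof
    fix y :: 'a assume "y \<in> \<rat>"
    then obtain a b where "y = of_int a / of_int b" by (auto elim: Rats_cases')
    then show "y \<in> Zp.A_frac"
      using subring_ambient_mult[OF Zp.subring_A_frac int Zp.A_frac_inverse[OF int]]
      by (simp add: field_class.field_divide_inverse)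
  qed
  then have "nv_closure nv \<rat> \<subseteq> nv_closure nv Zp.A_frac" by (rule nv_closure_mono)
  then show "x \<in> Zp.A_frac" using x by (auto simp: Qp_def Zp.A_frac_closed)
next
  fix x assume "x \<in> Zp.A_frac"
  then obtain k where k: "of_nat p ^ k * x \<in> nv_closure nv \<int>" by (auto simp: Zp.A_frac_def)
  have "inverse (of_nat p ^ k) * (of_nat p ^ k * x) \<in> nv_closure nv \<rat>"
    by (rule nv_closure_scale[OF k]) (use Ints_subset_Rats in auto)
  then show "x \<in> Qp nv" by (simp add: Qp_def flip: mult.assoc)
qed

lemma subfield_Qp: "subfield (Qp nv) ambient"
  by (simp add: Qp_eq Zp.subfield_A_frac)

lemma subring_Qp: "subring (Qp nv) ambient"
  by (simp add: Qp_eq Zp.subring_A_frac)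

lemma Qp_closed: "nv_closure nv (Qp nv) = Qp nv"
  by (simp add: Qp_eq Zp.A_frac_closed)

lemma nv_int_mod: "nv (of_int i - of_int (i mod int p ^ j)) \<le> (1 / real p) ^ j"
proof -
  have "i - i mod int p ^ j = int p ^ j * (i div int p ^ j)"
    by (simp add: minus_mod_eq_mult_div)
  then have "(of_int i - of_int (i mod int p ^ j) :: 'a) = of_nat p ^ j * of_int (i div int p ^ j)"
    by (metis of_int_diff of_int_mult of_int_of_nat_eq of_int_power)
  then show ?thesis
    using nv_mult_le[of "of_nat p ^ j" "(1 / real p) ^ j"] Zp.nv_B by (simp add: nv_power nv_p)
qed

text \<open>The form of local compactness that passes through an induction on the dimension. The net
  \<open>N\<close> need not lie in \<open>V\<close>.\<close>

definition totally_bounded :: "'a set \<Rightarrow> bool" where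
  "totally_bounded V \<longleftrightarrow>
     (\<forall>C. \<forall>e>0. \<exists>N. finite N \<and> (\<forall>y\<in>V. nv y \<le> C \<longrightarrow> (\<exists>z\<in>N. nv (y - z) < e)))"

lemma totally_bounded_Qp: "totally_bounded (Qp nv)"
  unfolding totally_bounded_def
proof (intro allI impI)
  fix C e :: real assume e: "e > 0"
  \<comment> \<open>Multiplication by \<open>p ^ k\<close> moves the ball of radius \<open>C\<close>
    into the \<open>p\<close>-adic integers. Dividing back enlarges errors by the same factor, so
    the target radius \<open>e\<close> is shrunk to \<open>e'\<close>.\<close>
  obtain k where k: "C * (1 / real p) ^ k < 1" using inv_p_power_small[of 1 C] by auto
  define e' where "e' = e * (1 / real p) ^ k"
  have e': "e' > 0" using e by (simp add: e'_def)
  obtain j where j: "(1 / real p) ^ j < e'" using inv_p_power_small[OF e', of 1] by auto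
  define N :: "'a set" where "N = (\<lambda>i. of_int i / of_nat p ^ k) ` {0..<int p ^ j}"
  have "\<exists>z\<in>N. nv (y - z) < e" if y: "y \<in> Qp nv" "nv y \<le> C" for y
  proof -
    have "nv (of_nat p ^ k * y) = (1 / real p) ^ k * nv y" by (simp add: nv_mult nv_power nv_p)
    also have "\<dots> \<le> (1 / real p) ^ k * C" by (intro mult_left_mono y) auto
    also have "\<dots> < 1" using k by (simp add: mult.commute)
    finally have "nv (of_nat p ^ k * y) < 1" .
    moreover have "of_nat p ^ k * y \<in> Qp nv"
      using subring_ambient_closed(4,7,8)[OF subring_Qp] y by blast
    ultimately have "of_nat p ^ k * y \<in> Zp.A"
      by (intro Zp.A_frac_integral) (auto simp: Qp_eq)
    then obtain a where "a \<in> \<int>" and a: "nv (of_nat p ^ k * y - a) < e'"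
      using nv_closureD e' by blast
    then obtain i where i: "nv (of_nat p ^ k * y - of_int i) < e'" by (auto elim: Ints_cases)
    moreover have "nv (of_int i - of_int (i mod int p ^ j)) < e'"
      using nv_int_mod j by (rule le_less_trans)
    ultimately have "nv (of_nat p ^ k * y - of_int (i mod int p ^ j)) < e'"
      by (rule nv_diff_trans_less)
    moreover have "y - of_int (i mod int p ^ j) / of_nat p ^ k =
        (of_nat p ^ k * y - of_int (i mod int p ^ j)) / of_nat p ^ k"
      by (simp add: field_simps)
    ultimately have "nv (y - of_int (i mod int p ^ j) / of_nat p ^ k) < e"
      by (simp add: nv_divide nv_power nv_p e'_def field_simps)
    moreover have "of_int (i mod int p ^ j) / of_nat p ^ k \<in> N"
      by (simp add: N_def)
    ultimately show ?thesis by blast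
  qed
  moreover have "finite N" by (simp add: N_def)
  ultimately show "\<exists>N. finite N \<and> (\<forall>y\<in>Qp nv. nv y \<le> C \<longrightarrow> (\<exists>z\<in>N. nv (y - z) < e))" by blast
qed

text \<open>
  Induction on the dimension: in \<open>V + Qp * v\<close> with \<open>V\<close> closed the coefficient of \<open>v\<close> is bounded by the
  absolute value, because \<open>v\<close> has positive distance from \<open>V\<close>.
\<close>

lemma dimension_closed_totally_bounded:
  assumes "ring.dimension ambient n (Qp nv) V"
  shows "nv_closure nv V = V \<and> totally_bounded V \<and> 0 \<in> V \<and> (\<forall>x\<in>V. \<forall>y\<in>V. x - y \<in> V) \<and>
         (\<forall>a\<in>Qp nv. \<forall>x\<in>V. a * x \<in> V)"
proof -
  interpret field "ambient :: 'a ring" by (rule field_from_type_algebra)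
  note QC = subring_ambient_closed[OF subring_Qp]
  from assms show ?thesis
  proof (induction n "Qp nv" V rule: dimension.induct)
    case zero_dim
    have "nv_closure nv {0} \<subseteq> {0}"
    proof
      fix x assume x: "x \<in> nv_closure nv {0}"
      then have "x = 0" by (intro eq_if_nv_le) (auto simp: nv_closure_def intro: less_imp_le)
      then show "x \<in> {0}" by simp
    qed
    then have "nv_closure nv {0} = {0}" using nv_closure_superset by blast
    moreover have "totally_bounded {0}"
      unfolding totally_bounded_def by (auto intro!: exI[of _ "{0}"])
    ultimately show ?case by simp
  next
    case (Suc_dim v V n)
    then have cl: "nv_closure nv V = V" and tb: "totally_bounded V" and V0: "0 \<in> V"
      and Vd: "\<And>x y. x \<in> V \<Longrightarrow> y \<in> V \<Longrightarrow> x - y \<in> V"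
      and Vs: "\<And>a x. a \<in> Qp nv \<Longrightarrow> x \<in> V \<Longrightarrow> a * x \<in> V" and v: "v \<notin> V"
      by auto
    define W where "W = line_extension (Qp nv) v V"
    have W: "x \<in> W \<longleftrightarrow> (\<exists>a\<in>Qp nv. \<exists>y\<in>V. x = a * v + y)" for x
      unfolding W_def line_extension_mem_iff by simp
    obtain \<delta> where \<delta>: "\<delta> > 0" "\<And>y. y \<in> V \<Longrightarrow> nv (v - y) \<ge> \<delta>"
      using v cl unfolding nv_closure_def by (smt (verit) mem_Collect_eq)
    have coeff: "nv a \<le> nv (a * v + y) / \<delta>" if "a \<in> Qp nv" "y \<in> V" for a y
    proof (cases "a = 0")
      case False
      have "inverse a \<in> Qp nv" using subfield_ambient_inverse[OF subfield_Qp that(1)] .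
      then have "- inverse a * y \<in> V" using Vs QC(5) that by blast
      then have "\<delta> \<le> nv (v - (- inverse a * y))" by (rule \<delta>)
      then have "nv a * \<delta> \<le> nv (a * (v - (- inverse a * y)))"
        by (simp add: nv_mult mult_left_mono nv_nonneg)
      also have "a * (v - (- inverse a * y)) = a * v + y"
        using False by (simp add: algebra_simps)
      finally show ?thesis using \<delta>(1) by (simp add: field_simps)
    qed (use \<delta>(1) nv_nonneg in simp)
    have "W \<subseteq> nv_closure nv W" by (rule nv_closure_superset)
    moreover have "nv_closure nv W \<subseteq> W"
    proof
      fix x assume x: "x \<in> nv_closure nv W"
      have "\<exists>a y. a \<in> Qp nv \<and> y \<in> V \<and> nv (x - (a * v + y)) < (1 / real p) ^ j" for j
      proof -
        obtain z where "z \<in> W" "nv (x - z) < (1 / real p) ^ j"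
          using nv_closureD[OF x, of "(1 / real p) ^ j"] by auto
        then show ?thesis using W by metis
      qed
      then obtain a y where ay: "\<And>j. a j \<in> Qp nv" "\<And>j. y j \<in> V"
          "\<And>j. nv (x - (a j * v + y j)) < (1 / real p) ^ j"
        by metis
      have "nv (a (Suc j) - a j) \<le> (1 / \<delta>) * (1 / real p) ^ j" for j
      proof -
        have "nv (x - (a (Suc j) * v + y (Suc j))) < (1 / real p) ^ j"
          using ay(3)[of "Suc j"] power_decreasing[of j "Suc j" "1 / real p"] p_gt_1 by simp
        then have "nv ((a (Suc j) * v + y (Suc j)) - (a j * v + y j)) \<le> (1 / real p) ^ j"
          using ay(3)[of j] nv_diff_trans_less nv_minus_commute by (metis less_imp_le)
        also have "(a (Suc j) * v + y (Suc j)) - (a j * v + y j) =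
            (a (Suc j) - a j) * v + (y (Suc j) - y j)"
          by (simp add: algebra_simps)
        finally have "nv ((a (Suc j) - a j) * v + (y (Suc j) - y j)) / \<delta> \<le> (1 / real p) ^ j / \<delta>"
          using \<delta>(1) by (intro divide_right_mono) auto
        moreover have "nv (a (Suc j) - a j) \<le> nv ((a (Suc j) - a j) * v + (y (Suc j) - y j)) / \<delta>"
          by (intro coeff QC Vd ay)
        ultimately show ?thesis by simp
      qed
      then obtain b where b: "\<And>j. nv (b - a j) \<le> (1 / \<delta>) * (1 / real p) ^ j"
        using nv_limit[of a] by blast
      have "b \<in> nv_closure nv (Qp nv)"
        by (rule nv_closureI_powers[of _ _ "1 / \<delta>"]) (use ay b in blast)
      then have bQ: "b \<in> Qp nv" by (simp add: Qp_closed)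
      \<comment> \<open>\<open>C\<close> dominates the error 1 of the approximants and the
        coefficient error \<open>1 / \<delta>\<close> multiplied by \<open>nv v\<close>. The
        components \<open>y j\<close> need no limit of their own: they approximate
        \<open>x - b * v\<close>, and \<open>V\<close> is closed.\<close>
      define C where "C = max 1 (nv v / \<delta>)"
      have "nv (x - b * v - y j) \<le> C * (1 / real p) ^ j" for j
      proof -
        have "x - b * v - y j = (x - (a j * v + y j)) - (b - a j) * v" by (simp add: algebra_simps)
        moreover have "nv (x - (a j * v + y j)) \<le> C * (1 / real p) ^ j"
        proof -
          have "1 * (1 / real p) ^ j \<le> C * (1 / real p) ^ j"
            by (intro mult_right_mono) (auto simp: C_def)
          then show ?thesis using ay(3)[of j] by linarith
        qed
        moreover have "nv ((b - a j) * v) \<le> C * (1 / real p) ^ j"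
        proof -
          have "nv ((b - a j) * v) \<le> (1 / \<delta> * (1 / real p) ^ j) * nv v"
            unfolding nv_mult by (intro mult_right_mono b nv_nonneg)
          also have "\<dots> = (nv v / \<delta>) * (1 / real p) ^ j" by simp
          also have "\<dots> \<le> C * (1 / real p) ^ j" by (intro mult_right_mono) (auto simp: C_def)
          finally show ?thesis .
        qed
        ultimately show ?thesis by (metis nv_diff_le)
      qed
      then have "x - b * v \<in> nv_closure nv V"
        by (intro nv_closureI_powers[of _ _ C]) (use ay in blast)
      then have "x - b * v \<in> V" by (simp add: cl)
      then show "x \<in> W" unfolding W using bQ by (intro bexI[of _ b] bexI[of _ "x - b * v"]) auto
    qed
    ultimately have "nv_closure nv W = W" by blast
    moreover have "totally_bounded W"
      unfolding totally_bounded_def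
    proof (intro allI impI)
      fix C e :: real assume e: "e > 0"
      define e' where "e' = e / (nv v + 1)"
      have nvv: "nv v + 1 > 0" using nv_nonneg[of v] by linarith
      have e': "e' > 0" using e nvv by (simp add: e'_def)
      \<comment> \<open>By \<open>coeff\<close> the coefficient is bounded by
        \<open>C / \<delta>\<close>, and then the component in \<open>V\<close> is bounded as a
        difference. So a net for coefficients and a net for \<open>V\<close> combine to one for
        \<open>W\<close>.\<close>
      obtain N1 where N1: "finite N1" "\<And>a. a \<in> Qp nv \<Longrightarrow> nv a \<le> C / \<delta> \<Longrightarrow> \<exists>z\<in>N1. nv (a - z) < e'"
        using totally_bounded_Qp e' unfolding totally_bounded_def by metis
      obtain N2 where N2: "finite N2"
          "\<And>y. y \<in> V \<Longrightarrow> nv y \<le> max C (C / \<delta> * nv v) \<Longrightarrow> \<exists>z\<in>N2. nv (y - z) < e"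
        using tb e unfolding totally_bounded_def by metis
      define N where "N = (\<lambda>(a, y). a * v + y) ` (N1 \<times> N2)"
      have "\<exists>z\<in>N. nv (x - z) < e" if x: "x \<in> W" "nv x \<le> C" for x
      proof -
        obtain a y where ay: "a \<in> Qp nv" "y \<in> V" "x = a * v + y" using x W by blast
        have a: "nv a \<le> C / \<delta>"
        proof -
          have "nv a \<le> nv x / \<delta>" unfolding ay(3) by (rule coeff[OF ay(1,2)])
          also have "\<dots> \<le> C / \<delta>" using x \<delta>(1) by (intro divide_right_mono) auto
          finally show ?thesis .
        qed
        have "nv (a * v) \<le> C / \<delta> * nv v"
          unfolding nv_mult by (intro mult_right_mono a nv_nonneg)
        moreover have "y = x - a * v" using ay by simp
        ultimately have "nv y \<le> max C (C / \<delta> * nv v)"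
          using x nv_diff_le[of x "max C (C / \<delta> * nv v)" "a * v"] by simp
        then obtain z2 where z2: "z2 \<in> N2" "nv (y - z2) < e" using N2 ay by blast
        obtain z1 where z1: "z1 \<in> N1" "nv (a - z1) < e'" using N1 a ay by blast
        have "nv ((a - z1) * v) \<le> e' * nv v"
          unfolding nv_mult using z1 by (intro mult_right_mono nv_nonneg) simp
        also have "\<dots> < e' * (nv v + 1)" using e' by simp
        also have "\<dots> = e" using nvv by (simp add: e'_def)
        finally have "nv ((a - z1) * v + (y - z2)) < e" using z2 by (intro nv_add_less)
        moreover have "x - (z1 * v + z2) = (a - z1) * v + (y - z2)" by (simp add: ay algebra_simps)
        moreover have "z1 * v + z2 \<in> N" using z1 z2 by (force simp: N_def)
        ultimately show ?thesis by metis
      qed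
      moreover have "finite N" using N1 N2 by (simp add: N_def)
      ultimately show "\<exists>N. finite N \<and> (\<forall>y\<in>W. nv y \<le> C \<longrightarrow> (\<exists>z\<in>N. nv (y - z) < e))" by blast
    qed
    moreover have "0 \<in> W" unfolding W using QC(2) V0 by (intro bexI[of _ 0]) auto
    moreover have "x - y \<in> W" if xy: "x \<in> W" "y \<in> W" for x y
    proof -
      obtain a x' b y' where "a \<in> Qp nv" "x' \<in> V" "x = a * v + x'" "b \<in> Qp nv" "y' \<in> V" "y = b * v + y'"
        using xy W by metis
      then show ?thesis unfolding W
        by (intro bexI[of _ "a - b"] bexI[of _ "x' - y'"]) (auto simp: algebra_simps intro: QC Vd)
    qed
    moreover have "a * x \<in> W" if xy: "a \<in> Qp nv" "x \<in> W" for a x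
    proof -
      obtain b y' where "b \<in> Qp nv" "y' \<in> V" "x = b * v + y'" using xy W by metis
      then show ?thesis unfolding W
        by (intro bexI[of _ "a * b"] bexI[of _ "a * y'"]) (auto simp: algebra_simps intro: QC Vs xy)
    qed
    ultimately show ?case unfolding W_def[symmetric] by blast
  qed
qed

lemma finite_ext_closed:
  assumes "finite_field_ext (Qp nv) E" shows "nv_closure nv E = E"
proof -
  interpret field "ambient :: 'a ring" by (rule field_from_type_algebra)
  from assms obtain n where "dimension n (Qp nv) E"
    unfolding finite_field_ext_def finite_dimension_def by blast
  then show ?thesis using dimension_closed_totally_bounded by blast
qed

text \<open>A pigeonhole argument in place of finiteness of the residue field: two of the powers
  \<open>x ^ (p ^ j)\<close> lie near the same point of a finite net. Their difference is congruent
  to a \<open>p ^ i\<close>-th power of \<open>x ^ (p ^ m) - x\<close>, and an element with small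
  power is small.\<close>

lemma finite_ext_residue_periodic:
  assumes E: "finite_field_ext (Qp nv) E" and x: "x \<in> E" "nv x \<le> 1"
  shows "\<exists>m\<ge>1. nv (x ^ (p ^ m) - x) < 1"
proof -
  interpret field "ambient :: 'a ring" by (rule field_from_type_algebra)
  from E obtain n where n: "dimension n (Qp nv) E"
    unfolding finite_field_ext_def finite_dimension_def by blast
  have E': "subring E ambient" using E subfieldE(1) unfolding finite_field_ext_def by blast
  obtain N where N: "finite N" "\<And>y. y \<in> E \<Longrightarrow> nv y \<le> 1 \<Longrightarrow> \<exists>z\<in>N. nv (y - z) < 1"
    using dimension_closed_totally_bounded[OF n] unfolding totally_bounded_def
    by (metis zero_less_one)
  have "\<exists>z\<in>N. nv (x ^ (p ^ j) - z) < 1" for j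
    by (intro N nv_power_le_1 x subring_ambient_power[OF E'])
  then obtain f where f: "\<And>j::nat. f j \<in> N" "\<And>j. nv (x ^ (p ^ j) - f j) < 1" by metis
  have "\<not> inj f"
    using finite_imageD[of f UNIV] finite_subset[of "range f" N] f(1) N(1) by (meson image_subset_iff infinite_UNIV_nat)
  then obtain i j where ij: "i < j" "f i = f j"
    unfolding inj_def by (metis linorder_neqE_nat)
  have close: "nv (x ^ (p ^ j) - x ^ (p ^ i)) < 1"
    using f(2)[of i] f(2)[of j] ij(2) nv_diff_trans_less nv_minus_commute by metis
  define m where "m = j - i"
  define a where "a = x ^ (p ^ m)"
  have a: "a ^ (p ^ i) = x ^ (p ^ j)"
    using ij by (simp add: a_def m_def flip: power_mult power_add)
  have "nv ((a + - x) ^ (p ^ i) - a ^ (p ^ i) - (- x) ^ (p ^ i)) \<le> 1 / real p"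
    by (rule nv_mod_p_power) (auto simp: a_def intro: nv_power_le_1 x)
  also have "\<dots> < 1" using p_gt_1 by simp
  finally have "nv ((a - x) ^ (p ^ i) - (x ^ (p ^ j) - x ^ (p ^ i))) < 1"
    by (simp add: minus_power_p a algebra_simps)
  then have "nv ((a - x) ^ (p ^ i)) < 1"
    using nv_add_less[OF _ close] by fastforce
  then have "nv (a - x) ^ (p ^ i) < 1" by (simp add: nv_power)
  then have "nv (a - x) < 1" by (meson not_le one_le_power)
  then show ?thesis using ij by (intro exI[of _ m]) (auto simp: a_def m_def)
qed

end

section \<open>The completed maximal unramified extension\<close>

context odd_padic_universe
begin

text \<open>Periodicity in the residue field only makes \<open>x ^ (p ^ m) - x\<close> smaller than
  1. Equality of the value groups upgrades this to divisibility by \<open>p\<close>, because a value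
  below 1 attained on \<open>Qp nv\<close> is at most \<open>1 / real p\<close>.\<close>

lemma frobenius_periodic_unramified:
  assumes E: "finite_unramified_ext nv E"
  shows "frobenius_periodic p nv (integers_of nv E)"
proof (intro frobenius_periodic.intro frobenius_periodic_axioms.intro padic_universe_axioms)
  have fin: "finite_field_ext (Qp nv) E" and nvE: "nv ` E = nv ` Qp nv"
    using E by (auto simp: finite_unramified_ext_def)
  have sf: "subfield E ambient" using fin by (simp add: finite_field_ext_def)
  interpret field "ambient :: 'a ring" by (rule field_from_type_algebra)
  have sr: "subring E ambient" using subfieldE(1)[OF sf] .
  note EC = subring_ambient_closed[OF sr]
  show "subring (integers_of nv E) ambient"
    by (rule subring_ambientI) (auto simp: integers_of_def intro: EC nv_diff_le nv_mult_le)
  show "nv x \<le> 1" if "x \<in> integers_of nv E" for x using that by (simp add: integers_of_def)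
  fix x assume "x \<in> integers_of nv E"
  then have x: "x \<in> E" "nv x \<le> 1" by (auto simp: integers_of_def)
  obtain m where m: "m \<ge> 1" "nv (x ^ (p ^ m) - x) < 1"
    using finite_ext_residue_periodic[OF fin x] by blast
  define y where "y = x ^ (p ^ m) - x"
  have y: "y \<in> E" "nv y < 1" unfolding y_def using m x EC(6,7) by blast+
  then obtain a where a: "a \<in> Qp nv" "nv a = nv y" using nvE by (metis imageE image_eqI)
  then have "a \<in> Zp.A" using y by (intro Zp.A_frac_integral) (auto simp: Qp_eq)
  then have "nv y \<le> 1 / real p" using Zp.A_nv_less_1_le[of a] a y by simp
  then have "nv (y / of_nat p) \<le> 1" by (simp add: nv_divide nv_p field_simps)
  moreover have "y / of_nat p \<in> E"
    using EC(4)[OF y(1) subfield_ambient_inverse[OF sf EC(8)]] by (simp add: field_class.field_divide_inverse)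
  ultimately have "y / of_nat p \<in> integers_of nv E" by (simp add: integers_of_def)
  moreover have "x ^ (p ^ m) - x = of_nat p * (y / of_nat p)" by (simp add: y_def)
  ultimately show "\<exists>m\<ge>1. \<exists>y\<in>integers_of nv E. x ^ (p ^ m) - x = of_nat p * y" using m by blast
qed

text \<open>Ensures that Teichmueller representatives, which are limits, stay in the same finite
  extension.\<close>

lemma integers_of_closed:
  assumes "finite_field_ext (Qp nv) E"
  shows "nv_closure nv (integers_of nv E) = integers_of nv E"
proof
  have "nv_closure nv (integers_of nv E) \<subseteq> nv_closure nv E"
    by (rule nv_closure_mono) (auto simp: integers_of_def)
  moreover have "nv x \<le> 1" if "x \<in> nv_closure nv (integers_of nv E)" for x
    by (rule nv_closure_le[OF _ _ that]) (auto simp: integers_of_def)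
  ultimately show "nv_closure nv (integers_of nv E) \<subseteq> integers_of nv E"
    using finite_ext_closed[OF assms] by (auto simp: integers_of_def)
qed (rule nv_closure_superset)

text \<open>For \<open>m >= 1\<close>: zero and the roots of unity of order dividing
  \<open>p ^ m - 1\<close>.\<close>

definition teich :: "nat \<Rightarrow> 'a set" where
  "teich m = {z. z ^ (p ^ m) = z}"

text \<open>The index starts at 1 because \<open>teich 0\<close> is the whole ambient field.\<close>

definition teich_all :: "'a set" where
  "teich_all = (\<Union>m\<in>{1..}. teich m)"

lemma teich_closed: "1 \<in> teich m" "z \<in> teich m \<Longrightarrow> - z \<in> teich m"
    "z \<in> teich m \<Longrightarrow> w \<in> teich m \<Longrightarrow> z * w \<in> teich m"
  by (auto simp: teich_def minus_power_p power_mult_distrib)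

lemma teich_mono: "teich m \<subseteq> teich (m * k)"
proof
  fix z assume z: "z \<in> teich m"
  have "z ^ (p ^ (m * k)) = z"
  proof (induction k)
    case (Suc k)
    have "z ^ (p ^ (m * Suc k)) = (z ^ (p ^ m)) ^ (p ^ (m * k))"
      by (simp add: power_add flip: power_mult)
    then show ?case using Suc z by (simp add: teich_def)
  qed simp
  then show "z \<in> teich (m * k)" by (simp add: teich_def)
qed

lemma finite_teich:
  assumes "m \<ge> 1" shows "finite (teich m)"
proof -
  have "1 < p" using p_gt_1 by simp
  then have pm: "1 < p ^ m" using assms by (intro one_less_power) auto
  define P :: "'a poly" where "P = monom 1 (p ^ m) - monom 1 1"
  have "coeff P (p ^ m) = 1" using pm by (simp add: P_def)
  then have "P \<noteq> 0" by auto
  moreover have "teich m = {z. poly P z = 0}"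
    by (auto simp: teich_def P_def poly_monom)
  ultimately show ?thesis using poly_roots_finite by metis
qed

lemma frobenius_periodic_teich: "m \<ge> 1 \<Longrightarrow> frobenius_periodic p nv (finite_sums (teich m))"
  by (rule frobenius_periodic_finite_sums[OF teich_closed]) (auto simp: teich_def)

lemma finite_sums_teich_all:
  "x \<in> finite_sums teich_all \<Longrightarrow> \<exists>m\<ge>1. x \<in> finite_sums (teich m)"
proof (induction rule: finite_sums.induct)
  case (add x z)
  then obtain m k where mk: "m \<ge> 1" "x \<in> finite_sums (teich m)" "k \<ge> 1" "z \<in> teich k"
    by (auto simp: teich_all_def)
  have "x \<in> finite_sums (teich (m * k))" using mk finite_sums_mono[OF teich_mono] by blast
  moreover have "z \<in> teich (m * k)" using mk teich_mono[of k m] by (auto simp: mult.commute)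
  ultimately have "x + z \<in> finite_sums (teich (m * k))" by (rule finite_sums.add)
  moreover have "m * k \<ge> 1" using mk by simp
  ultimately show ?case by blast
qed (auto intro: finite_sums.zero)

text \<open>Every finite sum of such roots lives at one level \<open>m\<close>, since two levels
  embed into their product; at this level all generators share a Frobenius period.\<close>

sublocale Ur: frobenius_periodic p nv "finite_sums teich_all"
proof (intro frobenius_periodic.intro frobenius_periodic_axioms.intro padic_universe_axioms)
  have mult: "z * w \<in> teich_all" if zw: "z \<in> teich_all" "w \<in> teich_all" for z w
  proof -
    obtain m k where mk: "m \<ge> 1" "z \<in> teich m" "k \<ge> 1" "w \<in> teich k"
      using zw by (auto simp: teich_all_def)
    then have "z \<in> teich (m * k)" "w \<in> teich (m * k)" "m * k \<ge> 1"
      using teich_mono[of k m] teich_mono[of m k] by (auto simp: mult.commute)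
    then show ?thesis using teich_closed(3) unfolding teich_all_def by (metis UN_iff atLeast_iff)
  qed
  show "subring (finite_sums teich_all) ambient"
    by (rule subring_finite_sums) (use teich_closed mult in \<open>auto simp: teich_all_def\<close>)
  fix x assume "x \<in> finite_sums teich_all"
  then obtain m where m: "m \<ge> 1" "x \<in> finite_sums (teich m)" using finite_sums_teich_all by blast
  interpret T: frobenius_periodic p nv "finite_sums (teich m)" by (rule frobenius_periodic_teich[OF m(1)])
  show "nv x \<le> 1" by (rule T.nv_B[OF m(2)])
  have "finite_sums (teich m) \<subseteq> finite_sums teich_all"
    by (rule finite_sums_mono) (use m in \<open>auto simp: teich_all_def\<close>)
  then show "\<exists>m\<ge>1. \<exists>y\<in>finite_sums teich_all. x ^ p ^ m - x = of_nat p * y"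
    using T.frob_B[OF m(2)] by blast
qed

text \<open>The Teichmueller expansion: \<open>x = z + p * y\<close> with a root of unity or zero
  \<open>z\<close> and an integer \<open>y\<close> of the same field. Repeating this with
  \<open>y\<close> yields one more \<open>p\<close>-adic digit each time.\<close>

lemma unramified_integers_subset:
  assumes E: "finite_unramified_ext nv E"
  shows "integers_of nv E \<subseteq> Ur.A"
proof
  fix x assume x: "x \<in> integers_of nv E"
  have fin: "finite_field_ext (Qp nv) E" using E by (simp add: finite_unramified_ext_def)
  interpret O: frobenius_periodic p nv "integers_of nv E" by (rule frobenius_periodic_unramified[OF E])
  have OA: "O.A = integers_of nv E" by (rule integers_of_closed[OF fin])
  have "\<forall>x\<in>integers_of nv E. \<exists>z\<in>finite_sums teich_all. nv (x - z) \<le> 1 * (1 / real p) ^ k" for k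
  proof (induction k)
    case 0
    then show ?case using finite_sums.zero[of teich_all] by (auto simp: integers_of_def intro!: bexI[of _ 0])
  next
    case (Suc k)
    show ?case
    proof
      fix x assume x: "x \<in> integers_of nv E"
      obtain m z where m: "m \<ge> 1" "z \<in> integers_of nv E" "z ^ (p ^ m) = z" "nv (x - z) < 1"
        using O.teichmueller[of x] x unfolding OA by blast
      have "x - z \<in> integers_of nv E" using x m(2) O.B_closed(6) by blast
      then obtain y where y: "y \<in> integers_of nv E" "x - z = of_nat p * y"
        using O.A_pE[of "x - z"] m(4) unfolding OA by blast
      obtain y' where y': "y' \<in> finite_sums teich_all" "nv (y - y') \<le> 1 * (1 / real p) ^ k"
        using Suc y by blast
      have "z \<in> teich_all" using m(1,3) by (auto simp: teich_all_def teich_def)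
      then have "z + of_nat p * y' \<in> finite_sums teich_all"
        using y' Ur.B_closed(3,4,8) finite_sums_superset by blast
      moreover have "x - (z + of_nat p * y') = of_nat p * (y - y')"
        using y by (simp add: algebra_simps)
      then have "nv (x - (z + of_nat p * y')) \<le> 1 * (1 / real p) ^ Suc k"
        using y'(2) p_gt_1 by (simp add: nv_mult nv_p divide_right_mono)
      ultimately show "\<exists>z\<in>finite_sums teich_all. nv (x - z) \<le> 1 * (1 / real p) ^ Suc k" by blast
    qed
  qed
  then show "x \<in> Ur.A" using x by (intro nv_closureI_powers[of _ _ 1]) blast
qed

text \<open>The finitely many elements of \<open>teich m\<close> span a finite dimensional space
  over \<open>Qp nv\<close>. It is closed, so it contains the closure \<open>T.A\<close> and, after
  inverting \<open>p\<close>, the whole field; the value group is the one computed in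
  \<open>nv_A_frac\<close>.\<close>

lemma teich_unramified:
  assumes m: "m \<ge> 1"
  shows "finite_unramified_ext nv (frobenius_periodic.A_frac p nv (finite_sums (teich m)))"
proof -
  interpret T: frobenius_periodic p nv "finite_sums (teich m)" by (rule frobenius_periodic_teich[OF m])
  interpret field "ambient :: 'a ring" by (rule field_from_type_algebra)
  have "\<int> \<subseteq> finite_sums (teich m)"
    unfolding finite_sums_Ints[symmetric]
    by (rule finite_sums_mono) (use teich_closed(1,2) in auto)
  then have "Zp.A \<subseteq> T.A" by (rule nv_closure_mono)
  then have Qp: "Qp nv \<subseteq> T.A_frac" by (auto simp: Qp_eq Zp.A_frac_def T.A_frac_def)
  obtain Us where Us: "set Us = teich m" using finite_teich[OF m] finite_list by blast
  define V where "V = Span (Qp nv) Us"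
  have Usc: "set Us \<subseteq> carrier ambient" by simp
  have Vfin: "finite_dimension (Qp nv) V"
    unfolding V_def by (rule Span_finite_dimension[OF subfield_Qp Usc])
  then obtain n where "dimension n (Qp nv) V" unfolding finite_dimension_def by blast
  from dimension_closed_totally_bounded[OF this]
  have V: "nv_closure nv V = V" "0 \<in> V" "\<And>x y. x \<in> V \<Longrightarrow> y \<in> V \<Longrightarrow> x - y \<in> V"
    "\<And>a x. a \<in> Qp nv \<Longrightarrow> x \<in> V \<Longrightarrow> a * x \<in> V" by auto
  have tV: "teich m \<subseteq> V"
    using Span_base_incl[OF subfield_Qp Usc] unfolding V_def Us .
  have "finite_sums (teich m) \<subseteq> V"
  proof
    fix x assume "x \<in> finite_sums (teich m)"
    then show "x \<in> V"
    proof (induction rule: finite_sums.induct)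
      case (add x z)
      have "x - (- z) \<in> V" using add tV teich_closed(2) by (intro V(3)) auto
      then show ?case by simp
    qed (rule V(2))
  qed
  then have "T.A \<subseteq> V" using nv_closure_mono V(1) by blast
  have "T.A_frac \<subseteq> V"
  proof
    fix x assume "x \<in> T.A_frac"
    then obtain k where k: "of_nat p ^ k * x \<in> T.A" by (auto simp: T.A_frac_def)
    have "inverse (of_nat p ^ k) \<in> Qp nv"
      by (intro subfield_ambient_inverse[OF subfield_Qp] subring_ambient_closed[OF subring_Qp])
    then have "inverse (of_nat p ^ k) * (of_nat p ^ k * x) \<in> V" using V(4) k \<open>T.A \<subseteq> V\<close> by blast
    then show "x \<in> V" by (simp flip: mult.assoc)
  qed
  moreover have "subalgebra (Qp nv) T.A_frac ambient"
  proof (intro subalgebra.intro subalgebra_axioms.intro)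
    show "subgroup T.A_frac (add_monoid ambient)" using T.subring_A_frac by (rule subring.axioms(1))
    fix a x assume "a \<in> Qp nv" "x \<in> T.A_frac"
    then show "a \<otimes>\<^bsub>ambient\<^esub> x \<in> T.A_frac"
      using Qp subring_ambient_mult[OF T.subring_A_frac] by auto
  qed
  ultimately have "finite_dimension (Qp nv) T.A_frac"
    using subalbegra_incl_imp_finite_dimension[OF subfield_Qp Vfin] by blast
  then show ?thesis
    unfolding finite_unramified_ext_def finite_field_ext_def
    using subfield_Qp T.subfield_A_frac Qp Zp.nv_A_frac T.nv_A_frac by (simp add: Qp_eq)
qed

text \<open>Each side contains a set whose closure is the other side. All structure of
  \<open>Rur nv\<close> is inherited from \<open>Ur.A\<close>, so the union \<open>Qp_ur\<close>
  never has to be shown to be a field.\<close>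

theorem Rur_eq: "Rur nv = Ur.A"
proof
  have "integers_of nv (Qp_ur nv) \<subseteq> Ur.A"
  proof
    fix x assume "x \<in> integers_of nv (Qp_ur nv)"
    then obtain E where "finite_unramified_ext nv E" "x \<in> integers_of nv E"
      by (auto simp: integers_of_def Qp_ur_def)
    then show "x \<in> Ur.A" using unramified_integers_subset by blast
  qed
  then have "nv_closure nv (integers_of nv (Qp_ur nv)) \<subseteq> nv_closure nv Ur.A" by (rule nv_closure_mono)
  then show "Rur nv \<subseteq> Ur.A" by (simp add: Rur_def)
  have "finite_sums teich_all \<subseteq> integers_of nv (Qp_ur nv)"
  proof
    fix x assume x: "x \<in> finite_sums teich_all"
    then obtain m where m: "m \<ge> 1" "x \<in> finite_sums (teich m)" using finite_sums_teich_all by blast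
    interpret T: frobenius_periodic p nv "finite_sums (teich m)" by (rule frobenius_periodic_teich[OF m(1)])
    have "x \<in> T.A_frac" using m T.B_subset_A T.A_subset_A_frac by blast
    then show "x \<in> integers_of nv (Qp_ur nv)"
      using teich_unramified[OF m(1)] Ur.nv_B[OF x] by (auto simp: integers_of_def Qp_ur_def)
  qed
  then show "Ur.A \<subseteq> Rur nv" unfolding Rur_def by (rule nv_closure_mono)
qed

end

section \<open>Frobenius lifts\<close>

context
  fixes R S :: "'a::comm_ring_1 set" and f :: "'a \<Rightarrow> 'a"
  assumes R: "subring R ambient" and f: "f \<in> ring_hom (subring_of R) (subring_of S)"
begin

lemma subring_hom_closed: "x \<in> R \<Longrightarrow> f x \<in> S"
  using ring_hom_closed[OF f] by simp

lemma subring_hom_add: "x \<in> R \<Longrightarrow> y \<in> R \<Longrightarrow> f (x + y) = f x + f y"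
  using ring_hom_add[OF f] by simp

lemma subring_hom_mult: "x \<in> R \<Longrightarrow> y \<in> R \<Longrightarrow> f (x * y) = f x * f y"
  using ring_hom_mult[OF f] by simp

lemma subring_hom_one: "f 1 = 1"
  using ring_hom_one[OF f] by simp

lemma subring_hom_zero: "f 0 = 0"
  using subring_hom_add[of 0 0] subring_ambient_zero[OF R] by simp

lemma subring_hom_diff: "x \<in> R \<Longrightarrow> y \<in> R \<Longrightarrow> f (x - y) = f x - f y"
  using subring_hom_add[of "x - y" y] subring_ambient_diff[OF R, of x y] by simp

lemma subring_hom_power: "x \<in> R \<Longrightarrow> f (x ^ n) = f x ^ n"
  by (induction n) (simp_all add: subring_hom_one subring_hom_mult subring_ambient_power[OF R])

lemma subring_hom_of_nat: "f (of_nat n) = of_nat n"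
  by (induction n)
     (simp_all add: subring_hom_zero subring_hom_one subring_hom_add subring_ambient_of_nat[OF R]
        subring_ambient_one[OF R])

lemma subring_hom_sum: "(\<And>i. i \<in> I \<Longrightarrow> g i \<in> R) \<Longrightarrow> f (sum g I) = (\<Sum>i\<in>I. f (g i))"
  by (induction I rule: infinite_finite_induct)
     (simp_all add: subring_hom_zero subring_hom_add subring_ambient_sum[OF R])

end

context odd_padic_universe
begin

lemmas subring_Rur = Ur.subring_A[folded Rur_eq]
  and nv_Rur = Ur.nv_A[folded Rur_eq]
  and Rur_unit = Ur.A_unit[folded Rur_eq]
  and Rur_pE = Ur.A_pE[folded Rur_eq]
  and Rur_p_multiple_iff = Ur.A_p_multiple_iff[folded Rur_eq]
  and Rur_nv_less_1_le = Ur.A_nv_less_1_le[folded Rur_eq]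
  and Rur_valuation = Ur.A_valuation[folded Rur_eq]
  and Rur_frob = Ur.frob_A[folded Rur_eq]

lemma Rur_closed: "nv_closure nv (Rur nv) = Rur nv"
  by (simp add: Rur_eq)

lemmas Rur_ops = subring_ambient_closed[OF subring_Rur]

lemma Rur_PIdl_iff: "x \<in> PIdl\<^bsub>subring_of (Rur nv)\<^esub> (of_nat p) \<longleftrightarrow> x \<in> Rur nv \<and> nv x < 1"
  by (simp add: PIdl_subring_of Rur_p_multiple_iff)

lemma Rur_limit:
  assumes "\<And>k. u k \<in> Rur nv" "\<And>k. nv (u (Suc k) - u k) \<le> C * (1 / real p) ^ k"
  shows "\<exists>l\<in>Rur nv. \<forall>k. nv (l - u k) \<le> C * (1 / real p) ^ k"
proof -
  obtain l where l: "\<And>k. nv (l - u k) \<le> C * (1 / real p) ^ k" using nv_limit[OF assms(2)] by blast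
  have "l \<in> nv_closure nv (Rur nv)"
    by (rule nv_closureI_powers[of _ _ C]) (use l assms in blast)
  then show ?thesis using l Rur_closed by auto
qed

text \<open>
  Since \<open>x\<close> is a \<open>p\<close>-th power modulo \<open>p\<close>, two homomorphisms that agree modulo an ideal agree
  modulo a smaller one.
\<close>

lemma ring_hom_Rur_unique:
  assumes f: "f \<in> ring_hom (subring_of (Rur nv)) (subring_of S)"
    and g: "g \<in> ring_hom (subring_of (Rur nv)) (subring_of S)"
    and S: "\<And>y. y \<in> S \<Longrightarrow> nv y \<le> 1"
    and r: "r < 1" "\<And>x. x \<in> Rur nv \<Longrightarrow> nv (f x - g x) \<le> r"
    and x: "x \<in> Rur nv"
  shows "f x = g x"
proof -
  note fh = subring_hom_closed[OF subring_Rur f] subring_hom_add[OF subring_Rur f] subring_hom_mult[OF subring_Rur f]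
    subring_hom_power[OF subring_Rur f] subring_hom_of_nat[OF subring_Rur f]
  note gh = subring_hom_closed[OF subring_Rur g] subring_hom_add[OF subring_Rur g] subring_hom_mult[OF subring_Rur g]
    subring_hom_power[OF subring_Rur g] subring_hom_of_nat[OF subring_Rur g]
  \<comment> \<open>One rate for both gains of the induction step: the \<open>p ^ m\<close>-th power
    multiplies an error by at most \<open>t\<close>, and multiplication by \<open>p\<close>
    multiplies it by \<open>1 / real p\<close>. The radius \<open>r\<close> may exceed
    \<open>1 / real p\<close> when \<open>S\<close> is ramified.\<close>
  define t where "t = max r (1 / real p)"
  have t: "0 < t" "t < 1" "r \<le> t" "1 / real p \<le> t" using r p_gt_1 by (auto simp: t_def less_max_iff_disj)
  have "\<forall>x\<in>Rur nv. nv (f x - g x) \<le> t * t ^ k" for k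
  proof (induction k)
    case 0
    then show ?case using r t by (auto intro: order_trans)
  next
    case (Suc k)
    show ?case
    proof
      fix x assume x: "x \<in> Rur nv"
      obtain m where m: "m \<ge> 1" "nv (x ^ (p ^ m) - x) < 1" using Rur_frob[OF x] by blast
      have "nv (x - x ^ (p ^ m)) < 1" using m by (simp add: nv_minus_commute)
      moreover have xm: "x ^ (p ^ m) \<in> Rur nv" using x by (rule Rur_ops)
      then have "x - x ^ (p ^ m) \<in> Rur nv" using x by (intro Rur_ops)
      ultimately obtain y where y: "y \<in> Rur nv" "x - x ^ (p ^ m) = of_nat p * y"
        using Rur_pE by blast
      have xy: "x = x ^ (p ^ m) + of_nat p * y" using y(2) by (simp add: algebra_simps)
      have py: "of_nat p * y \<in> Rur nv" using y by (intro Rur_ops)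
      have "f x = f x ^ (p ^ m) + of_nat p * f y"
        by (subst xy) (simp add: fh x xm py y Rur_ops)
      moreover have "g x = g x ^ (p ^ m) + of_nat p * g y"
        by (subst xy) (simp add: gh x xm py y Rur_ops)
      ultimately have "f x - g x = (f x ^ (p ^ m) - g x ^ (p ^ m)) + of_nat p * (f y - g y)"
        by (simp add: algebra_simps)
      then have fg: "nv (f x - g x) = nv ((f x ^ (p ^ m) - g x ^ (p ^ m)) + of_nat p * (f y - g y))" by simp
      have tk: "t * t ^ k \<le> t" using t by (simp add: mult_left_le power_le_one)
      have "nv (f x ^ (p ^ m) - g x ^ (p ^ m)) \<le> (t * t ^ k) * max (t * t ^ k) (1 / real p)"
        using Suc x order_trans[OF tk less_imp_le[OF t(2)]] m(1)
        by (intro nv_prime_power_diff_le S fh gh) auto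
      also have "\<dots> \<le> (t * t ^ k) * t"
        by (rule mult_left_mono) (use t tk in auto)
      finally have "nv (f x ^ (p ^ m) - g x ^ (p ^ m)) \<le> t * t ^ Suc k"
        by (simp add: mult_ac)
      moreover have "nv (of_nat p * (f y - g y)) \<le> t * t ^ Suc k"
      proof -
        have "nv (of_nat p * (f y - g y)) = (1 / real p) * nv (f y - g y)"
          by (simp add: nv_mult nv_p)
        also have "\<dots> \<le> t * (t * t ^ k)"
          using Suc y t by (intro mult_mono nv_nonneg) auto
        finally show ?thesis by simp
      qed
      ultimately show "nv (f x - g x) \<le> t * t ^ Suc k" unfolding fg by (rule nv_add_le)
    qed
  qed
  then have le: "nv (f x - g x) \<le> t * t ^ k" for k using x by blast
  have "(\<lambda>k. t * t ^ k) \<longlonglongrightarrow> t * 0"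
    by (intro tendsto_mult tendsto_const LIMSEQ_power_zero) (use t in auto)
  then have "nv (f x - g x) \<le> 0"
    using LIMSEQ_le_const[of "\<lambda>k. t * t ^ k" 0 "nv (f x - g x)"] le by auto
  then show ?thesis using nv_pos[of "f x - g x"] by force
qed

lemma frobenius_lift_funpow:
  assumes "frobenius_lift p (Rur nv) \<phi>"
  shows "\<phi> ^^ s \<in> ring_hom (subring_of (Rur nv)) (subring_of (Rur nv))"
    and "a \<in> Rur nv \<Longrightarrow> nv ((\<phi> ^^ s) a - a ^ (p ^ s)) < 1"
proof -
  have \<phi>: "\<phi> \<in> ring_hom (subring_of (Rur nv)) (subring_of (Rur nv))"
    and lift: "nv (\<phi> a - a ^ p) < 1" if "a \<in> Rur nv" for a
    using assms that by (auto simp: frobenius_lift_def Rur_PIdl_iff)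
  have *: "\<phi> ^^ s \<in> ring_hom (subring_of (Rur nv)) (subring_of (Rur nv)) \<and>
    (\<forall>a\<in>Rur nv. nv ((\<phi> ^^ s) a - a ^ (p ^ s)) < 1)"
  proof (induction s)
    case 0
    then show ?case by (auto intro!: ring_hom_memI simp: Rur_ops)
  next
    case (Suc s)
    then have hom: "\<phi> ^^ s \<in> ring_hom (subring_of (Rur nv)) (subring_of (Rur nv))"
      and IH: "\<And>a. a \<in> Rur nv \<Longrightarrow> nv ((\<phi> ^^ s) a - a ^ (p ^ s)) < 1" by auto
    have "\<phi> ^^ Suc s \<in> ring_hom (subring_of (Rur nv)) (subring_of (Rur nv))"
      using ring_hom_trans[OF hom \<phi>[of 0]] Rur_ops(2) by (simp add: o_def)
    moreover have "nv ((\<phi> ^^ Suc s) a - a ^ (p ^ Suc s)) < 1" if a: "a \<in> Rur nv" for a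
    proof -
      have c: "(\<phi> ^^ s) a \<in> Rur nv" by (rule subring_hom_closed[OF subring_Rur hom a])
      have "nv (((\<phi> ^^ s) a) ^ p - (a ^ (p ^ s)) ^ p) \<le> nv ((\<phi> ^^ s) a - a ^ (p ^ s))"
        by (intro nv_power_diff_le nv_Rur c Rur_ops a)
      also have "\<dots> < 1" by (rule IH[OF a])
      finally have "nv (((\<phi> ^^ s) a) ^ p - (a ^ (p ^ s)) ^ p) < 1" .
      with lift[OF c] have "nv (\<phi> ((\<phi> ^^ s) a) - (a ^ (p ^ s)) ^ p) < 1" by (rule nv_diff_trans_less)
      then show ?thesis by (simp add: mult.commute flip: power_mult)
    qed
    ultimately show ?case by blast
  qed
  show "\<phi> ^^ s \<in> ring_hom (subring_of (Rur nv)) (subring_of (Rur nv))" using * by blast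
  show "a \<in> Rur nv \<Longrightarrow> nv ((\<phi> ^^ s) a - a ^ (p ^ s)) < 1" using * by blast
qed

end

text \<open>Collects what is used about the power \<open>\<phi> ^^ s\<close>. The condition
  \<open>s >= 1\<close> makes the map \<open>a \<mapsto> a ^ (p ^ s)\<close> contracting inside
  residue classes.\<close>

locale frobenius_power = odd_padic_universe +
  fixes s :: nat and \<Phi> :: "'a \<Rightarrow> 'a"
  assumes s: "s \<ge> 1"
    and Phi_hom: "\<Phi> \<in> ring_hom (subring_of (Rur nv)) (subring_of (Rur nv))"
    and Phi_lift: "a \<in> Rur nv \<Longrightarrow> nv (\<Phi> a - a ^ (p ^ s)) < 1"
begin

lemmas Phi_closed = subring_hom_closed[OF subring_Rur Phi_hom]
  and Phi_add = subring_hom_add[OF subring_Rur Phi_hom]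
  and Phi_mult = subring_hom_mult[OF subring_Rur Phi_hom]
  and Phi_zero = subring_hom_zero[OF subring_Rur Phi_hom]
  and Phi_diff = subring_hom_diff[OF subring_Rur Phi_hom]
  and Phi_power = subring_hom_power[OF subring_Rur Phi_hom]
  and Phi_of_nat = subring_hom_of_nat[OF subring_Rur Phi_hom]
  and Phi_sum = subring_hom_sum[OF subring_Rur Phi_hom]

text \<open>A power of \<open>p\<close> is fixed, and a unit \<open>y\<close> is sent close to the
  unit \<open>y ^ (p ^ s)\<close>. So \<Phi> is an isometry, which yields injectivity and transports
  the contraction through its inverse.\<close>

lemma nv_Phi:
  assumes a: "a \<in> Rur nv"
  shows "nv (\<Phi> a) = nv a"
proof (cases "a = 0")
  case False
  then obtain k y where y: "y \<in> Rur nv" "nv y = 1" "a = of_nat p ^ k * y"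
    using Rur_valuation[OF a] by blast
  have "nv (\<Phi> y - y ^ (p ^ s)) < nv (y ^ (p ^ s))"
    using Phi_lift[OF y(1)] y(2) by (simp add: nv_power)
  then have "nv (\<Phi> y) = nv (y ^ (p ^ s))" by (rule nv_eq_of_close)
  moreover have "\<Phi> a = of_nat p ^ k * \<Phi> y"
    using y by (simp add: Phi_mult Phi_power Phi_of_nat Rur_ops)
  ultimately show ?thesis using y by (simp add: nv_mult nv_power)
qed (simp add: Phi_zero)

lemma nv_Phi_diff: "a \<in> Rur nv \<Longrightarrow> b \<in> Rur nv \<Longrightarrow> nv (\<Phi> a - \<Phi> b) = nv (a - b)"
  using nv_Phi[of "a - b"] Phi_diff[of a b] Rur_ops(6)[of a b] by simp

lemma inj_on_Phi: "inj_on \<Phi> (Rur nv)"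
proof (rule inj_onI)
  fix a b assume "a \<in> Rur nv" "b \<in> Rur nv" "\<Phi> a = \<Phi> b"
  then have "nv (a - b) = 0" using nv_Phi_diff[of a b] by simp
  then show "a = b" by (simp add: nv_eq_0_iff)
qed

text \<open>Perfectness made explicit: \<open>a\<close> is congruent to
  \<open>a ^ (p ^ (m * s))\<close>, whose \<open>p ^ s\<close>-th root is
  \<open>a ^ (p ^ ((m - 1) * s))\<close>.\<close>

lemma Phi_surj_mod_p:
  assumes a: "a \<in> Rur nv"
  shows "\<exists>b\<in>Rur nv. nv (a - \<Phi> b) < 1"
proof -
  obtain m where m: "m \<ge> 1" "nv (a ^ (p ^ m) - a) < 1" using Rur_frob[OF a] by blast
  have *: "nv (a ^ (p ^ (m * k)) - a) < 1" for k
  proof (induction k)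
    case (Suc k)
    have "nv ((a ^ (p ^ m)) ^ (p ^ (m * k)) - a ^ (p ^ (m * k))) \<le> nv (a ^ (p ^ m) - a)"
      by (intro nv_power_diff_le nv_Rur a Rur_ops)
    then have "nv ((a ^ (p ^ m)) ^ (p ^ (m * k)) - a ^ (p ^ (m * k))) < 1" using m by simp
    then have "nv ((a ^ (p ^ m)) ^ (p ^ (m * k)) - a) < 1" using Suc by (rule nv_diff_trans_less)
    then show ?case by (simp add: power_add flip: power_mult)
  qed simp
  define b where "b = a ^ (p ^ ((m - 1) * s))"
  have b: "b \<in> Rur nv" unfolding b_def by (intro Rur_ops a)
  have "(m - 1) * s + s = m * s" using m(1) by (cases m) auto
  then have "b ^ (p ^ s) = a ^ (p ^ (m * s))"
    by (simp add: b_def flip: power_mult power_add)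
  then have "nv (a - b ^ (p ^ s)) < 1" using *[of s] by (simp add: nv_minus_commute)
  moreover have "nv (b ^ (p ^ s) - \<Phi> b) < 1" using Phi_lift[OF b] by (simp add: nv_minus_commute)
  ultimately show ?thesis using b nv_diff_trans_less by blast
qed

text \<open>Write \<open>a = \<Phi> b + p * c\<close> and repeat with the remainder
  \<open>c\<close>. Since \<Phi> fixes \<open>p\<close>, the partial sums \<open>u k\<close> of the
  digits times powers of \<open>p\<close> satisfy \<open>\<Phi> (u k) = a\<close> modulo
  \<open>p ^ k\<close>.\<close>

lemma Phi_surj:
  assumes a: "a \<in> Rur nv"
  shows "\<exists>b\<in>Rur nv. \<Phi> b = a"
proof -
  have "\<exists>b c. b \<in> Rur nv \<and> c \<in> Rur nv \<and> a = \<Phi> b + of_nat p * c" if "a \<in> Rur nv" for a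
  proof -
    obtain b where b: "b \<in> Rur nv" "nv (a - \<Phi> b) < 1" using Phi_surj_mod_p[OF \<open>a \<in> Rur nv\<close>] by blast
    have "a - \<Phi> b \<in> Rur nv" by (intro Rur_ops \<open>a \<in> Rur nv\<close> Phi_closed b)
    then obtain c where "c \<in> Rur nv" "a - \<Phi> b = of_nat p * c" using Rur_pE b by blast
    then show ?thesis using b by (metis add_diff_cancel_left' add_diff_eq diff_add_cancel)
  qed
  then obtain \<beta> \<rho> where \<beta>: "\<And>a. a \<in> Rur nv \<Longrightarrow> \<beta> a \<in> Rur nv" "\<And>a. a \<in> Rur nv \<Longrightarrow> \<rho> a \<in> Rur nv"
      "\<And>a. a \<in> Rur nv \<Longrightarrow> a = \<Phi> (\<beta> a) + of_nat p * \<rho> a"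
    by metis
  define e where "e k = (\<rho> ^^ k) a" for k
  have e: "e k \<in> Rur nv" for k by (induction k) (auto simp: e_def a \<beta>)
  define u where "u k = (\<Sum>i<k. of_nat p ^ i * \<beta> (e i))" for k
  have uR: "u k \<in> Rur nv" for k unfolding u_def by (intro Rur_ops \<beta> e)
  have ua: "a = \<Phi> (u k) + of_nat p ^ k * e k" for k
  proof (induction k)
    case 0
    then show ?case by (simp add: u_def e_def Phi_zero)
  next
    case (Suc k)
    have "\<Phi> (u (Suc k)) = \<Phi> (u k) + of_nat p ^ k * \<Phi> (\<beta> (e k))"
    proof -
      have "u (Suc k) = u k + of_nat p ^ k * \<beta> (e k)" by (simp add: u_def)
      then show ?thesis
        by (simp add: Phi_add Phi_mult Phi_power Phi_of_nat uR Rur_ops \<beta> e)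
    qed
    moreover have "e k = \<Phi> (\<beta> (e k)) + of_nat p * e (Suc k)" using \<beta>(3)[OF e, of k] by (simp add: e_def)
    then have "of_nat p ^ k * e k = of_nat p ^ k * \<Phi> (\<beta> (e k)) + of_nat p ^ Suc k * e (Suc k)"
      by (metis distrib_left mult.assoc power_Suc2)
    ultimately show ?case using Suc by (simp add: add.assoc)
  qed
  have pk: "nv (of_nat p ^ k * y) \<le> 1 * (1 / real p) ^ k" if "y \<in> Rur nv" for y k
    using nv_mult_le[of "of_nat p ^ k" "(1 / real p) ^ k" y] nv_Rur[OF that] by (simp add: nv_power nv_p)
  have "nv (u (Suc k) - u k) \<le> 1 * (1 / real p) ^ k" for k
    using pk[OF \<beta>(1)[OF e], of k k] by (simp add: u_def)
  then obtain b where b: "b \<in> Rur nv" "\<And>k. nv (b - u k) \<le> 1 * (1 / real p) ^ k"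
    using Rur_limit[of u 1, OF uR] by blast
  have "\<Phi> b = a"
  proof (rule eq_if_nv_le_powers)
    fix k
    have "nv (\<Phi> b - \<Phi> (u k)) \<le> 1 * (1 / real p) ^ k" using b uR by (simp add: nv_Phi_diff)
    moreover have "nv (\<Phi> (u k) - a) \<le> 1 * (1 / real p) ^ k"
    proof -
      have "\<Phi> (u k) - a = - (of_nat p ^ k * e k)" by (subst ua[of k]) simp
      then show ?thesis using pk[OF e, of k k] by simp
    qed
    ultimately show "nv (\<Phi> b - a) \<le> 1 * (1 / real p) ^ k" by (rule nv_diff_trans_le)
  qed
  then show ?thesis using b by blast
qed

text \<open>Solutions are the fixed points of \<open>H\<close>, which applies a right inverse \<Psi>
  of \<Phi> to \<open>G\<close>. As \<Phi> is an isometry, estimates for \<open>G\<close> are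
  estimates for \<open>H\<close>.\<close>

lemma unique_fixed_point:
  fixes M :: "'n::finite \<Rightarrow> 'n \<Rightarrow> 'a" and w0 :: "'a ^ 'n"
  assumes M: "\<And>k j. M k j \<in> Rur nv" and w0: "w0 \<in> vecs (Rur nv)"
  shows "\<exists>!w. w \<in> vecs (Rur nv) \<and>
           (\<forall>k. \<Phi> (w $ k) = (w $ k) ^ (p ^ s) - of_nat p * (\<Sum>j\<in>UNIV. M k j * \<Phi> (w $ j))) \<and>
           (\<forall>i. nv (w $ i - w0 $ i) < 1)"
proof -
  obtain \<Psi> where \<Psi>: "\<And>a. a \<in> Rur nv \<Longrightarrow> \<Psi> a \<in> Rur nv" "\<And>a. a \<in> Rur nv \<Longrightarrow> \<Phi> (\<Psi> a) = a"
    using Phi_surj by metis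
  define G where "G w k = (w $ k) ^ (p ^ s) - of_nat p * (\<Sum>j\<in>UNIV. M k j * \<Phi> (w $ j))" for w :: "'a ^ 'n" and k
  have G: "G w k \<in> Rur nv" if "w \<in> vecs (Rur nv)" for w :: "'a ^ 'n" and k
    unfolding G_def using that by (intro Rur_ops M Phi_closed) (auto simp: vecs_def)
  define H where "H w = (\<chi> k. \<Psi> (G w k))" for w
  have H: "H w \<in> vecs (Rur nv)" if "w \<in> vecs (Rur nv)" for w :: "'a ^ 'n"
    using G[OF that] \<Psi> by (simp add: H_def vecs_def)
  have PhiH: "\<Phi> (H w $ k) = G w k" if "w \<in> vecs (Rur nv)" for w :: "'a ^ 'n" and k
    using G[OF that] \<Psi> by (simp add: H_def)
  have fixed: "(\<forall>k. \<Phi> (w $ k) = G w k) \<longleftrightarrow> H w = w" if w: "w \<in> vecs (Rur nv)" for w :: "'a ^ 'n"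
  proof -
    have "\<Phi> (w $ k) = G w k \<longleftrightarrow> H w $ k = w $ k" for k
      using inj_onD[OF inj_on_Phi, of "H w $ k" "w $ k"] H[OF w] w PhiH[OF w, of k] by (auto simp: vecs_def)
    then show ?thesis by (simp add: vec_eq_iff)
  qed
  \<comment> \<open>The term with \<open>p\<close> shrinks every distance by
    \<open>1 / real p\<close>, but the power map does so only when the distance is already at most
    \<open>1 / real p\<close>. Existence and uniqueness are therefore statements within one residue
    class.\<close>
  have contr: "nv (H w $ k - H w' $ k) \<le> C * (1 / real p)"
    if w: "w \<in> vecs (Rur nv)" "w' \<in> vecs (Rur nv)" and C: "\<And>i. nv (w $ i - w' $ i) \<le> C" "C \<le> 1 / real p"
    for w w' :: "'a ^ 'n" and k C
  proof -
    have C0: "C \<ge> 0" using order_trans[OF nv_nonneg C(1)] .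
    have wi: "w $ i \<in> Rur nv" "w' $ i \<in> Rur nv" for i using w by (auto simp: vecs_def)
    have HG: "nv (H w $ k - H w' $ k) = nv (G w k - G w' k)"
      using nv_Phi_diff[of "H w $ k" "H w' $ k"] H[OF w(1)] H[OF w(2)] PhiH w by (simp add: vecs_def)
    have GG: "G w k - G w' k = ((w $ k) ^ (p ^ s) - (w' $ k) ^ (p ^ s)) -
        (\<Sum>j\<in>UNIV. M k j * (\<Phi> (w $ j) - \<Phi> (w' $ j))) * of_nat p"
      by (simp add: G_def right_diff_distrib sum_subtractf mult.commute)
    have "nv ((w $ k) ^ (p ^ s) - (w' $ k) ^ (p ^ s)) \<le> C * (1 / real p)"
    proof -
      have "1 / real p \<le> 1" using p_gt_1 by simp
      with C(2) have "C \<le> 1" by linarith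
      then have "nv ((w $ k) ^ (p ^ s) - (w' $ k) ^ (p ^ s)) \<le> C * max C (1 / real p)"
        by (intro nv_prime_power_diff_le nv_Rur wi C s)
      then show ?thesis using C(2) by (simp add: max_absorb2)
    qed
    moreover have "nv ((\<Sum>j\<in>UNIV. M k j * (\<Phi> (w $ j) - \<Phi> (w' $ j))) * of_nat p) \<le> C * (1 / real p)"
    proof -
      have "nv (\<Sum>j\<in>UNIV. M k j * (\<Phi> (w $ j) - \<Phi> (w' $ j))) \<le> C"
      proof (rule nv_sum_le[OF C0])
        fix j
        have "nv ((\<Phi> (w $ j) - \<Phi> (w' $ j)) * M k j) \<le> C"
          by (intro nv_mult_le nv_Rur M) (simp add: nv_Phi_diff wi C)
        then show "nv (M k j * (\<Phi> (w $ j) - \<Phi> (w' $ j))) \<le> C" by (simp add: mult.commute)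
      qed
      then show ?thesis unfolding nv_mult nv_p by (intro mult_right_mono) auto
    qed
    ultimately show ?thesis unfolding HG GG by (rule nv_diff_le)
  qed
  \<comment> \<open>Modulo \<open>p\<close> both \<open>G w\<close> and \<open>\<Phi> w\<close> are
    the \<open>p ^ s\<close>-th powers of the entries, so \<open>H\<close> preserves residue
    classes. The first iteration step is thereby small enough for \<open>contr\<close>.\<close>
  have near: "nv (H w $ k - w $ k) < 1" if w: "w \<in> vecs (Rur nv)" for w :: "'a ^ 'n" and k
  proof -
    have wi: "w $ i \<in> Rur nv" for i using w by (auto simp: vecs_def)
    have HG: "nv (H w $ k - w $ k) = nv (G w k - \<Phi> (w $ k))"
      using nv_Phi_diff[of "H w $ k" "w $ k"] H[OF w] PhiH w by (simp add: vecs_def)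
    have GG: "G w k - \<Phi> (w $ k) = - (\<Phi> (w $ k) - (w $ k) ^ (p ^ s)) - of_nat p * (\<Sum>j\<in>UNIV. M k j * \<Phi> (w $ j))"
      by (simp add: G_def)
    have "nv (of_nat p * (\<Sum>j\<in>UNIV. M k j * \<Phi> (w $ j))) < 1"
    proof -
      have "(\<Sum>j\<in>UNIV. M k j * \<Phi> (w $ j)) \<in> Rur nv" by (intro Rur_ops M Phi_closed wi)
      then show ?thesis using Rur_p_multiple_iff by blast
    qed
    moreover have "nv (- (\<Phi> (w $ k) - (w $ k) ^ (p ^ s))) < 1" unfolding nv_uminus by (rule Phi_lift[OF wi])
    ultimately show ?thesis unfolding HG GG by (intro nv_diff_less)
  qed
  define W where "W k = (H ^^ k) w0" for k
  have W: "W k \<in> vecs (Rur nv)" for k by (induction k) (auto simp: W_def w0 H)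
  have WS: "W (Suc k) = H (W k)" for k by (simp add: W_def)
  have pk: "1 / real p * (1 / real p) ^ k \<le> 1 / real p" for k
    by (rule mult_left_le) (use p_gt_1 in \<open>auto intro: power_le_one\<close>)
  have step: "nv (W (Suc k) $ i - W k $ i) \<le> 1 / real p * (1 / real p) ^ k" for k i
  proof (induction k arbitrary: i)
    case 0
    have "nv (H w0 $ i - w0 $ i) \<le> 1 / real p"
      using near[OF w0] H[OF w0] w0 by (intro Rur_nv_less_1_le Rur_ops) (auto simp: vecs_def)
    then show ?case by (simp add: W_def)
  next
    case (Suc k)
    have "nv (H (W (Suc k)) $ i - H (W k) $ i) \<le> 1 / real p * (1 / real p) ^ k * (1 / real p)"
      by (rule contr[OF W W Suc pk])
    then show ?case by (simp add: WS mult.commute)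
  qed
  have "\<exists>l\<in>Rur nv. \<forall>k. nv (l - W k $ i) \<le> 1 / real p * (1 / real p) ^ k" for i
    by (rule Rur_limit[of "\<lambda>k. W k $ i"]) (use W step in \<open>auto simp: vecs_def\<close>)
  then obtain l where l: "\<And>i. l i \<in> Rur nv" "\<And>i k. nv (l i - W k $ i) \<le> 1 / real p * (1 / real p) ^ k"
    by metis
  define w where "w = (\<chi> i. l i)"
  have w: "w \<in> vecs (Rur nv)" using l by (simp add: w_def vecs_def)
  have wl: "nv (w $ i - W k $ i) \<le> 1 / real p * (1 / real p) ^ k" for i k using l by (simp add: w_def)
  have "H w = w"
  proof (subst vec_eq_iff, rule, rule eq_if_nv_le_powers)
    fix i k
    have mono: "1 / real p * (1 / real p) ^ Suc k \<le> 1 / real p * (1 / real p) ^ k"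
      by (intro mult_left_mono power_decreasing) (use p_gt_1 in auto)
    have "nv (H w $ i - W (Suc k) $ i) \<le> 1 / real p * (1 / real p) ^ k * (1 / real p)"
      unfolding WS by (rule contr[OF w W wl pk])
    then have "nv (H w $ i - W (Suc k) $ i) \<le> 1 / real p * (1 / real p) ^ k"
      using mono by (simp add: mult.commute)
    moreover have "nv (W (Suc k) $ i - w $ i) \<le> 1 / real p * (1 / real p) ^ k"
      using order_trans[OF wl mono] by (simp add: nv_minus_commute)
    ultimately show "nv (H w $ i - w $ i) \<le> 1 / real p * (1 / real p) ^ k" by (rule nv_diff_trans_le)
  qed
  moreover have "nv (w $ i - w0 $ i) < 1" for i
    using le_less_trans[OF wl[of i 0], of 1] p_gt_1 by (simp add: W_def)
  ultimately have ex: "w \<in> vecs (Rur nv) \<and> (\<forall>k. \<Phi> (w $ k) = G w k) \<and> (\<forall>i. nv (w $ i - w0 $ i) < 1)"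
    using w fixed by blast
  have "w' = w" if w': "w' \<in> vecs (Rur nv)" "\<forall>k. \<Phi> (w' $ k) = G w' k" "\<forall>i. nv (w' $ i - w0 $ i) < 1" for w' :: "'a ^ 'n"
  proof -
    have H': "H w' = w'" "H w = w" using fixed w' ex by blast+
    have "nv (w' $ i - w $ i) \<le> 1 / real p * (1 / real p) ^ k" for i k
    proof (induction k arbitrary: i)
      case 0
      have "nv (w0 $ i - w $ i) < 1" using ex by (simp add: nv_minus_commute)
      then have "nv (w' $ i - w $ i) < 1" using w'(3) nv_diff_trans_less by blast
      then show ?case using w w'(1) by (simp add: Rur_nv_less_1_le Rur_ops vecs_def)
    next
      case (Suc k)
      have "nv (H w' $ i - H w $ i) \<le> 1 / real p * (1 / real p) ^ k * (1 / real p)"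
        by (rule contr[OF w'(1) w Suc pk])
      then show ?case by (simp add: H' mult.commute)
    qed
    then show ?thesis by (simp add: vec_eq_iff eq_if_nv_le_powers[of _ _ "1 / real p"])
  qed
  with ex show ?thesis unfolding G_def by blast
qed

end

section \<open>Evaluation at the identity matrix\<close>

text \<open>The entries of the identity matrix; \<open>None\<close> gets the inverse of its
  determinant.\<close>

definition one_point :: "('n \<times> 'n) option \<Rightarrow> 'a::field_char_0" where
  "one_point v = (case v of Some (i, j) \<Rightarrow> if i = j then 1 else 0 | None \<Rightarrow> 1)"

definition monom_at_one :: "(('n \<times> 'n) option \<Rightarrow>\<^sub>0 nat) \<Rightarrow> 'a::field_char_0" where
  "monom_at_one m = (\<Prod>v\<in>Poly_Mapping.keys m. one_point v ^ Poly_Mapping.lookup m v)"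

lemma monom_at_one_superset:
  assumes "finite V" "Poly_Mapping.keys m \<subseteq> V"
  shows "monom_at_one m = (\<Prod>v\<in>V. one_point v ^ Poly_Mapping.lookup m v)"
  unfolding monom_at_one_def
  by (rule prod.mono_neutral_left) (use assms in \<open>auto simp: in_keys_iff\<close>)

lemma monom_at_one_zero: "monom_at_one 0 = 1"
  by (simp add: monom_at_one_def)

lemma monom_at_one_single: "monom_at_one (Poly_Mapping.single v 1) = one_point v"
  by (simp add: monom_at_one_def)

lemma monom_at_one_add: "monom_at_one (m + m') = monom_at_one m * monom_at_one m'"
proof -
  define V where "V = Poly_Mapping.keys m \<union> Poly_Mapping.keys m'"
  have "finite V" "Poly_Mapping.keys m \<subseteq> V" "Poly_Mapping.keys m' \<subseteq> V" "Poly_Mapping.keys (m + m') \<subseteq> V"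
    by (auto simp: V_def dest!: subsetD[OF keys_add])
  then show ?thesis
    by (simp add: monom_at_one_superset[of V] lookup_add power_add prod.distrib)
qed

lemma gl_poly_eval_one_alt:
  "gl_poly_eval_one f = (\<Sum>m\<in>Poly_Mapping.keys f. Poly_Mapping.lookup f m * monom_at_one m)"
  by (simp add: gl_poly_eval_one_def monom_at_one_def one_point_def)

lemma gl_poly_eval_one_superset:
  assumes "finite V" "Poly_Mapping.keys f \<subseteq> V"
  shows "gl_poly_eval_one f = (\<Sum>m\<in>V. Poly_Mapping.lookup f m * monom_at_one m)"
  unfolding gl_poly_eval_one_alt
  by (rule sum.mono_neutral_left) (use assms in \<open>auto simp: in_keys_iff\<close>)

lemma eval_one_single: "gl_poly_eval_one (Poly_Mapping.single m a) = a * monom_at_one m"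
  by (simp add: gl_poly_eval_one_alt)

lemma eval_one_zero: "gl_poly_eval_one 0 = 0"
  by (simp add: gl_poly_eval_one_alt)

lemma eval_one_add: "gl_poly_eval_one (f + g) = gl_poly_eval_one f + gl_poly_eval_one g"
proof -
  define V where "V = Poly_Mapping.keys f \<union> Poly_Mapping.keys g"
  have "finite V" "Poly_Mapping.keys f \<subseteq> V" "Poly_Mapping.keys g \<subseteq> V" "Poly_Mapping.keys (f + g) \<subseteq> V"
    by (auto simp: V_def dest!: subsetD[OF keys_add])
  then show ?thesis
    by (simp add: gl_poly_eval_one_superset[of V] lookup_add algebra_simps sum.distrib)
qed

lemma eval_one_uminus: "gl_poly_eval_one (- f) = - gl_poly_eval_one f"
  using eval_one_add[of f "- f"] by (simp add: eval_one_zero eq_neg_iff_add_eq_0 add.commute)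

lemma eval_one_diff: "gl_poly_eval_one (f - g) = gl_poly_eval_one f - gl_poly_eval_one g"
  using eval_one_add[of f "- g"] by (simp add: eval_one_uminus)

lemma eval_one_sum: "gl_poly_eval_one (sum f I) = (\<Sum>i\<in>I. gl_poly_eval_one (f i))"
  by (induction I rule: infinite_finite_induct) (simp_all add: eval_one_zero eval_one_add)

lemma poly_mapping_eq_sum_single:
  "f = (\<Sum>m\<in>Poly_Mapping.keys f. Poly_Mapping.single m (Poly_Mapping.lookup f m))"
  by (rule poly_mapping_eqI)
     (auto simp: lookup_sum lookup_single when_def in_keys_iff sum.delta')

lemma eval_one_mult: "gl_poly_eval_one (f * g) = gl_poly_eval_one f * gl_poly_eval_one g"
proof -
  have "f * g = (\<Sum>m\<in>Poly_Mapping.keys f. \<Sum>m'\<in>Poly_Mapping.keys g.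
      Poly_Mapping.single (m + m') (Poly_Mapping.lookup f m * Poly_Mapping.lookup g m'))"
    by (subst (1) poly_mapping_eq_sum_single[of f], subst (1) poly_mapping_eq_sum_single[of g])
       (simp add: sum_product mult_single)
  then have "gl_poly_eval_one (f * g) = (\<Sum>m\<in>Poly_Mapping.keys f. \<Sum>m'\<in>Poly_Mapping.keys g.
      (Poly_Mapping.lookup f m * monom_at_one m) * (Poly_Mapping.lookup g m' * monom_at_one m'))"
    by (simp add: eval_one_sum eval_one_single monom_at_one_add mult_ac)
  then show ?thesis by (simp add: gl_poly_eval_one_alt sum_product)
qed

lemma eval_one_const: "gl_poly_eval_one (gl_const a) = a"
  by (simp add: gl_const_def eval_one_single monom_at_one_zero)

lemma gl_const_one: "gl_const 1 = 1"
  by (simp add: gl_const_def)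

lemma gl_const_mult: "gl_const (a * b) = gl_const a * gl_const b"
  by (simp add: gl_const_def mult_single)

lemma gl_const_power: "gl_const (a ^ n) = gl_const a ^ n"
  by (induction n) (simp_all add: gl_const_one gl_const_mult)

lemma eval_one_one: "gl_poly_eval_one 1 = 1"
  using eval_one_const[of 1] by (simp add: gl_const_one)

lemma eval_one_var: "gl_poly_eval_one (gl_var v) = one_point v"
  by (simp add: gl_var_def eval_one_single monom_at_one_single[simplified])

lemma eval_one_prod: "gl_poly_eval_one (prod f I) = (\<Prod>i\<in>I. gl_poly_eval_one (f i))"
  by (induction I rule: infinite_finite_induct) (simp_all add: eval_one_one eval_one_mult)

lemma eval_one_of_nat: "gl_poly_eval_one (of_nat n) = of_nat n"
  by (induction n) (simp_all add: eval_one_one eval_one_zero eval_one_add)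

lemma eval_one_of_int: "gl_poly_eval_one (of_int n) = of_int n"
  by (cases n rule: int_cases2) (simp_all add: eval_one_of_nat eval_one_uminus)

text \<open>Evaluation commutes with the Leibniz expansion. The value 1 makes the relation
  \<open>gl_var None * gl_det - 1\<close> vanish at the identity, so evaluation descends to
  \<open>gl_ring\<close>.\<close>

lemma eval_one_det: "gl_poly_eval_one (gl_det :: ('a::field_char_0, 'n::finite) gl_poly) = 1"
proof -
  have "gl_poly_eval_one (gl_det :: ('a, 'n) gl_poly) = det ((\<chi> i j. if i = j then 1 else 0) :: 'a ^ 'n ^ 'n)"
    by (simp add: gl_det_def det_def eval_one_sum eval_one_mult eval_one_prod eval_one_of_int
        eval_one_var one_point_def)
  also have "((\<chi> i j. if i = j then 1 else 0) :: 'a ^ 'n ^ 'n) = (mat 1 :: 'a ^ 'n ^ 'n)"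
    by (simp add: mat_def)
  finally show ?thesis by simp
qed

lemma Sum_any_closed:
  assumes "subring S ambient" "\<And>i. f i \<in> S"
  shows "Sum_any f \<in> S"
  unfolding Sum_any.expand_set by (intro subring_ambient_closed[OF assms(1)] assms)

lemma subring_gl_poly:
  assumes S: "subring S ambient"
  shows "subring {f :: ('a::field_char_0, 'n) gl_poly. \<forall>m. Poly_Mapping.lookup f m \<in> S} ambient"
proof (rule subring_ambientI)
  fix f g :: "('a, 'n) gl_poly"
  assume f: "f \<in> {f. \<forall>m. Poly_Mapping.lookup f m \<in> S}" and g: "g \<in> {f. \<forall>m. Poly_Mapping.lookup f m \<in> S}"
  then show "f - g \<in> {f. \<forall>m. Poly_Mapping.lookup f m \<in> S}"
    by (simp add: lookup_minus subring_ambient_diff[OF S])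
  have "Poly_Mapping.lookup (f * g) m \<in> S" for m
    unfolding lookup_mult
    by (intro Sum_any_closed[OF S] subring_ambient_mult[OF S])
       (use f g subring_ambient_zero[OF S] in \<open>auto simp: when_def\<close>)
  then show "f * g \<in> {f. \<forall>m. Poly_Mapping.lookup f m \<in> S}" by simp
qed (auto simp: lookup_one when_def subring_ambient_closed[OF S])

section \<open>The adic completion of a commutative ring\<close>

context
  fixes Q :: "('a, 'm) ring_scheme" and a :: 'a
  assumes Q: "cring Q" and a: "a \<in> carrier Q"
begin

interpretation Q: cring Q by (rule Q)

abbreviation (input) apow where "apow k \<equiv> PIdl\<^bsub>Q\<^esub> (a [^]\<^bsub>Q\<^esub> (k::nat))"

lemma adic_ideal: "ideal (apow k) Q"
  using a by (intro Q.cgenideal_ideal) simp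

lemma adic_ideal_Suc: "apow (Suc k) \<subseteq> apow k"
  unfolding cgenideal_def
proof safe
  fix x assume x: "x \<in> carrier Q"
  show "\<exists>y. x \<otimes>\<^bsub>Q\<^esub> a [^]\<^bsub>Q\<^esub> Suc k = y \<otimes>\<^bsub>Q\<^esub> a [^]\<^bsub>Q\<^esub> k \<and> y \<in> carrier Q"
    using x a by (intro exI[of _ "x \<otimes>\<^bsub>Q\<^esub> a"]) (simp add: Q.m_ac)
qed

lemma adic_quot_cring: "cring (adic_quot Q a k)"
  unfolding adic_quot_def using ideal.quotient_is_cring[OF adic_ideal Q] .

lemma adic_coset_mono: "apow (Suc k) +>\<^bsub>Q\<^esub> x \<subseteq> apow k +>\<^bsub>Q\<^esub> x"
  using adic_ideal_Suc[of k] by (auto simp: a_r_coset_def r_coset_def)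

lemma adic_quot_sel:
  "carrier (adic_quot Q a k) = a_rcosets\<^bsub>Q\<^esub> (apow k)"
  "V \<otimes>\<^bsub>adic_quot Q a k\<^esub> W = (\<Union>x\<in>V. \<Union>y\<in>W. apow k +>\<^bsub>Q\<^esub> (x \<otimes>\<^bsub>Q\<^esub> y))"
  "\<one>\<^bsub>adic_quot Q a k\<^esub> = apow k +>\<^bsub>Q\<^esub> \<one>\<^bsub>Q\<^esub>"
  "\<zero>\<^bsub>adic_quot Q a k\<^esub> = apow k"
  "V \<oplus>\<^bsub>adic_quot Q a k\<^esub> W = {x \<oplus>\<^bsub>Q\<^esub> y |x y. x \<in> V \<and> y \<in> W}"
  by (auto simp: adic_quot_def FactRing_def rcoset_mult_def set_add_def set_mult_def)

lemma adic_completion_sel: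
  "F \<in> carrier (adic_completion Q a) \<longleftrightarrow>
     (\<forall>k. F k \<in> carrier (adic_quot Q a k)) \<and> (\<forall>k. F (Suc k) \<subseteq> F k)"
  "F \<otimes>\<^bsub>adic_completion Q a\<^esub> G = (\<lambda>k. F k \<otimes>\<^bsub>adic_quot Q a k\<^esub> G k)"
  "\<one>\<^bsub>adic_completion Q a\<^esub> = (\<lambda>k. \<one>\<^bsub>adic_quot Q a k\<^esub>)"
  "\<zero>\<^bsub>adic_completion Q a\<^esub> = (\<lambda>k. \<zero>\<^bsub>adic_quot Q a k\<^esub>)"
  "F \<oplus>\<^bsub>adic_completion Q a\<^esub> G = (\<lambda>k. F k \<oplus>\<^bsub>adic_quot Q a k\<^esub> G k)"
  by (simp_all add: adic_completion_def)

lemma adic_of_closed: "y \<in> carrier Q \<Longrightarrow> adic_of Q a y \<in> carrier (adic_completion Q a)"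
  unfolding adic_completion_sel adic_of_def adic_quot_sel
  using adic_coset_mono by (auto simp: A_RCOSETS_def' )

lemma adic_completion_mult_closed:
  assumes "F \<in> carrier (adic_completion Q a)" "G \<in> carrier (adic_completion Q a)"
  shows "F \<otimes>\<^bsub>adic_completion Q a\<^esub> G \<in> carrier (adic_completion Q a)"
  unfolding adic_completion_sel
proof (intro conjI allI)
  fix k
  interpret C: cring "adic_quot Q a k" by (rule adic_quot_cring)
  show "F k \<otimes>\<^bsub>adic_quot Q a k\<^esub> G k \<in> carrier (adic_quot Q a k)"
    using assms unfolding adic_completion_sel by blast
  have "F (Suc k) \<subseteq> F k" "G (Suc k) \<subseteq> G k" using assms unfolding adic_completion_sel by blast+
  then show "F (Suc k) \<otimes>\<^bsub>adic_quot Q a (Suc k)\<^esub> G (Suc k) \<subseteq> F k \<otimes>\<^bsub>adic_quot Q a k\<^esub> G k"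
    unfolding adic_quot_sel by (intro UN_mono adic_coset_mono) auto
qed

lemma adic_completion_add_closed:
  assumes "F \<in> carrier (adic_completion Q a)" "G \<in> carrier (adic_completion Q a)"
  shows "F \<oplus>\<^bsub>adic_completion Q a\<^esub> G \<in> carrier (adic_completion Q a)"
  unfolding adic_completion_sel
proof (intro conjI allI)
  fix k
  interpret C: cring "adic_quot Q a k" by (rule adic_quot_cring)
  show "F k \<oplus>\<^bsub>adic_quot Q a k\<^esub> G k \<in> carrier (adic_quot Q a k)"
    using assms unfolding adic_completion_sel by blast
  have "F (Suc k) \<subseteq> F k" "G (Suc k) \<subseteq> G k" using assms unfolding adic_completion_sel by blast+
  then show "F (Suc k) \<oplus>\<^bsub>adic_quot Q a (Suc k)\<^esub> G (Suc k) \<subseteq> F k \<oplus>\<^bsub>adic_quot Q a k\<^esub> G k"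
    unfolding adic_quot_sel by blast
qed

lemma adic_completion_one_closed: "\<one>\<^bsub>adic_completion Q a\<^esub> \<in> carrier (adic_completion Q a)"
  using adic_of_closed[of "\<one>\<^bsub>Q\<^esub>"] by (simp add: adic_completion_sel(3) adic_quot_sel(3) adic_of_def)

lemma adic_completion_zero_closed: "\<zero>\<^bsub>adic_completion Q a\<^esub> \<in> carrier (adic_completion Q a)"
  unfolding adic_completion_sel
proof (intro conjI allI)
  fix k
  interpret C: cring "adic_quot Q a k" by (rule adic_quot_cring)
  show "\<zero>\<^bsub>adic_quot Q a k\<^esub> \<in> carrier (adic_quot Q a k)" by simp
  show "\<zero>\<^bsub>adic_quot Q a (Suc k)\<^esub> \<subseteq> \<zero>\<^bsub>adic_quot Q a k\<^esub>"
    unfolding adic_quot_sel by (rule adic_ideal_Suc)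
qed

lemma adic_completion_cring: "cring (adic_completion Q a)"
proof (rule cringI)
  note cl = adic_completion_mult_closed adic_completion_add_closed adic_completion_one_closed
    adic_completion_zero_closed
  have quot: "cring (adic_quot Q a k)" for k by (rule adic_quot_cring)
  have mem: "F k \<in> carrier (adic_quot Q a k)" if "F \<in> carrier (adic_completion Q a)" for F k
    using that unfolding adic_completion_sel by blast
  note sel = adic_completion_sel(2-)
  show "abelian_group (adic_completion Q a)"
  proof (rule abelian_groupI)
    fix F G H
    assume F: "F \<in> carrier (adic_completion Q a)" and G: "G \<in> carrier (adic_completion Q a)"
      and H: "H \<in> carrier (adic_completion Q a)"
    show "F \<oplus>\<^bsub>adic_completion Q a\<^esub> G \<oplus>\<^bsub>adic_completion Q a\<^esub> H =
        F \<oplus>\<^bsub>adic_completion Q a\<^esub> (G \<oplus>\<^bsub>adic_completion Q a\<^esub> H)"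
      unfolding sel by (rule ext) (intro cring.cring_simprules(7)[OF quot] mem F G H)
  next
    fix F G
    assume F: "F \<in> carrier (adic_completion Q a)" and G: "G \<in> carrier (adic_completion Q a)"
    show "F \<oplus>\<^bsub>adic_completion Q a\<^esub> G = G \<oplus>\<^bsub>adic_completion Q a\<^esub> F"
      unfolding sel by (rule ext) (intro cring.cring_simprules(10)[OF quot] mem F G)
  next
    fix F
    assume F: "F \<in> carrier (adic_completion Q a)"
    show "\<zero>\<^bsub>adic_completion Q a\<^esub> \<oplus>\<^bsub>adic_completion Q a\<^esub> F = F"
      unfolding sel by (rule ext) (intro cring.cring_simprules(8)[OF quot] mem F)
    \<comment> \<open>An additive inverse must be compatible between the levels. Multiplication by
      the image of -1 provides this, because products of compatible families are already known to be
      compatible.\<close>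
    define M where "M = adic_of Q a (\<ominus>\<^bsub>Q\<^esub> \<one>\<^bsub>Q\<^esub>)"
    have M: "M \<in> carrier (adic_completion Q a)" unfolding M_def by (intro adic_of_closed) simp
    have "M k \<otimes>\<^bsub>adic_quot Q a k\<^esub> F k \<oplus>\<^bsub>adic_quot Q a k\<^esub> F k = \<zero>\<^bsub>adic_quot Q a k\<^esub>" for k
    proof -
      interpret C: cring "adic_quot Q a k" by (rule quot)
      interpret J: ideal "apow k" Q by (rule adic_ideal)
      have hom: "(+>\<^bsub>Q\<^esub>) (apow k) \<in> ring_hom Q (adic_quot Q a k)"
        unfolding adic_quot_def by (rule J.rcos_ring_hom)
      have "M k \<oplus>\<^bsub>adic_quot Q a k\<^esub> \<one>\<^bsub>adic_quot Q a k\<^esub> = apow k +>\<^bsub>Q\<^esub> (\<ominus>\<^bsub>Q\<^esub> \<one>\<^bsub>Q\<^esub> \<oplus>\<^bsub>Q\<^esub> \<one>\<^bsub>Q\<^esub>)"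
        using ring_hom_add[OF hom, of "\<ominus>\<^bsub>Q\<^esub> \<one>\<^bsub>Q\<^esub>" "\<one>\<^bsub>Q\<^esub>"] by (simp add: M_def adic_of_def adic_quot_sel(3))
      also have "\<dots> = \<zero>\<^bsub>adic_quot Q a k\<^esub>"
        by (simp add: Q.l_neg adic_quot_sel(4) Q.a_coset_add_zero J.a_subset)
      finally have M1: "M k \<oplus>\<^bsub>adic_quot Q a k\<^esub> \<one>\<^bsub>adic_quot Q a k\<^esub> = \<zero>\<^bsub>adic_quot Q a k\<^esub>" .
      have "M k \<otimes>\<^bsub>adic_quot Q a k\<^esub> F k \<oplus>\<^bsub>adic_quot Q a k\<^esub> F k =
          (M k \<oplus>\<^bsub>adic_quot Q a k\<^esub> \<one>\<^bsub>adic_quot Q a k\<^esub>) \<otimes>\<^bsub>adic_quot Q a k\<^esub> F k"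
        using mem[OF M] mem[OF F] by (simp add: C.l_distr)
      then show ?thesis using M1 mem[OF F] by simp
    qed
    then have "M \<otimes>\<^bsub>adic_completion Q a\<^esub> F \<oplus>\<^bsub>adic_completion Q a\<^esub> F = \<zero>\<^bsub>adic_completion Q a\<^esub>"
      unfolding sel by blast
    then show "\<exists>G\<in>carrier (adic_completion Q a). G \<oplus>\<^bsub>adic_completion Q a\<^esub> F = \<zero>\<^bsub>adic_completion Q a\<^esub>"
      using cl(1)[OF M F] by blast
  qed (use cl in blast)+
  show "Group.comm_monoid (adic_completion Q a)"
  proof (rule comm_monoidI)
    fix F G H
    assume F: "F \<in> carrier (adic_completion Q a)" and G: "G \<in> carrier (adic_completion Q a)"
      and H: "H \<in> carrier (adic_completion Q a)"
    show "F \<otimes>\<^bsub>adic_completion Q a\<^esub> G \<otimes>\<^bsub>adic_completion Q a\<^esub> H =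
        F \<otimes>\<^bsub>adic_completion Q a\<^esub> (G \<otimes>\<^bsub>adic_completion Q a\<^esub> H)"
      unfolding sel by (rule ext) (intro cring.cring_simprules(11)[OF quot] mem F G H)
  next
    fix F G
    assume F: "F \<in> carrier (adic_completion Q a)" and G: "G \<in> carrier (adic_completion Q a)"
    show "F \<otimes>\<^bsub>adic_completion Q a\<^esub> G = G \<otimes>\<^bsub>adic_completion Q a\<^esub> F"
      unfolding sel by (rule ext) (intro cring.cring_simprules(14)[OF quot] mem F G)
  next
    fix F
    assume F: "F \<in> carrier (adic_completion Q a)"
    show "\<one>\<^bsub>adic_completion Q a\<^esub> \<otimes>\<^bsub>adic_completion Q a\<^esub> F = F"
      unfolding sel by (rule ext) (intro cring.cring_simprules(12)[OF quot] mem F)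
  qed (use cl in blast)+
  fix F G H
  assume F: "F \<in> carrier (adic_completion Q a)" and G: "G \<in> carrier (adic_completion Q a)"
    and H: "H \<in> carrier (adic_completion Q a)"
  show "(F \<oplus>\<^bsub>adic_completion Q a\<^esub> G) \<otimes>\<^bsub>adic_completion Q a\<^esub> H =
      F \<otimes>\<^bsub>adic_completion Q a\<^esub> H \<oplus>\<^bsub>adic_completion Q a\<^esub> G \<otimes>\<^bsub>adic_completion Q a\<^esub> H"
    unfolding sel by (rule ext) (intro cring.cring_simprules(13)[OF quot] mem F G H)
qed

lemma adic_coset_diff:
  assumes "F \<in> carrier (adic_completion Q a)" "x \<in> F k" "y \<in> F k"
  shows "\<exists>z\<in>carrier Q. x = y \<oplus>\<^bsub>Q\<^esub> z \<otimes>\<^bsub>Q\<^esub> a [^]\<^bsub>Q\<^esub> k"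
proof -
  interpret J: ideal "apow k" Q by (rule adic_ideal)
  obtain t where t: "t \<in> carrier Q" "F k = apow k +>\<^bsub>Q\<^esub> t"
    using assms(1) unfolding adic_completion_sel adic_quot_sel A_RCOSETS_def' by blast
  obtain i i' where i: "i \<in> apow k" "i' \<in> apow k" "x = i \<oplus>\<^bsub>Q\<^esub> t" "y = i' \<oplus>\<^bsub>Q\<^esub> t"
    using assms(2,3) unfolding t(2) a_r_coset_def' by blast
  have ic: "i \<in> carrier Q" "i' \<in> carrier Q" using i J.Icarr by blast+
  have "i \<ominus>\<^bsub>Q\<^esub> i' \<in> apow k"
    using i J.a_closed J.a_inv_closed by (simp add: a_minus_def)
  then obtain z where z: "z \<in> carrier Q" "i \<ominus>\<^bsub>Q\<^esub> i' = z \<otimes>\<^bsub>Q\<^esub> a [^]\<^bsub>Q\<^esub> k"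
    unfolding cgenideal_def by blast
  have "x = y \<oplus>\<^bsub>Q\<^esub> (i \<ominus>\<^bsub>Q\<^esub> i')"
    unfolding i using ic t(1) by algebra
  then show "\<exists>z\<in>carrier Q. x = y \<oplus>\<^bsub>Q\<^esub> z \<otimes>\<^bsub>Q\<^esub> a [^]\<^bsub>Q\<^esub> k" using z by metis
qed

lemma adic_coset_self: "x \<in> carrier Q \<Longrightarrow> x \<in> apow k +>\<^bsub>Q\<^esub> x"
proof -
  interpret J: ideal "apow k" Q by (rule adic_ideal)
  show "x \<in> carrier Q \<Longrightarrow> ?thesis" by (rule J.a_rcos_self)
qed

lemma adic_coset_nonempty:
  assumes "F \<in> carrier (adic_completion Q a)"
  shows "\<exists>x\<in>carrier Q. x \<in> F k"
  using assms adic_coset_self unfolding adic_completion_sel adic_quot_sel A_RCOSETS_def' by blast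

end

text \<open>What makes the description of \<open>gl_eval_one\<close> by \<open>THE\<close>
  meaningful: \<open>complete\<close> gives a limit of the representatives' values and
  \<open>separated\<close> its uniqueness. Both speak of divisibility in \<open>S\<close>, since
  \<open>gl_eval_one\<close> is defined by the ideals generated by the powers of
  \<open>p\<close>.\<close>

locale padic_complete_subring =
  fixes p :: nat and S :: "'a::field_char_0 set"
  assumes subring_S: "subring S ambient"
    and separated: "(\<And>k. \<exists>y\<in>S. x = of_nat p ^ k * y) \<Longrightarrow> x = 0"
    and complete: "(\<And>k. u k \<in> S) \<Longrightarrow> (\<And>k. \<exists>y\<in>S. u (Suc k) - u k = of_nat p ^ k * y) \<Longrightarrow>
                   \<exists>l\<in>S. \<forall>k. \<exists>y\<in>S. l - u k = of_nat p ^ k * y"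
begin

lemmas S_ops = subring_ambient_closed[OF subring_S]

definition P :: "('a, 'n::finite) gl_poly set" where
  "P = {f. \<forall>m. Poly_Mapping.lookup f m \<in> S}"

lemma carrier_gl_poly_ring [simp]: "carrier (gl_poly_ring S) = P"
  by (simp add: gl_poly_ring_def P_def)

lemma gl_poly_ring_sel [simp]:
  "\<one>\<^bsub>gl_poly_ring S\<^esub> = 1" "f \<oplus>\<^bsub>gl_poly_ring S\<^esub> g = f + g" "f \<otimes>\<^bsub>gl_poly_ring S\<^esub> g = f * g"
  by (simp_all add: gl_poly_ring_def)

lemma subring_P: "subring P ambient"
  unfolding P_def by (rule subring_gl_poly[OF subring_S])

lemmas P_ops = subring_ambient_closed[OF subring_P]

lemma gl_const_closed: "a \<in> S \<Longrightarrow> gl_const a \<in> P"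
  by (auto simp: P_def gl_const_def lookup_single when_def S_ops)

lemma gl_var_closed: "gl_var v \<in> P"
  by (auto simp: P_def gl_var_def lookup_single when_def S_ops)

lemma gl_relation_closed: "gl_var None * gl_det - 1 \<in> (P :: ('a, 'n::finite) gl_poly set)"
proof -
  have "(of_int n :: ('a, 'n) gl_poly) \<in> P" for n
  proof (cases n rule: int_cases2)
    case (nonneg k)
    then show ?thesis using P_ops(8)[of k] by simp
  next
    case (nonpos k)
    then show ?thesis using P_ops(5)[OF P_ops(8)[of k]] by simp
  qed
  then have "(gl_det :: ('a, 'n) gl_poly) \<in> P"
    unfolding gl_det_def det_def by (intro P_ops(9) P_ops(4) P_ops(10)) (simp_all add: gl_var_closed)
  then show ?thesis by (intro P_ops gl_var_closed)
qed

lemma eval_one_closed: "f \<in> P \<Longrightarrow> gl_poly_eval_one f \<in> S"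
proof -
  assume f: "f \<in> P"
  have "one_point v \<in> S" for v :: "('n \<times> 'n) option"
    by (auto simp: one_point_def S_ops split: option.split)
  then have "monom_at_one m \<in> S" for m :: "('n \<times> 'n) option \<Rightarrow>\<^sub>0 nat"
    unfolding monom_at_one_def by (intro S_ops)
  then show ?thesis
    unfolding gl_poly_eval_one_alt using f by (intro S_ops) (auto simp: P_def)
qed

lemma gl_poly_ring_cring: "cring (gl_poly_ring S :: ('a, 'n::finite) gl_poly ring)"
  unfolding gl_poly_ring_def by (rule subring_of_cring[OF subring_P[unfolded P_def]])

lemma gl_ideal_ideal: "ideal (gl_ideal S) (gl_poly_ring S :: ('a, 'n::finite) gl_poly ring)"
proof -
  interpret cring "gl_poly_ring S :: ('a, 'n) gl_poly ring" by (rule gl_poly_ring_cring)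
  show ?thesis unfolding gl_ideal_def using gl_relation_closed by (intro cgenideal_ideal) simp
qed

lemma gl_ring_cring: "cring (gl_ring S :: ('a, 'n::finite) gl_poly set ring)"
  unfolding gl_ring_def using ideal.quotient_is_cring[OF gl_ideal_ideal gl_poly_ring_cring] .

lemma gl_class_hom: "gl_class S \<in> ring_hom (gl_poly_ring S) (gl_ring S :: ('a, 'n::finite) gl_poly set ring)"
proof -
  have "gl_class S = (+>\<^bsub>gl_poly_ring S\<^esub>) (gl_ideal S :: ('a, 'n) gl_poly set)"
    by (simp add: gl_class_def fun_eq_iff)
  then show ?thesis unfolding gl_ring_def using ideal.rcos_ring_hom[OF gl_ideal_ideal] by metis
qed

lemma gl_class_closed: "f \<in> P \<Longrightarrow> gl_class S f \<in> carrier (gl_ring S)"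
  using ring_hom_closed[OF gl_class_hom, of f] by simp

lemma gl_class_add: "f \<in> P \<Longrightarrow> g \<in> P \<Longrightarrow> gl_class S (f + g) = gl_class S f \<oplus>\<^bsub>gl_ring S\<^esub> gl_class S g"
  using ring_hom_add[OF gl_class_hom, of f g] by simp

lemma gl_class_mult: "f \<in> P \<Longrightarrow> g \<in> P \<Longrightarrow> gl_class S (f * g) = gl_class S f \<otimes>\<^bsub>gl_ring S\<^esub> gl_class S g"
  using ring_hom_mult[OF gl_class_hom, of f g] by simp

lemma gl_class_one: "gl_class S 1 = \<one>\<^bsub>gl_ring S\<^esub>"
  using ring_hom_one[OF gl_class_hom] by simp

lemma gl_class_power: "f \<in> P \<Longrightarrow> gl_class S (f ^ n) = gl_class S f [^]\<^bsub>gl_ring S\<^esub> n"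
  by (induction n) (simp_all add: gl_class_one gl_class_mult P_ops(7) mult.commute[of f])

lemma gl_class_surj:
  assumes "V \<in> carrier (gl_ring S)"
  shows "\<exists>f\<in>P. V = gl_class S f"
proof -
  have "V \<in> a_rcosets\<^bsub>gl_poly_ring S\<^esub> gl_ideal S"
    using assms by (simp add: gl_ring_def FactRing_def)
  then show ?thesis unfolding A_RCOSETS_def' gl_class_def carrier_gl_poly_ring by blast
qed

text \<open>Two representatives differ by a multiple of the determinant relation, which evaluates to
  \<open>1 * 1 - 1\<close>.\<close>

lemma gl_class_eqD:
  assumes f: "f \<in> P" and g: "g \<in> P" and eq: "gl_class S f = gl_class S g"
  shows "gl_poly_eval_one f = gl_poly_eval_one g"
proof -
  interpret J: ideal "gl_ideal S" "gl_poly_ring S :: ('a, 'b) gl_poly ring" by (rule gl_ideal_ideal)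
  have "f \<in> gl_ideal S +>\<^bsub>gl_poly_ring S\<^esub> g"
    using J.a_rcos_self[of f] f eq by (simp add: gl_class_def)
  then obtain i where i: "i \<in> gl_ideal S" "f = i + g"
    unfolding a_r_coset_def' by (auto simp: gl_poly_ring_def)
  then obtain h where "i = (gl_var None * gl_det - 1) * h"
    unfolding gl_ideal_def gl_poly_ring_def PIdl_subring_of by blast
  then have "gl_poly_eval_one i = 0"
    by (simp add: eval_one_mult eval_one_diff eval_one_det eval_one_one eval_one_var one_point_def)
  then show ?thesis using i by (simp add: eval_one_add)
qed

abbreviation gp :: "('a, 'n::finite) gl_poly set" where
  "gp \<equiv> gl_class S (gl_const (of_nat p))"

lemma gp_closed: "gp \<in> carrier (gl_ring S)"
  by (intro gl_class_closed gl_const_closed S_ops)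

lemma gl_hat_ring_cring: "cring (gl_hat_ring p S :: ('a, 'n::finite) gl_hat ring)"
  unfolding gl_hat_ring_def by (rule adic_completion_cring[OF gl_ring_cring gp_closed])

lemma gl_hat_of_closed: "f \<in> P \<Longrightarrow> gl_hat_of p S f \<in> carrier (gl_hat_ring p S)"
  unfolding gl_hat_of_def gl_hat_ring_def
  by (intro adic_of_closed[OF gl_ring_cring gp_closed] gl_class_closed)

lemma gl_hat_rep:
  assumes "F \<in> carrier (gl_hat_ring p S)"
  shows "\<exists>f\<in>P. gl_class S f \<in> F k"
proof -
  obtain x where "x \<in> carrier (gl_ring S)" "x \<in> F k"
    using adic_coset_nonempty[OF gl_ring_cring gp_closed assms[unfolded gl_hat_ring_def]] by blast
  then show ?thesis using gl_class_surj by metis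
qed

text \<open>At level \<open>k\<close> representatives differ by a multiple of \<open>p ^ k\<close>,
  up to the determinant relation; evaluation preserves the former and kills the latter.\<close>

lemma gl_hat_rep_diff:
  assumes F: "F \<in> carrier (gl_hat_ring p S)" and f: "f \<in> P" "gl_class S f \<in> F k" and g: "g \<in> P" "gl_class S g \<in> F k"
  shows "\<exists>y\<in>S. gl_poly_eval_one f - gl_poly_eval_one g = of_nat p ^ k * y"
proof -
  obtain z where z: "z \<in> carrier (gl_ring S)"
      "gl_class S f = gl_class S g \<oplus>\<^bsub>gl_ring S\<^esub> z \<otimes>\<^bsub>gl_ring S\<^esub> gp [^]\<^bsub>gl_ring S\<^esub> k"
    using adic_coset_diff[OF gl_ring_cring gp_closed F[unfolded gl_hat_ring_def] f(2) g(2)] by blast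
  obtain h where h: "h \<in> P" "z = gl_class S h" using gl_class_surj[OF z(1)] by blast
  note pP = gl_const_closed[OF S_ops(8)]
  have "gl_class S f = gl_class S (g + h * gl_const (of_nat p) ^ k)"
    unfolding gl_class_add[OF g(1) P_ops(4)[OF h(1) P_ops(7)[OF pP]]]
      gl_class_mult[OF h(1) P_ops(7)[OF pP]] gl_class_power[OF pP] z(2) h(2) by (rule refl)
  then have "gl_poly_eval_one f = gl_poly_eval_one (g + h * gl_const (of_nat p) ^ k)"
    using f(1) g(1) h(1) pP by (intro gl_class_eqD P_ops)
  then have "gl_poly_eval_one f - gl_poly_eval_one g = of_nat p ^ k * gl_poly_eval_one h"
    by (simp add: eval_one_add eval_one_mult eval_one_const flip: gl_const_power)
  then show ?thesis using eval_one_closed[OF h(1)] by blast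
qed

text \<open>The definition tests all representatives at every level. One good representative per
  level suffices, because any other one has the same value modulo \<open>p ^ k\<close>.\<close>

lemma gl_eval_one_eqI:
  assumes F: "F \<in> carrier (gl_hat_ring p S)" and r: "r \<in> S"
    and ex: "\<And>k. \<exists>f\<in>P. gl_class S f \<in> F k \<and> (\<exists>y\<in>S. r - gl_poly_eval_one f = of_nat p ^ k * y)"
  shows "gl_eval_one p S F = r"
proof -
  have close: "\<exists>y\<in>S. r - gl_poly_eval_one f = of_nat p ^ k * y" if f: "f \<in> P" "gl_class S f \<in> F k" for k f
  proof -
    obtain g y where g: "g \<in> P" "gl_class S g \<in> F k" "y \<in> S" "r - gl_poly_eval_one g = of_nat p ^ k * y"
      using ex by blast
    obtain z where z: "z \<in> S" "gl_poly_eval_one g - gl_poly_eval_one f = of_nat p ^ k * z"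
      using gl_hat_rep_diff[OF F g(1,2) f] by blast
    have "r - gl_poly_eval_one f = of_nat p ^ k * (y + z)"
      using g(4) z(2) by (simp add: algebra_simps)
    then show ?thesis using g z S_ops(3) by blast
  qed
  show ?thesis unfolding gl_eval_one_def
  proof (rule the_equality)
    show "r \<in> S \<and> (\<forall>k. \<forall>f\<in>carrier (gl_poly_ring S). gl_class S f \<in> F k \<longrightarrow>
        r - gl_poly_eval_one f \<in> PIdl\<^bsub>subring_of S\<^esub> (of_nat p ^ k))"
      using r close by (simp add: PIdl_subring_of)
    fix r' assume r': "r' \<in> S \<and> (\<forall>k. \<forall>f\<in>carrier (gl_poly_ring S). gl_class S f \<in> F k \<longrightarrow>
        r' - gl_poly_eval_one f \<in> PIdl\<^bsub>subring_of S\<^esub> (of_nat p ^ k))"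
    have "\<exists>y\<in>S. r' - r = of_nat p ^ k * y" for k
    proof -
      obtain f where f: "f \<in> P" "gl_class S f \<in> F k" using gl_hat_rep[OF F] by blast
      obtain y where y: "y \<in> S" "r - gl_poly_eval_one f = of_nat p ^ k * y" using close[OF f] by blast
      obtain y' where y': "y' \<in> S" "r' - gl_poly_eval_one f = of_nat p ^ k * y'"
        using r' f by (auto simp: PIdl_subring_of)
      have "r' - r = of_nat p ^ k * (y' - y)" using y(2) y'(2) by (simp add: algebra_simps)
      then show ?thesis using y y' S_ops(6) by blast
    qed
    then have "r' - r = 0" by (rule separated)
    then show "r' = r" by simp
  qed
qed

text \<open>A representative at level \<open>k + 1\<close> is also one at level \<open>k\<close>, so
  the values of any choice of representatives form a \<open>p\<close>-adic Cauchy sequence in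
  \<open>S\<close>.\<close>

lemma gl_eval_one_rep:
  assumes F: "F \<in> carrier (gl_hat_ring p S)"
  shows "gl_eval_one p S F \<in> S"
    and "\<exists>f\<in>P. gl_class S f \<in> F k \<and> (\<exists>y\<in>S. gl_eval_one p S F - gl_poly_eval_one f = of_nat p ^ k * y)"
proof -
  have "\<forall>k. \<exists>f. f \<in> P \<and> gl_class S f \<in> F k" using gl_hat_rep[OF F] by blast
  then obtain f where f: "\<And>k. f k \<in> P" "\<And>k. gl_class S (f k) \<in> F k" by metis
  have "F (Suc k) \<subseteq> F k" for k
    using F unfolding gl_hat_ring_def adic_completion_sel[OF gl_ring_cring gp_closed] by blast
  then have "\<exists>y\<in>S. gl_poly_eval_one (f (Suc k)) - gl_poly_eval_one (f k) = of_nat p ^ k * y" for k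
    using f by (intro gl_hat_rep_diff[OF F]) blast+
  then obtain l where l: "l \<in> S" "\<And>k. \<exists>y\<in>S. l - gl_poly_eval_one (f k) = of_nat p ^ k * y"
    using complete[of "\<lambda>k. gl_poly_eval_one (f k)"] eval_one_closed[OF f(1)] by blast
  have "gl_eval_one p S F = l"
    by (rule gl_eval_one_eqI[OF F l(1)]) (use f l(2) in blast)
  then show "gl_eval_one p S F \<in> S"
      "\<exists>f\<in>P. gl_class S f \<in> F k \<and> (\<exists>y\<in>S. gl_eval_one p S F - gl_poly_eval_one f = of_nat p ^ k * y)"
    using l f by blast+
qed

lemma gl_eval_one_hat_of:
  assumes f: "f \<in> P"
  shows "gl_eval_one p S (gl_hat_of p S f) = gl_poly_eval_one f"
proof (rule gl_eval_one_eqI[OF gl_hat_of_closed[OF f] eval_one_closed[OF f]])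
  fix k
  have "gl_class S f \<in> gl_hat_of p S f k"
    unfolding gl_hat_of_def adic_of_def
    by (rule adic_coset_self[OF gl_ring_cring gp_closed gl_class_closed[OF f]])
  then show "\<exists>f'\<in>P. gl_class S f' \<in> gl_hat_of p S f k \<and>
      (\<exists>y\<in>S. gl_poly_eval_one f - gl_poly_eval_one f' = of_nat p ^ k * y)"
    using f S_ops(2) by (intro bexI[of _ f] conjI bexI[of _ 0]) auto
qed

lemma gl_eval_one_hom:
  "gl_eval_one p S \<in> ring_hom (gl_hat_ring p S :: ('a, 'n::finite) gl_hat ring) (subring_of S)"
proof (rule ring_hom_memI)
  interpret A: cring "gl_hat_ring p S :: ('a, 'n) gl_hat ring" by (rule gl_hat_ring_cring)
  note sel = adic_completion_sel[OF gl_ring_cring gp_closed, folded gl_hat_ring_def]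
  note qsel = adic_quot_sel[OF gl_ring_cring gp_closed]
  show "gl_eval_one p S F \<in> carrier (subring_of S)" if "F \<in> carrier (gl_hat_ring p S)" for F :: "('a, 'n) gl_hat"
    using gl_eval_one_rep(1)[OF that] by simp
  have "gl_hat_of p S 1 = \<one>\<^bsub>gl_hat_ring p S :: ('a, 'n) gl_hat ring\<^esub>"
    by (simp add: gl_hat_of_def adic_of_def sel qsel gl_class_one)
  then show "gl_eval_one p S \<one>\<^bsub>gl_hat_ring p S :: ('a, 'n) gl_hat ring\<^esub> = \<one>\<^bsub>subring_of S\<^esub>"
    using gl_eval_one_hat_of[OF P_ops(1)] by (metis eval_one_one one_subring_of)
  fix F G :: "('a, 'n) gl_hat"
  assume F: "F \<in> carrier (gl_hat_ring p S)" and G: "G \<in> carrier (gl_hat_ring p S)"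
  let ?r = "gl_eval_one p S F" and ?t = "gl_eval_one p S G"
  have rt: "?r \<in> S" "?t \<in> S" using F G gl_eval_one_rep(1) by auto
  have "\<exists>h\<in>P. gl_class S h \<in> (F \<oplus>\<^bsub>gl_hat_ring p S\<^esub> G) k \<and> (\<exists>y\<in>S. ?r + ?t - gl_poly_eval_one h = of_nat p ^ k * y)"
    and "\<exists>h\<in>P. gl_class S h \<in> (F \<otimes>\<^bsub>gl_hat_ring p S\<^esub> G) k \<and> (\<exists>y\<in>S. ?r * ?t - gl_poly_eval_one h = of_nat p ^ k * y)" for k
  proof -
    obtain f y where f: "f \<in> P" "gl_class S f \<in> F k" and y: "y \<in> S" "?r - gl_poly_eval_one f = of_nat p ^ k * y"
      using gl_eval_one_rep(2)[OF F, of k] by auto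
    obtain g z where g: "g \<in> P" "gl_class S g \<in> G k" and z: "z \<in> S" "?t - gl_poly_eval_one g = of_nat p ^ k * z"
      using gl_eval_one_rep(2)[OF G, of k] by auto
    have "gl_class S (f + g) \<in> (F \<oplus>\<^bsub>gl_hat_ring p S\<^esub> G) k"
      unfolding sel qsel gl_class_add[OF f(1) g(1)] using f(2) g(2) by blast
    moreover have "?r + ?t - gl_poly_eval_one (f + g) = of_nat p ^ k * (y + z)"
      using y(2) z(2) by (simp add: eval_one_add algebra_simps)
    ultimately show "\<exists>h\<in>P. gl_class S h \<in> (F \<oplus>\<^bsub>gl_hat_ring p S\<^esub> G) k \<and> (\<exists>y\<in>S. ?r + ?t - gl_poly_eval_one h = of_nat p ^ k * y)"
      using P_ops(3)[OF f(1) g(1)] S_ops(3)[OF y(1) z(1)] by blast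
    interpret Q: cring "gl_ring S :: ('a, 'n) gl_poly set ring" by (rule gl_ring_cring)
    have "gl_class S f \<otimes>\<^bsub>gl_ring S\<^esub> gl_class S g \<in>
        PIdl\<^bsub>gl_ring S\<^esub> (gp [^]\<^bsub>gl_ring S\<^esub> k) +>\<^bsub>gl_ring S\<^esub> (gl_class S f \<otimes>\<^bsub>gl_ring S\<^esub> gl_class S g)"
      by (intro adic_coset_self[OF gl_ring_cring gp_closed] Q.m_closed gl_class_closed f g)
    then have "gl_class S (f * g) \<in> (F \<otimes>\<^bsub>gl_hat_ring p S\<^esub> G) k"
      unfolding sel qsel gl_class_mult[OF f(1) g(1)] using f(2) g(2) by blast
    moreover have "?r * ?t - gl_poly_eval_one (f * g) =
        (?r - gl_poly_eval_one f) * ?t + gl_poly_eval_one f * (?t - gl_poly_eval_one g)"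
      by (simp add: eval_one_mult algebra_simps)
    then have "?r * ?t - gl_poly_eval_one (f * g) = of_nat p ^ k * (y * ?t + gl_poly_eval_one f * z)"
      unfolding y(2) z(2) by (simp add: algebra_simps)
    moreover have "y * ?t + gl_poly_eval_one f * z \<in> S" by (intro S_ops y z rt eval_one_closed f)
    ultimately show "\<exists>h\<in>P. gl_class S h \<in> (F \<otimes>\<^bsub>gl_hat_ring p S\<^esub> G) k \<and> (\<exists>y\<in>S. ?r * ?t - gl_poly_eval_one h = of_nat p ^ k * y)"
      using P_ops(4)[OF f(1) g(1)] by blast
  qed
  then show "gl_eval_one p S (F \<otimes>\<^bsub>gl_hat_ring p S\<^esub> G) = ?r \<otimes>\<^bsub>subring_of S\<^esub> ?t"
    and "gl_eval_one p S (F \<oplus>\<^bsub>gl_hat_ring p S\<^esub> G) = ?r \<oplus>\<^bsub>subring_of S\<^esub> ?t"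
    using F G rt S_ops(3,4) by (auto intro!: gl_eval_one_eqI)
qed

end

text \<open>The axioms are made for this: \<pi> times the additivity defect is
  \<open>p * Cp\<close>, which cancels the defect of the \<open>p ^ s\<close>-th power, and the
  product rule is the expansion of a product of two twisted values. Passing through \<epsilon> means
  that \<open>\<pi> * (p / \<pi>) = p\<close> is needed only in a field, not in
  \<open>A\<close>.\<close>

lemma higher_pi_derivation_hom:
  fixes S :: "'a::field_char_0 set"
  assumes p: "Factorial_Ring.prime (p::nat)" and A: "cring A" and S: "subring S ambient"
    and \<epsilon>: "\<epsilon> \<in> ring_hom A (subring_of S)"
    and d: "higher_pi_derivation A p s q t d" and q: "q \<in> carrier A" and t: "t \<in> carrier A"
    and \<pi>: "\<epsilon> q = of_nat p / \<pi>" "\<epsilon> t = \<pi>" "\<pi> \<noteq> 0"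
  shows "(\<lambda>x. \<epsilon> x ^ (p ^ s) + \<pi> * \<epsilon> (d x)) \<in> ring_hom A (subring_of S)"
proof -
  interpret A: cring A by (rule A)
  have S': "cring (subring_of S)" by (rule subring_of_cring[OF S])
  interpret h: ring_hom_cring A "subring_of S" \<epsilon>
    by (rule ring_hom_cring.intro[OF A S' ring_hom_cring_axioms.intro[OF \<epsilon>]])
  note S_ops = subring_ambient_closed[OF S]
  have dc: "d x \<in> carrier A" if "x \<in> carrier A" for x
    using d that by (auto simp: higher_pi_derivation_def)
  have \<epsilon>c: "\<epsilon> x \<in> S" if "x \<in> carrier A" for x using h.hom_closed[OF that] by simp
  have \<pi>S: "\<pi> \<in> S" using \<epsilon>c[OF t] \<pi> by simp
  have pow: "\<epsilon> (x [^]\<^bsub>A\<^esub> n) = \<epsilon> x ^ n" if "x \<in> carrier A" for x and n :: nat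
  proof (induction n)
    case (Suc n)
    have "\<epsilon> (x [^]\<^bsub>A\<^esub> Suc n) = \<epsilon> (x [^]\<^bsub>A\<^esub> n) * \<epsilon> x" using that h.hom_mult[of "x [^]\<^bsub>A\<^esub> n" x] by simp
    then show ?case using Suc by simp
  qed (use h.hom_one in simp)
  have npow: "\<epsilon> (add_pow A n x) = of_nat n * \<epsilon> x" if x: "x \<in> carrier A" for n :: nat and x
  proof (induction n)
    case (Suc n)
    have "\<epsilon> (add_pow A (Suc n) x) = \<epsilon> (add_pow A n x \<oplus>\<^bsub>A\<^esub> x)" using x by simp
    also have "\<dots> = \<epsilon> (add_pow A n x) + \<epsilon> x" using x by (subst h.hom_add) auto
    finally show ?case using Suc by (simp add: algebra_simps)
  qed simp
  have Cp: "Cp A p s x y \<in> carrier A"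
    "of_nat p * \<epsilon> (Cp A p s x y) = \<epsilon> x ^ (p ^ s) + \<epsilon> y ^ (p ^ s) - (\<epsilon> x + \<epsilon> y) ^ (p ^ s)"
    if x: "x \<in> carrier A" and y: "y \<in> carrier A" for x y
  proof -
    define g where "g k = add_pow A ((p ^ s choose k) div p) (x [^]\<^bsub>A\<^esub> k \<otimes>\<^bsub>A\<^esub> y [^]\<^bsub>A\<^esub> (p ^ s - k))" for k
    have g: "g k \<in> carrier A" for k using x y by (simp add: g_def)
    have \<epsilon>g: "\<epsilon> (g k) = of_nat ((p ^ s choose k) div p) * (\<epsilon> x ^ k * \<epsilon> y ^ (p ^ s - k))" for k
    proof -
      have "\<epsilon> (x [^]\<^bsub>A\<^esub> k \<otimes>\<^bsub>A\<^esub> y [^]\<^bsub>A\<^esub> (p ^ s - k)) = \<epsilon> x ^ k * \<epsilon> y ^ (p ^ s - k)"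
        using x y by (subst h.hom_mult) (auto simp: pow)
      then show ?thesis using x y by (simp add: g_def npow)
    qed
    have C: "Cp A p s x y = \<ominus>\<^bsub>A\<^esub> (\<Oplus>\<^bsub>A\<^esub>k\<in>{0<..<p ^ s}. g k)"
      by (simp add: Cp_def g_def)
    have sumc: "(\<Oplus>\<^bsub>A\<^esub>k\<in>{0<..<p ^ s}. g k) \<in> carrier A" using g by (intro A.finsum_closed) auto
    then show "Cp A p s x y \<in> carrier A" by (simp add: C)
    have "\<epsilon> (\<Oplus>\<^bsub>A\<^esub>k\<in>{0<..<p ^ s}. g k) = (\<Oplus>\<^bsub>subring_of S\<^esub>k\<in>{0<..<p ^ s}. \<epsilon> (g k))"
      using g by (subst h.hom_finsum) (auto simp: o_def)
    also have "\<dots> = (\<Sum>k\<in>{0<..<p ^ s}. \<epsilon> (g k))"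
      by (rule finsum_subring_of[OF S]) (simp add: \<epsilon>c g)
    finally have sum: "\<epsilon> (\<Oplus>\<^bsub>A\<^esub>k\<in>{0<..<p ^ s}. g k) = (\<Sum>k\<in>{0<..<p ^ s}. \<epsilon> (g k))" .
    have "\<epsilon> (Cp A p s x y) = - \<epsilon> (\<Oplus>\<^bsub>A\<^esub>k\<in>{0<..<p ^ s}. g k)"
      unfolding C using sumc h.hom_a_inv[OF sumc] by (simp add: a_inv_subring_of[OF S] \<epsilon>c)
    then have "\<epsilon> (Cp A p s x y) = - (\<Sum>k\<in>{0<..<p ^ s}. of_nat ((p ^ s choose k) div p) * (\<epsilon> x ^ k * \<epsilon> y ^ (p ^ s - k)))"
      by (simp add: sum \<epsilon>g)
    then show "of_nat p * \<epsilon> (Cp A p s x y) = \<epsilon> x ^ (p ^ s) + \<epsilon> y ^ (p ^ s) - (\<epsilon> x + \<epsilon> y) ^ (p ^ s)"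
      using add_power_prime_power[OF p, of "\<epsilon> x" "\<epsilon> y" s] by simp
  qed
  show ?thesis
  proof (rule ring_hom_memI)
    show "\<epsilon> x ^ (p ^ s) + \<pi> * \<epsilon> (d x) \<in> carrier (subring_of S)" if "x \<in> carrier A" for x
      using that \<pi>S \<epsilon>c dc by (auto intro!: S_ops(3,4,7))
    have "d \<one>\<^bsub>A\<^esub> = \<zero>\<^bsub>A\<^esub>" using d by (simp add: higher_pi_derivation_def)
    then show "\<epsilon> \<one>\<^bsub>A\<^esub> ^ (p ^ s) + \<pi> * \<epsilon> (d \<one>\<^bsub>A\<^esub>) = \<one>\<^bsub>subring_of S\<^esub>" using h.hom_one h.hom_zero by simp
    fix x y assume x: "x \<in> carrier A" and y: "y \<in> carrier A"
    have add: "\<epsilon> (u \<oplus>\<^bsub>A\<^esub> v) = \<epsilon> u + \<epsilon> v" if "u \<in> carrier A" "v \<in> carrier A" for u v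
      using h.hom_add[OF that] by simp
    have mult: "\<epsilon> (u \<otimes>\<^bsub>A\<^esub> v) = \<epsilon> u * \<epsilon> v" if "u \<in> carrier A" "v \<in> carrier A" for u v
      using h.hom_mult[OF that] by simp
    have "d (x \<oplus>\<^bsub>A\<^esub> y) = d x \<oplus>\<^bsub>A\<^esub> d y \<oplus>\<^bsub>A\<^esub> q \<otimes>\<^bsub>A\<^esub> Cp A p s x y"
      using d x y by (simp add: higher_pi_derivation_def)
    then have "\<epsilon> (d (x \<oplus>\<^bsub>A\<^esub> y)) = \<epsilon> (d x) + \<epsilon> (d y) + of_nat p / \<pi> * \<epsilon> (Cp A p s x y)"
      using x y q by (simp add: add mult dc Cp \<pi>)
    then have "\<pi> * \<epsilon> (d (x \<oplus>\<^bsub>A\<^esub> y)) = \<pi> * \<epsilon> (d x) + \<pi> * \<epsilon> (d y) + of_nat p * \<epsilon> (Cp A p s x y)"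
      using \<pi>(3) by (simp add: field_simps)
    then show "\<epsilon> (x \<oplus>\<^bsub>A\<^esub> y) ^ (p ^ s) + \<pi> * \<epsilon> (d (x \<oplus>\<^bsub>A\<^esub> y)) =
        (\<epsilon> x ^ (p ^ s) + \<pi> * \<epsilon> (d x)) \<oplus>\<^bsub>subring_of S\<^esub> (\<epsilon> y ^ (p ^ s) + \<pi> * \<epsilon> (d y))"
      using x y by (simp add: add Cp(2))
    have "d (x \<otimes>\<^bsub>A\<^esub> y) = x [^]\<^bsub>A\<^esub> (p ^ s) \<otimes>\<^bsub>A\<^esub> d y \<oplus>\<^bsub>A\<^esub> y [^]\<^bsub>A\<^esub> (p ^ s) \<otimes>\<^bsub>A\<^esub> d x
            \<oplus>\<^bsub>A\<^esub> t \<otimes>\<^bsub>A\<^esub> d x \<otimes>\<^bsub>A\<^esub> d y"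
      using d x y by (simp add: higher_pi_derivation_def)
    then have "\<epsilon> (d (x \<otimes>\<^bsub>A\<^esub> y)) = \<epsilon> x ^ (p ^ s) * \<epsilon> (d y) + \<epsilon> y ^ (p ^ s) * \<epsilon> (d x) + \<pi> * \<epsilon> (d x) * \<epsilon> (d y)"
      using x y t by (simp add: add mult dc pow \<pi>)
    then show "\<epsilon> (x \<otimes>\<^bsub>A\<^esub> y) ^ (p ^ s) + \<pi> * \<epsilon> (d (x \<otimes>\<^bsub>A\<^esub> y)) =
        (\<epsilon> x ^ (p ^ s) + \<pi> * \<epsilon> (d x)) \<otimes>\<^bsub>subring_of S\<^esub> (\<epsilon> y ^ (p ^ s) + \<pi> * \<epsilon> (d y))"
      using x y by (simp add: mult power_mult_distrib algebra_simps)
  qed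
qed

section \<open>Parallel vectors\<close>

context odd_padic_universe
begin

text \<open>The generator lies in the ideal it generates, so it is small; and this ideal contains
  the nonzero element \<open>p\<close>, so the generator is nonzero.\<close>

lemma prime_element_nv:
  assumes E: "finite_galois_ext (Qp nv) E" and pe: "prime_element_of nv E \<pi>"
  shows "\<pi> \<noteq> 0" "nv \<pi> < 1"
proof -
  have "subfield E ambient" using E by (simp add: finite_galois_ext_def finite_field_ext_def)
  then have sr: "subring E ambient" by (rule subfieldE)
  have "1 \<in> integers_of nv E" using subring_ambient_one[OF sr] by (simp add: integers_of_def)
  then have "\<pi> \<in> PIdl\<^bsub>subring_of (integers_of nv E)\<^esub> \<pi>"
    unfolding PIdl_subring_of by (intro bexI[of _ 1]) auto
  then show "nv \<pi> < 1" using pe by (auto simp: prime_element_of_def)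
  have "of_nat p \<in> {x \<in> E. nv x < 1}"
    using subring_ambient_of_nat[OF sr, of p] p_gt_1 by (simp add: nv_p)
  then obtain y where "of_nat p = \<pi> * y"
    using pe unfolding prime_element_of_def by (auto simp: PIdl_subring_of)
  then show "\<pi> \<noteq> 0" using of_nat_p_nz by force
qed

lemma adjoin_Rur:
  assumes \<pi>: "nv \<pi> \<le> 1"
  shows "subring (adjoin (Rur nv) \<pi>) ambient" "Rur nv \<subseteq> adjoin (Rur nv) \<pi>" "\<pi> \<in> adjoin (Rur nv) \<pi>"
    "y \<in> adjoin (Rur nv) \<pi> \<Longrightarrow> nv y \<le> 1"
proof -
  interpret field "ambient :: 'a ring" by (rule field_from_type_algebra)
  show "subring (adjoin (Rur nv) \<pi>) ambient" unfolding adjoin_def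
    by (rule simple_extension_is_subring[OF subring_Rur]) simp
  show "Rur nv \<subseteq> adjoin (Rur nv) \<pi>" unfolding adjoin_def
    by (rule simple_extension_incl) auto
  show "\<pi> \<in> adjoin (Rur nv) \<pi>" unfolding adjoin_def
    by (rule simple_extension_mem[OF subring_Rur]) simp
  show "nv y \<le> 1" if "y \<in> adjoin (Rur nv) \<pi>"
    using that unfolding adjoin_def
    by (induction rule: simple_extension.induct) (auto intro: nv_add_le[OF nv_mult_le[OF _ \<pi>] nv_Rur])
qed

lemma Rur_p_powerE:
  assumes "x \<in> Rur nv" "nv x \<le> 1 * (1 / real p) ^ k"
  shows "\<exists>y\<in>Rur nv. x = of_nat p ^ k * y"
proof -
  have "nv (x / of_nat p ^ k) \<le> 1"
    using assms(2) by (simp add: nv_divide nv_power nv_p field_simps)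
  moreover have "x / of_nat p ^ k \<in> Ur.A_frac"
    using assms(1) unfolding Ur.A_frac_def Rur_eq by (auto intro!: exI[of _ k])
  ultimately have "x / of_nat p ^ k \<in> Rur nv" unfolding Rur_eq by (intro Ur.A_frac_integral)
  then show ?thesis by (intro bexI[of _ "x / of_nat p ^ k"]) auto
qed

text \<open>Completeness holds coordinate by coordinate over \<open>Rur\<close>. Expanding the
  quotients of the successive differences by \<open>p ^ k\<close>, and not the terms
  \<open>u k\<close>, gives coordinates whose partial sums visibly converge.\<close>

lemma padic_complete_free_module:
  fixes \<theta> :: "'a ^ 'n::finite"
  assumes S: "subring S ambient" "Rur nv \<subseteq> S" "\<And>y. y \<in> S \<Longrightarrow> nv y \<le> 1" and \<theta>: "is_basis (Rur nv) S \<theta>"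
  shows "padic_complete_subring p S"
proof (rule padic_complete_subring.intro[OF S(1)])
  note S_ops = subring_ambient_closed[OF S(1)]
  have \<theta>S: "\<theta> $ i \<in> S" for i using \<theta> by (auto simp: is_basis_def vecs_def)
  show "x = 0" if x: "\<And>k. \<exists>y\<in>S. x = of_nat p ^ k * y" for x
  proof (rule eq_if_nv_le_powers)
    fix k
    obtain y where y: "y \<in> S" "x = of_nat p ^ k * y" using x by blast
    show "nv (x - 0) \<le> 1 * (1 / real p) ^ k"
      using nv_mult_le[of "of_nat p ^ k" "(1 / real p) ^ k" y] S(3)[OF y(1)] y(2) by (simp add: nv_power nv_p)
  qed
  fix u assume u: "\<And>k. u k \<in> S" and du: "\<And>k. \<exists>y\<in>S. u (Suc k) - u k = of_nat p ^ k * y"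
  have "\<exists>a. a \<in> vecs (Rur nv) \<and> u (Suc k) - u k = of_nat p ^ k * (\<Sum>i\<in>UNIV. a $ i * \<theta> $ i)" for k
  proof -
    obtain y where y: "y \<in> S" "u (Suc k) - u k = of_nat p ^ k * y" using du by blast
    then show ?thesis using \<theta> unfolding is_basis_def by metis
  qed
  then obtain a where a: "\<And>k. a k \<in> vecs (Rur nv)"
      "\<And>k. u (Suc k) - u k = of_nat p ^ k * (\<Sum>i\<in>UNIV. a k $ i * \<theta> $ i)" by metis
  have aR: "a k $ i \<in> Rur nv" for k i using a(1) by (auto simp: vecs_def)
  define v where "v i k = (\<Sum>j<k. of_nat p ^ j * a j $ i)" for i k
  have vR: "v i k \<in> Rur nv" for i k unfolding v_def by (intro Rur_ops aR)
  have "nv (v i (Suc k) - v i k) \<le> 1 * (1 / real p) ^ k" for i k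
    using nv_mult_le[of "of_nat p ^ k" "(1 / real p) ^ k"] nv_Rur[OF aR] by (simp add: v_def nv_power nv_p)
  then have "\<exists>l\<in>Rur nv. \<forall>k. nv (l - v i k) \<le> 1 * (1 / real p) ^ k" for i
    by (intro Rur_limit vR)
  then obtain l where l: "\<And>i. l i \<in> Rur nv" "\<And>i k. nv (l i - v i k) \<le> 1 * (1 / real p) ^ k" by metis
  define L where "L = u 0 + (\<Sum>i\<in>UNIV. l i * \<theta> $ i)"
  have uk: "u k = u 0 + (\<Sum>i\<in>UNIV. v i k * \<theta> $ i)" for k
  proof (induction k)
    case (Suc k)
    have "u (Suc k) = u k + (\<Sum>i\<in>UNIV. of_nat p ^ k * a k $ i * \<theta> $ i)"
      using a(2)[of k] by (simp add: sum_distrib_left mult.assoc algebra_simps)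
    also have "\<dots> = u 0 + (\<Sum>i\<in>UNIV. (v i k + of_nat p ^ k * a k $ i) * \<theta> $ i)"
      using Suc by (simp add: sum.distrib algebra_simps)
    finally show ?case by (simp add: v_def)
  qed (simp add: v_def)
  have "L \<in> S" unfolding L_def using l S(2) by (intro S_ops u \<theta>S) auto
  moreover have "\<exists>y\<in>S. L - u k = of_nat p ^ k * y" for k
  proof -
    have "\<exists>b\<in>Rur nv. l i - v i k = of_nat p ^ k * b" for i
      by (intro Rur_p_powerE Rur_ops l vR)
    then obtain b where b: "\<And>i. b i \<in> Rur nv" "\<And>i. l i - v i k = of_nat p ^ k * b i" by metis
    have "L - u k = (\<Sum>i\<in>UNIV. (l i - v i k) * \<theta> $ i)"
      by (subst uk) (simp add: L_def left_diff_distrib sum_subtractf)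
    also have "\<dots> = of_nat p ^ k * (\<Sum>i\<in>UNIV. b i * \<theta> $ i)"
      by (simp add: b sum_distrib_left mult.assoc)
    finally have "L - u k = of_nat p ^ k * (\<Sum>i\<in>UNIV. b i * \<theta> $ i)" .
    moreover have "(\<Sum>i\<in>UNIV. b i * \<theta> $ i) \<in> S" using b S(2) by (intro S_ops \<theta>S) auto
    ultimately show ?thesis by blast
  qed
  ultimately show "\<exists>l\<in>S. \<forall>k. \<exists>y\<in>S. l - u k = of_nat p ^ k * y" by blast
qed

end

section \<open>The linear functional attached to a curve\<close>

context
  fixes R S :: "'a::field_char_0 set" and \<theta> c :: "'a ^ 'n::finite"
  assumes R: "subring R ambient" and basis: "is_basis R S \<theta>" and S: "subring S ambient" and RS: "R \<subseteq> S"
begin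

lemma coordsI:
  assumes "u \<in> vecs R" "a = (\<Sum>i\<in>UNIV. u $ i * \<theta> $ i)"
  shows "coords R \<theta> a = u"
proof -
  have "a \<in> S" unfolding assms(2)
    using assms(1) RS basis
    by (intro subring_ambient_closed[OF S]) (auto simp: vecs_def is_basis_def)
  then have "\<exists>!u. u \<in> vecs R \<and> a = (\<Sum>i\<in>UNIV. u $ i * \<theta> $ i)" using basis by (simp add: is_basis_def)
  then show ?thesis unfolding coords_def using assms by (intro the1_equality) auto
qed

lemma coords_rep:
  assumes "a \<in> S"
  shows "coords R \<theta> a \<in> vecs R" "a = (\<Sum>i\<in>UNIV. coords R \<theta> a $ i * \<theta> $ i)"
proof -
  obtain u where "u \<in> vecs R" "a = (\<Sum>i\<in>UNIV. u $ i * \<theta> $ i)"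
    using basis assms unfolding is_basis_def by metis
  then show "coords R \<theta> a \<in> vecs R" "a = (\<Sum>i\<in>UNIV. coords R \<theta> a $ i * \<theta> $ i)"
    using coordsI by metis+
qed

lemma curve_star_closed: "c \<in> vecs R \<Longrightarrow> a \<in> S \<Longrightarrow> curve_star R \<theta> c a \<in> R"
  unfolding curve_star_def using coords_rep(1)[of a]
  by (intro subring_ambient_closed[OF R]) (auto simp: vecs_def)

lemma curve_star_add:
  assumes "a \<in> S" "b \<in> S"
  shows "curve_star R \<theta> c (a + b) = curve_star R \<theta> c a + curve_star R \<theta> c b"
proof -
  have "coords R \<theta> (a + b) = coords R \<theta> a + coords R \<theta> b"
  proof (rule coordsI)
    show "coords R \<theta> a + coords R \<theta> b \<in> vecs R"
      using coords_rep(1)[OF assms(1)] coords_rep(1)[OF assms(2)] subring_ambient_add[OF R]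
      by (simp add: vecs_def)
    show "a + b = (\<Sum>i\<in>UNIV. (coords R \<theta> a + coords R \<theta> b) $ i * \<theta> $ i)"
      using coords_rep(2)[OF assms(1)] coords_rep(2)[OF assms(2)]
      by (simp add: distrib_right sum.distrib)
  qed
  then show ?thesis by (simp add: curve_star_def distrib_right sum.distrib)
qed

lemma curve_star_scale:
  assumes "x \<in> R" "a \<in> S"
  shows "curve_star R \<theta> c (x * a) = x * curve_star R \<theta> c a"
proof -
  have "coords R \<theta> (x * a) = x *s coords R \<theta> a"
  proof (rule coordsI)
    show "x *s coords R \<theta> a \<in> vecs R"
      using coords_rep(1)[OF assms(2)] assms(1) subring_ambient_mult[OF R] by (simp add: vecs_def)
    have "x * a = x * (\<Sum>i\<in>UNIV. coords R \<theta> a $ i * \<theta> $ i)" using coords_rep(2)[OF assms(2)] by simp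
    then show "x * a = (\<Sum>i\<in>UNIV. (x *s coords R \<theta> a) $ i * \<theta> $ i)"
      by (simp add: sum_distrib_left mult.assoc)
  qed
  then show ?thesis by (simp add: curve_star_def sum_distrib_left mult.assoc)
qed

lemma curve_star_sum:
  assumes "finite J" "\<And>j. j \<in> J \<Longrightarrow> f j \<in> S"
  shows "curve_star R \<theta> c (sum f J) = (\<Sum>j\<in>J. curve_star R \<theta> c (f j))"
  using assms
proof (induction J rule: finite_induct)
  case empty
  show ?case
    using curve_star_scale[of 0 0] subring_ambient_zero[OF R] subring_ambient_zero[OF S] by simp
next
  case (insert j J)
  then show ?case using curve_star_add[of "f j" "sum f J"] subring_ambient_sum[OF S, of J f] by simp
qed

end

text \<open>
  On \<open>R\<close> every twisted map \<open>a \<mapsto> a ^ (p ^ s) + \<pi> * d i a\<close> is \<open>\<phi> ^^ s\<close>. Applying the twisted map on the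
  coordinate ring to the entries of \<open>x w\<close> therefore gives the derivations of these entries.
\<close>

lemma eval_connection_mat_vec:
  fixes \<pi> :: "'a::{alg_closed_field, field_char_0}" and w :: "'a ^ 'n::finite"
  assumes fp: "frobenius_power p nv s \<Phi>" and S: "padic_complete_subring p S"
    and RS: "Rur nv \<subseteq> S" and nvS: "\<And>y. y \<in> S \<Longrightarrow> nv y \<le> 1"
    and \<pi>: "\<pi> \<in> S" "\<pi> \<noteq> 0" "nv \<pi> < 1" "of_nat p / \<pi> \<in> S"
    and d: "\<And>i. higher_pi_derivation (subring_of S) p s (of_nat p / \<pi>) \<pi> (d i)"
    and D: "pi_connection p s S \<pi> d D" and w: "w \<in> vecs (Rur nv)"
  shows "gl_eval_one p S (D i (gl_mat_vec p S w k)) =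
           (\<Phi> (w $ k) - (w $ k) ^ (p ^ s)) / \<pi> +
           (\<Sum>j\<in>UNIV. gl_eval_one p S (D i (gl_hat_of p S (gl_var (Some (k, j))))) * \<Phi> (w $ j))"
proof -
  interpret frobenius_power p nv s \<Phi> by (rule fp)
  interpret S: padic_complete_subring p S by (rule S)
  let ?A = "gl_hat_ring p S :: ('a, 'n) gl_hat ring"
  let ?\<epsilon> = "gl_eval_one p S :: ('a, 'n) gl_hat \<Rightarrow> 'a"
  interpret A: cring ?A by (rule S.gl_hat_ring_cring)
  have SC: "cring (subring_of S)" by (rule subring_of_cring[OF S.subring_S])
  have wR: "w $ j \<in> Rur nv" for j using w by (auto simp: vecs_def)
  have wS: "w $ j \<in> S" for j using wR RS by blast
  have cc: "gl_hat_const p S a \<in> carrier ?A" if "a \<in> S" for a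
    by (intro S.gl_hat_of_closed S.gl_const_closed that)
  have ce: "?\<epsilon> (gl_hat_const p S a) = a" if "a \<in> S" for a
    using S.gl_eval_one_hat_of[OF S.gl_const_closed[OF that]] by (simp add: eval_one_const)
  have vc: "gl_hat_of p S (gl_var v) \<in> carrier ?A" for v
    by (intro S.gl_hat_of_closed S.gl_var_closed)
  have ve: "?\<epsilon> (gl_hat_of p S (gl_var (Some (a, b)))) = (if a = b then 1 else 0)" for a b
    by (subst S.gl_eval_one_hat_of[OF S.gl_var_closed]) (simp add: eval_one_var one_point_def)
  have Di: "higher_pi_derivation ?A p s (gl_hat_const p S (of_nat p / \<pi>)) (gl_hat_const p S \<pi>) (D i)"
    and Dc: "D i (gl_hat_const p S a) = gl_hat_const p S (d i a)" if "a \<in> S" for a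
    using D that by (auto simp: pi_connection_def)
  define \<psi> where "\<psi> F = ?\<epsilon> F ^ (p ^ s) + \<pi> * ?\<epsilon> (D i F)" for F
  have \<psi>: "\<psi> \<in> ring_hom ?A (subring_of S)"
    unfolding \<psi>_def
    by (rule higher_pi_derivation_hom[where \<epsilon> = ?\<epsilon>, OF prime_p A.is_cring S.subring_S S.gl_eval_one_hom
          Di[OF \<pi>(1)] cc[OF \<pi>(4)] cc[OF \<pi>(1)] ce[OF \<pi>(4)] ce[OF \<pi>(1)] \<pi>(2)])
  interpret \<psi>: ring_hom_cring ?A "subring_of S" \<psi>
    by (rule ring_hom_cring.intro[OF A.is_cring SC ring_hom_cring_axioms.intro[OF \<psi>]])
  define f where "f a = a ^ (p ^ s) + \<pi> * d i a" for a
  have dS: "d i a \<in> S" if "a \<in> S" for a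
    using d[of i] that by (auto simp: higher_pi_derivation_def)
  have id: "(\<lambda>x. x) \<in> ring_hom (subring_of S) (subring_of S)" by (auto intro!: ring_hom_memI)
  have fS: "f \<in> ring_hom (subring_of S) (subring_of S)"
    unfolding f_def
    using higher_pi_derivation_hom[where \<epsilon> = "\<lambda>x. x", OF prime_p SC S.subring_S id d[of i] _ _ refl refl \<pi>(2)] \<pi> by simp
  have fR: "f \<in> ring_hom (subring_of (Rur nv)) (subring_of S)"
    using subsetD[OF RS] subring_hom_closed[OF S.subring_S fS] subring_hom_add[OF S.subring_S fS]
      subring_hom_mult[OF S.subring_S fS] subring_hom_one[OF S.subring_S fS]
    by (intro ring_hom_memI) auto
  have PhiS: "\<Phi> \<in> ring_hom (subring_of (Rur nv)) (subring_of S)"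
    using Phi_hom RS by (auto simp: ring_hom_def)
  have fPhi: "f a = \<Phi> a" if a: "a \<in> Rur nv" for a
  proof (rule ring_hom_Rur_unique[OF fR PhiS nvS _ _ a])
    \<comment> \<open>Both maps are compared with \<open>x ^ (p ^ s)\<close>: \<open>f\<close>
      differs from it by a multiple of \<pi> and \<Phi> by a multiple of \<open>p\<close>. Agreement
      within any radius below 1 is enough for uniqueness.\<close>
    show "max (nv \<pi>) (1 / real p) < 1" using \<pi>(3) p_gt_1 by simp
    fix x assume x: "x \<in> Rur nv"
    have "nv (\<pi> * d i x) \<le> nv \<pi>" using x RS by (intro nv_mult_le nvS dS) auto
    moreover have "nv (\<Phi> x - x ^ (p ^ s)) \<le> 1 / real p"
      by (intro Rur_nv_less_1_le Phi_lift x Rur_ops Phi_closed)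
    moreover have "f x - \<Phi> x = \<pi> * d i x - (\<Phi> x - x ^ (p ^ s))" by (simp add: f_def)
    ultimately show "nv (f x - \<Phi> x) \<le> max (nv \<pi>) (1 / real p)"
      by (metis nv_diff_le max.coboundedI1 max.coboundedI2)
  qed
  have \<psi>c: "\<psi> (gl_hat_const p S (w $ j)) = \<Phi> (w $ j)" for j
    using fPhi[OF wR, of j] by (simp add: \<psi>_def f_def ce wS Dc dS)
  define \<Gamma> where "\<Gamma> j = ?\<epsilon> (D i (gl_hat_of p S (gl_var (Some (k, j)))))" for j
  have \<psi>v: "\<psi> (gl_hat_of p S (gl_var (Some (k, j)))) = (if k = j then 1 else 0) + \<pi> * \<Gamma> j" for j
    by (simp add: \<psi>_def \<Gamma>_def ve)
  \<comment> \<open>\<open>D i\<close> is not additive in general, so the entry of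
    \<open>x w\<close> is expanded under the two ring homomorphisms \<epsilon> and \<psi> instead;
    the derivative is then recovered from \<psi> by subtracting the \<open>p ^ s\<close>-th power
    and dividing by \<pi>.\<close>
  have expand: "h (gl_mat_vec p S w k) = (\<Sum>j\<in>UNIV. h (gl_hat_of p S (gl_var (Some (k, j)))) * h (gl_hat_const p S (w $ j)))"
    if h: "h \<in> ring_hom ?A (subring_of S)" for h
  proof -
    interpret h: ring_hom_cring ?A "subring_of S" h
      by (rule ring_hom_cring.intro[OF A.is_cring SC ring_hom_cring_axioms.intro[OF h]])
    have "h (gl_mat_vec p S w k) = (\<Oplus>\<^bsub>subring_of S\<^esub>j\<in>UNIV.
        h (gl_hat_of p S (gl_var (Some (k, j))) \<otimes>\<^bsub>?A\<^esub> gl_hat_const p S (w $ j)))"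
      unfolding gl_mat_vec_def using vc cc[OF wS] by (subst h.hom_finsum) (auto simp: o_def)
    also have "\<dots> = (\<Sum>j\<in>UNIV. h (gl_hat_of p S (gl_var (Some (k, j))) \<otimes>\<^bsub>?A\<^esub> gl_hat_const p S (w $ j)))"
      using h.hom_closed[OF A.m_closed[OF vc cc[OF wS]]] by (intro finsum_subring_of[OF S.subring_S]) simp
    also have "\<dots> = (\<Sum>j\<in>UNIV. h (gl_hat_of p S (gl_var (Some (k, j)))) * h (gl_hat_const p S (w $ j)))"
      using h.hom_mult[OF vc cc[OF wS]] by simp
    finally show ?thesis .
  qed
  have "?\<epsilon> (gl_mat_vec p S w k) = (\<Sum>j\<in>UNIV. (if k = j then 1 else 0) * w $ j)"
    using expand[OF S.gl_eval_one_hom] by (simp add: ve ce wS)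
  also have "\<dots> = (\<Sum>j\<in>UNIV. if k = j then w $ j else 0)" by (intro sum.cong) auto
  finally have \<epsilon>w: "?\<epsilon> (gl_mat_vec p S w k) = w $ k" by simp
  have "\<psi> (gl_mat_vec p S w k) = (\<Sum>j\<in>UNIV. ((if k = j then 1 else 0) + \<pi> * \<Gamma> j) * \<Phi> (w $ j))"
    using expand[OF \<psi>] by (simp add: \<psi>v \<psi>c)
  also have "\<dots> = (\<Sum>j\<in>UNIV. (if k = j then \<Phi> (w $ j) else 0) + \<pi> * (\<Gamma> j * \<Phi> (w $ j)))"
    by (intro sum.cong) (auto simp: algebra_simps)
  also have "\<dots> = \<Phi> (w $ k) + \<pi> * (\<Sum>j\<in>UNIV. \<Gamma> j * \<Phi> (w $ j))"
    by (simp add: sum.distrib sum_distrib_left)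
  finally have "(w $ k) ^ (p ^ s) + \<pi> * ?\<epsilon> (D i (gl_mat_vec p S w k)) =
      \<Phi> (w $ k) + \<pi> * (\<Sum>j\<in>UNIV. \<Gamma> j * \<Phi> (w $ j))"
    by (simp add: \<psi>_def \<epsilon>w)
  then show ?thesis
    unfolding \<Gamma>_def[symmetric] using \<pi>(2) by (simp add: field_simps)
qed

theorem theorem3p16:
  fixes p s :: nat
    and nv :: "'a::{alg_closed_field, field_char_0} \<Rightarrow> real"
    and R K E R\<pi> :: "'a set" and \<pi> :: 'a
    and \<phi> :: "'a \<Rightarrow> 'a"
    and \<theta> r c w0 :: "'a ^ 'n::finite"
    and d :: "'n \<Rightarrow> 'a \<Rightarrow> 'a"
    and D :: "'n \<Rightarrow> ('a, 'n) gl_hat \<Rightarrow> ('a, 'n) gl_hat"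
  defines "R \<equiv> Rur nv" and "K \<equiv> adjoin R (1 / of_nat p)" and "R\<pi> \<equiv> adjoin R \<pi>"
  assumes "padic_universe p nv" and "odd p" and "s \<ge> 1"
    and "finite_galois_ext (Qp nv) E" and "prime_element_of nv E \<pi>"
    and "ring.dimension ambient CARD('n) K (generate_field ambient (K \<union> {\<pi>}))"
    and "frobenius_lift p R \<phi>"
    and "is_basis R R\<pi> \<theta>"
    and "r \<in> vecs R" and "of_nat p / \<pi> = (\<Sum>l\<in>UNIV. r $ l * \<theta> $ l)"
    and "\<forall>i. higher_pi_derivation (subring_of R\<pi>) p s (of_nat p / \<pi>) \<pi> (d i)"
    and "pi_connection p s R\<pi> \<pi> d D"
    and "c \<in> vecs R" and "nondegenerate p s R \<phi> r c"
    and "w0 \<in> vecs R"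
  shows "\<exists>!w. w \<in> vecs R \<and> parallel_along p s R R\<pi> \<phi> \<theta> D c w \<and>
              (\<forall>i. w $ i - w0 $ i \<in> PIdl\<^bsub>subring_of R\<^esub> (of_nat p))"
proof -
  interpret odd_padic_universe p nv
    using \<open>padic_universe p nv\<close> \<open>odd p\<close> by (intro odd_padic_universe.intro odd_padic_universe_axioms.intro)
  define \<Phi> where "\<Phi> = \<phi> ^^ s"
  have lift: "frobenius_lift p (Rur nv) \<phi>" using assms(10) by (simp add: R_def)
  have fp: "frobenius_power p nv s \<Phi>"
    unfolding \<Phi>_def
    by (intro frobenius_power.intro frobenius_power_axioms.intro odd_padic_universe_axioms
        \<open>s \<ge> 1\<close> frobenius_lift_funpow[OF lift])
  interpret frobenius_power p nv s \<Phi> by (rule fp)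
  have \<pi>: "\<pi> \<noteq> 0" "nv \<pi> < 1"
    using prime_element_nv[OF \<open>finite_galois_ext (Qp nv) E\<close> \<open>prime_element_of nv E \<pi>\<close>] .
  note adj = adjoin_Rur[OF less_imp_le[OF \<pi>(2)], folded R_def, folded R\<pi>_def]
  note R = subring_Rur[folded R_def]
  note basis = \<open>is_basis R R\<pi> \<theta>\<close>
  have S: "padic_complete_subring p R\<pi>"
    by (rule padic_complete_free_module[folded R_def, OF adj(1,2,4) basis])
  interpret S: padic_complete_subring p R\<pi> by (rule S)
  have \<theta>S: "\<theta> $ i \<in> R\<pi>" for i using basis by (auto simp: is_basis_def vecs_def)
  have p\<pi>: "of_nat p / \<pi> \<in> R\<pi>"
    unfolding \<open>of_nat p / \<pi> = _\<close> using \<open>r \<in> vecs R\<close> adj(2)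
    by (intro S.S_ops \<theta>S) (auto simp: vecs_def)
  note PhiR = Phi_closed[folded R_def]
  have cR: "c $ i \<in> R" for i using \<open>c \<in> vecs R\<close> by (auto simp: vecs_def)
  define v where "v = velocity p \<phi> s c"
  have delta: "delta p \<phi> s a = (\<Phi> a - a ^ (p ^ s)) / of_nat p" for a by (simp add: delta_def \<Phi>_def)
  have deltaR: "delta p \<phi> s a \<in> R" if a: "a \<in> R" for a
  proof -
    have "\<Phi> a - a ^ (p ^ s) \<in> Rur nv" using a unfolding R_def by (intro Rur_ops Phi_closed)
    then obtain y where "y \<in> Rur nv" "\<Phi> a - a ^ (p ^ s) = of_nat p * y"
      using Rur_pE Phi_lift a unfolding R_def by blast
    then show ?thesis by (simp add: delta R_def)
  qed
  have vR: "v $ i \<in> R" for i by (simp add: v_def velocity_def deltaR cR)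
  have nd: "nv (\<Sum>l\<in>UNIV. r $ l * c $ l) = 1" "nv (\<Sum>l\<in>UNIV. v $ l) = 1"
  proof -
    have "(\<Sum>l\<in>UNIV. r $ l * c $ l) \<in> Rur nv" "(\<Sum>l\<in>UNIV. v $ l) \<in> Rur nv"
      using \<open>r \<in> vecs R\<close> cR vR unfolding R_def by (auto intro!: Rur_ops(4,9) simp: vecs_def)
    with \<open>nondegenerate p s R \<phi> r c\<close> nv_Rur
    show "nv (\<Sum>l\<in>UNIV. r $ l * c $ l) = 1" "nv (\<Sum>l\<in>UNIV. v $ l) = 1"
      unfolding nondegenerate_def R_def Rur_PIdl_iff v_def[symmetric] by (force simp: not_less)+
  qed
  define rc where "rc = (\<Sum>l\<in>UNIV. r $ l * c $ l)"
  \<comment> \<open>The future coefficient of \<open>delta p \<phi> s (w $ k)\<close>: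
    \<open>rc\<close> is the image of \<open>p / \<pi>\<close> under the functional, and the other
    factor is \<Phi> of the sum of the velocity. Since \<Phi> preserves absolute values, both
    factors have absolute value 1.\<close>
  define u where "u = (\<Sum>i\<in>UNIV. \<Phi> (v $ i)) * rc"
  have rcR: "rc \<in> R" unfolding rc_def using \<open>r \<in> vecs R\<close> cR
    by (intro subring_ambient_closed[OF R]) (auto simp: vecs_def)
  have VR: "(\<Sum>i\<in>UNIV. \<Phi> (v $ i)) \<in> R" by (intro subring_ambient_closed[OF R] PhiR vR)
  have uR: "u \<in> R" unfolding u_def by (intro subring_ambient_closed[OF R] rcR VR)
  have "(\<Sum>i\<in>UNIV. \<Phi> (v $ i)) = \<Phi> (\<Sum>i\<in>UNIV. v $ i)"
    using vR by (simp add: Phi_sum R_def)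
  moreover have "(\<Sum>i\<in>UNIV. v $ i) \<in> Rur nv" using vR unfolding R_def by (intro Rur_ops)
  ultimately have nvu: "nv u = 1" using nd by (simp add: u_def rc_def nv_mult nv_Phi)
  then have u0: "u \<noteq> 0" by auto
  have uinv: "inverse u \<in> R" using Rur_unit uR nvu by (simp add: R_def)
  define \<Gamma> where "\<Gamma> i k j = gl_eval_one p R\<pi> (D i (gl_hat_of p R\<pi> (gl_var (Some (k, j)))))" for i k j
  have DA: "D i F \<in> carrier (gl_hat_ring p R\<pi>)" if "F \<in> carrier (gl_hat_ring p R\<pi>)" for i F
    using \<open>pi_connection p s R\<pi> \<pi> d D\<close> that by (auto simp: pi_connection_def higher_pi_derivation_def)
  have \<Gamma>S: "\<Gamma> i k j \<in> R\<pi>" for i k j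
    unfolding \<Gamma>_def by (intro S.gl_eval_one_rep(1) DA S.gl_hat_of_closed S.gl_var_closed)
  define B where "B k j = curve_star R \<theta> c (\<Sum>i\<in>UNIV. \<Phi> (v $ i) * \<Gamma> i k j)" for k j
  have PhivS: "\<Phi> (v $ i) \<in> R\<pi>" for i using PhiR[OF vR] adj(2) by blast
  have sumS: "(\<Sum>i\<in>UNIV. \<Phi> (v $ i) * \<Gamma> i k j) \<in> R\<pi>" for k j
    by (intro S.S_ops PhivS \<Gamma>S)
  have BR: "B k j \<in> R" for k j
    unfolding B_def by (rule curve_star_closed[OF R basis adj(1,2) \<open>c \<in> vecs R\<close> sumS])
  \<comment> \<open>By uniqueness of coordinates in the basis, those of \<open>p / \<pi>\<close> are
    the given \<open>r\<close>.\<close>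
  have star_p\<pi>: "curve_star R \<theta> c (of_nat p / \<pi>) = rc"
    using coordsI[OF R basis adj(1,2) \<open>r \<in> vecs R\<close> \<open>of_nat p / \<pi> = _\<close>] by (simp add: curve_star_def rc_def)
  let ?A = "gl_hat_ring p R\<pi> :: ('a, 'n) gl_hat ring"
  interpret A: cring ?A by (rule S.gl_hat_ring_cring)
  interpret e: ring_hom_cring ?A "subring_of R\<pi>" "gl_eval_one p R\<pi>"
    by (rule ring_hom_cring.intro[OF A.is_cring subring_of_cring[OF adj(1)]
          ring_hom_cring_axioms.intro[OF S.gl_eval_one_hom]])
  have parallel: "curve_star R \<theta> c (gl_eval_one p R\<pi> (directional p s R\<pi> \<phi> D v (gl_mat_vec p R\<pi> w k))) =
      u * delta p \<phi> s (w $ k) + (\<Sum>j\<in>UNIV. B k j * \<Phi> (w $ j))" if w: "w \<in> vecs R" for w k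
  proof -
    have wR: "w $ j \<in> R" for j using w by (auto simp: vecs_def)
    have wS: "w $ j \<in> R\<pi>" for j using wR adj(2) by blast
    have mv: "gl_mat_vec p R\<pi> w k \<in> carrier ?A"
      unfolding gl_mat_vec_def
      by (intro A.finsum_closed Pi_I A.m_closed S.gl_hat_of_closed S.gl_var_closed S.gl_const_closed wS)
    have cA: "gl_hat_const p R\<pi> (\<Phi> (v $ i)) \<in> carrier ?A" for i
      by (intro S.gl_hat_of_closed S.gl_const_closed PhivS)
    have ce: "gl_eval_one p R\<pi> (gl_hat_const p R\<pi> (\<Phi> (v $ i)) :: ('a, 'n) gl_hat) = \<Phi> (v $ i)" for i
      using S.gl_eval_one_hat_of[OF S.gl_const_closed[OF PhivS]] by (simp add: eval_one_const)
    have "gl_eval_one p R\<pi> (directional p s R\<pi> \<phi> D v (gl_mat_vec p R\<pi> w k)) =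
        (\<Oplus>\<^bsub>subring_of R\<pi>\<^esub>i\<in>UNIV. gl_eval_one p R\<pi> (gl_hat_const p R\<pi> (\<Phi> (v $ i)) \<otimes>\<^bsub>?A\<^esub> D i (gl_mat_vec p R\<pi> w k)))"
      unfolding directional_def \<Phi>_def[symmetric]
      using cA DA[OF mv] by (subst e.hom_finsum) (auto simp: o_def)
    also have "\<dots> = (\<Sum>i\<in>UNIV. gl_eval_one p R\<pi> (gl_hat_const p R\<pi> (\<Phi> (v $ i)) \<otimes>\<^bsub>?A\<^esub> D i (gl_mat_vec p R\<pi> w k)))"
      using e.hom_closed[OF A.m_closed[OF cA DA[OF mv]]] by (intro finsum_subring_of[OF adj(1)]) simp
    also have "\<dots> = (\<Sum>i\<in>UNIV. \<Phi> (v $ i) * gl_eval_one p R\<pi> (D i (gl_mat_vec p R\<pi> w k)))"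
      using e.hom_mult[OF cA DA[OF mv]] ce by simp
    also have "\<dots> = (\<Sum>i\<in>UNIV. \<Phi> (v $ i) * ((\<Phi> (w $ k) - (w $ k) ^ (p ^ s)) / \<pi> + (\<Sum>j\<in>UNIV. \<Gamma> i k j * \<Phi> (w $ j))))"
      using eval_connection_mat_vec[OF fp S adj(2)[unfolded R_def] adj(4,3) \<pi> p\<pi> _ \<open>pi_connection p s R\<pi> \<pi> d D\<close> w[unfolded R_def]]
        \<open>\<forall>i. higher_pi_derivation _ p s _ \<pi> (d i)\<close> by (simp add: \<Gamma>_def)
    \<comment> \<open>Division by \<pi> leaves \<open>R\<close>. Splitting off
      \<open>p / \<pi>\<close> leaves a coefficient in \<open>R\<close>, which the
      \<open>R\<close>-linear functional can pull out.\<close>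
    also have "\<dots> = (\<Sum>i\<in>UNIV. \<Phi> (v $ i)) * delta p \<phi> s (w $ k) * (of_nat p / \<pi>) +
        (\<Sum>i\<in>UNIV. \<Sum>j\<in>UNIV. \<Phi> (w $ j) * (\<Phi> (v $ i) * \<Gamma> i k j))"
    proof -
      have "\<Phi> (v $ i) * ((\<Phi> (w $ k) - (w $ k) ^ (p ^ s)) / \<pi> + (\<Sum>j\<in>UNIV. \<Gamma> i k j * \<Phi> (w $ j))) =
          \<Phi> (v $ i) * delta p \<phi> s (w $ k) * (of_nat p / \<pi>) + (\<Sum>j\<in>UNIV. \<Phi> (w $ j) * (\<Phi> (v $ i) * \<Gamma> i k j))" for i
        by (simp add: delta distrib_left sum_distrib_left mult_ac)
      then show ?thesis by (simp add: sum.distrib sum_distrib_right sum_divide_distrib)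
    qed
    \<comment> \<open>After the exchange the scalars \<open>\<Phi> (w $ j)\<close> of
      \<open>R\<close> stand outside; the inner sums do not involve \<open>w\<close>, and the
      functional turns them into the matrix \<open>B\<close>.\<close>
    also have "(\<Sum>i\<in>UNIV. \<Sum>j\<in>UNIV. \<Phi> (w $ j) * (\<Phi> (v $ i) * \<Gamma> i k j)) =
        (\<Sum>j\<in>UNIV. \<Phi> (w $ j) * (\<Sum>i\<in>UNIV. \<Phi> (v $ i) * \<Gamma> i k j))"
      by (subst sum.swap) (simp add: sum_distrib_left)
    finally have eq: "gl_eval_one p R\<pi> (directional p s R\<pi> \<phi> D v (gl_mat_vec p R\<pi> w k)) =
        (\<Sum>i\<in>UNIV. \<Phi> (v $ i)) * delta p \<phi> s (w $ k) * (of_nat p / \<pi>) +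
        (\<Sum>j\<in>UNIV. \<Phi> (w $ j) * (\<Sum>i\<in>UNIV. \<Phi> (v $ i) * \<Gamma> i k j))" .
    have PhiwS: "\<Phi> (w $ j) \<in> R\<pi>" for j using PhiR[OF wR] adj(2) by blast
    have aR: "(\<Sum>i\<in>UNIV. \<Phi> (v $ i)) * delta p \<phi> s (w $ k) \<in> R"
      by (intro subring_ambient_mult[OF R] VR deltaR wR)
    note star = curve_star_add[OF R basis adj(1,2)] curve_star_scale[OF R basis adj(1,2)]
      curve_star_sum[OF R basis adj(1,2)]
    define a where "a = (\<Sum>i\<in>UNIV. \<Phi> (v $ i)) * delta p \<phi> s (w $ k)"
    define g where "g j = (\<Sum>i\<in>UNIV. \<Phi> (v $ i) * \<Gamma> i k j)" for j
    have a: "a \<in> R" "a \<in> R\<pi>" using aR adj(2) by (auto simp: a_def)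
    have g: "g j \<in> R\<pi>" for j unfolding g_def by (rule sumS)
    have "curve_star R \<theta> c (a * (of_nat p / \<pi>) + (\<Sum>j\<in>UNIV. \<Phi> (w $ j) * g j)) =
        curve_star R \<theta> c (a * (of_nat p / \<pi>)) + curve_star R \<theta> c (\<Sum>j\<in>UNIV. \<Phi> (w $ j) * g j)"
      by (intro star S.S_ops a g p\<pi> PhiwS)
    also have "curve_star R \<theta> c (a * (of_nat p / \<pi>)) = a * rc"
      using star(2)[OF a(1) p\<pi>] star_p\<pi> by simp
    also have "curve_star R \<theta> c (\<Sum>j\<in>UNIV. \<Phi> (w $ j) * g j) = (\<Sum>j\<in>UNIV. curve_star R \<theta> c (\<Phi> (w $ j) * g j))"
      by (intro star S.S_ops g PhiwS) simp
    also have "\<dots> = (\<Sum>j\<in>UNIV. B k j * \<Phi> (w $ j))"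
      using star(2)[OF PhiR[OF wR] g] by (simp add: B_def g_def mult.commute)
    finally show ?thesis unfolding eq a_def g_def by (simp add: u_def mult_ac)
  qed
  \<comment> \<open>As \<open>u\<close> is a unit, its inverse moves into the matrix with entries
    still in \<open>R\<close>; clearing the denominator \<open>p\<close> of \<open>delta\<close>
    puts the factor \<open>p\<close> in front of the matrix term, which makes that term
    contracting.\<close>
  have iff: "parallel_along p s R R\<pi> \<phi> \<theta> D c w \<longleftrightarrow>
      (\<forall>k. \<Phi> (w $ k) = (w $ k) ^ (p ^ s) - of_nat p * (\<Sum>j\<in>UNIV. inverse u * B k j * \<Phi> (w $ j)))"
    if w: "w \<in> vecs R" for w
  proof -
    have "u * delta p \<phi> s (w $ k) + (\<Sum>j\<in>UNIV. B k j * \<Phi> (w $ j)) = 0 \<longleftrightarrow>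
      \<Phi> (w $ k) = (w $ k) ^ (p ^ s) - of_nat p * (\<Sum>j\<in>UNIV. inverse u * B k j * \<Phi> (w $ j))" for k
    proof -
      define t where "t = (\<Sum>j\<in>UNIV. inverse u * B k j * \<Phi> (w $ j))"
      have "(\<Sum>j\<in>UNIV. B k j * \<Phi> (w $ j)) = u * t"
        using u0 by (simp add: t_def sum_distrib_left mult.assoc[symmetric])
      then have "u * delta p \<phi> s (w $ k) + (\<Sum>j\<in>UNIV. B k j * \<Phi> (w $ j)) = u * (delta p \<phi> s (w $ k) + t)"
        by (simp add: distrib_left)
      then have "u * delta p \<phi> s (w $ k) + (\<Sum>j\<in>UNIV. B k j * \<Phi> (w $ j)) = 0 \<longleftrightarrow> delta p \<phi> s (w $ k) + t = 0"
        using u0 by simp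
      also have "\<dots> \<longleftrightarrow> \<Phi> (w $ k) = (w $ k) ^ (p ^ s) - of_nat p * t"
        by (simp add: delta field_simps)
      finally show ?thesis unfolding t_def .
    qed
    then show ?thesis unfolding parallel_along_def v_def[symmetric] parallel[OF w] by simp
  qed
  have cong: "(\<forall>i. w $ i - w0 $ i \<in> PIdl\<^bsub>subring_of R\<^esub> (of_nat p)) \<longleftrightarrow> (\<forall>i. nv (w $ i - w0 $ i) < 1)"
    if w: "w \<in> vecs R" for w
    using w \<open>w0 \<in> vecs R\<close> Rur_ops(6) unfolding R_def Rur_PIdl_iff by (auto simp: vecs_def)
  have ex1: "\<exists>!w. w \<in> vecs R \<and>
      (\<forall>k. \<Phi> (w $ k) = (w $ k) ^ (p ^ s) - of_nat p * (\<Sum>j\<in>UNIV. inverse u * B k j * \<Phi> (w $ j))) \<and>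
      (\<forall>i. nv (w $ i - w0 $ i) < 1)"
    using unique_fixed_point[of "\<lambda>k j. inverse u * B k j" w0, folded R_def]
      subring_ambient_mult[OF R uinv BR] \<open>w0 \<in> vecs R\<close> by blast
  have "w \<in> vecs R \<and> parallel_along p s R R\<pi> \<phi> \<theta> D c w \<and>
        (\<forall>i. w $ i - w0 $ i \<in> PIdl\<^bsub>subring_of R\<^esub> (of_nat p)) \<longleftrightarrow> w \<in> vecs R \<and>
      (\<forall>k. \<Phi> (w $ k) = (w $ k) ^ (p ^ s) - of_nat p * (\<Sum>j\<in>UNIV. inverse u * B k j * \<Phi> (w $ j))) \<and>
      (\<forall>i. nv (w $ i - w0 $ i) < 1)" for w
    using iff[of w] cong[of w] by blast
  then show ?thesis using ex1 by presburger
qed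

end
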